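(* A spherical random field belongs to the disjoint union of the classes of isotropic, diagonal anisotropic, and harmonic order-dependent anisotropic fields if and only if its spectrum satisfies $C_{\ell\ell'mm'}=\delta_\ell^{\ell'}\tilde C_{\ell mm'}$ for all $\ell,\ell',m,m'$ (for some numbers $\tilde C_{\ell mm'}$). In this case the covariance function admits the spectral representation $$C((\theta_1,\varphi_1),(\theta_2,\varphi_2))=\sum_{\ell\in\mathbb{N}_0}\sum_{m=-\ell}^{\ell}\sum_{m'=-\ell}^{\ell}\frac{2\ell+1}{4\pi}\left(\frac{(\ell-m)!(\ell-m')!}{(\ell+m)!(\ell+m')!}\right)^{1/2}\tilde C_{\ell mm'}\,e^{i(m\varphi_1-m'\varphi_2)}P_\ell^m(\cos\theta_1)P_\ell^{m'}(\cos\theta_2).$$ If the covariance function is twice differentiable, then this class can be equivalently characterized by the condition $$\Delta_{\mathbf{x}_1}C(\mathbf{x}_1,\mathbf{x}_2)=\Delta_{\mathbf{x}_2}C(\mathbf{x}_1,\mathbf{x}_2)\quad\text{for all }\mathbf{x}_1,\mathbf{x}_2\in\mathbb{S}^2,$$ where $\Delta_{\mathbf{x}}$ is the Laplace–Beltrami operator on the sphere.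
   Context: $(\theta,\varphi)$ are colatitude and longitude on the unit sphere $\mathbb{S}^2$. A spherical random field is a real-valued zero-mean second-order random field $T$ on $\mathbb{S}^2$ with continuous, not identically constant covariance function $C$. It is isotropic if $C(\mathbf{x}_1,\mathbf{x}_2)$ depends only on the great-circle distance of $\mathbf{x}_1,\mathbf{x}_2$. $Y_{\ell m}(\theta,\varphi)=e^{im\varphi}\left[\frac{(2\ell+1)(\ell-m)!}{4\pi(\ell+m)!}\right]^{1/2}P_\ell^m(\cos\theta)$, $|m|\le\ell$, are the orthonormal complex spherical harmonics, $P_\ell^m$ the associated Legendre functions with $P_\ell^{-m}=(-1)^m\frac{(\ell-m)!}{(\ell+m)!}P_\ell^m$ for $m>0$. The field is expanded as $T=\sum_{\ell,m}a_{\ell m}Y_{\ell m}$ with $a_{\ell m}=\int_{\mathbb{S}^2}T\,Y^*_{\ell m}\,d\mathbf{s}$ ($d\mathbf{s}$ surface measure), the series being taken to converge in $L_2(\Omega\times\mathbb{S}^2)$ and, at each $\mathbf{x}\in\mathbb{S}^2$, in $L_2(\Omega)$, where $\Omega$ is the underlying probability space. The spectrum is $C_{\ell\ell'mm'}=\mathbf{E}(a_{\ell m}a^*_{\ell'm'})$, and $C(\mathbf{x}_1,\mathbf{x}_2)=\sum_{\ell,\ell',m,m'}C_{\ell\ell'mm'}Y_{\ell m}(\mathbf{x}_1)Y^*_{\ell'm'}(\mathbf{x}_2)$. Isotropy is equivalent to $C_{\ell\ell'mm'}=\delta_\ell^{\ell'}\delta_m^{m'}C_\ell$. Harmonic order-dependent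 anisotropic: $C_{\ell\ell'mm'}=\delta_\ell^{\ell'}\tilde C_{\ell mm'}$ with $\tilde C_{\ell mm'}\neq0$ for some $\ell$ and some $m\ne m'$ in $\{-\ell,\dots,\ell\}$. Diagonal anisotropic: $C_{\ell\ell'mm'}=\delta_\ell^{\ell'}\delta_m^{m'}C_{\ell m}$ with $C_{\ell m}\neq C_{\ell m'}$ for some $\ell$ and some $m\neq m'$ in $\{-\ell,\dots,\ell\}$. In coordinates, $\Delta_{(\theta,\varphi)}=\frac{1}{\sin\theta}\frac{\partial}{\partial\theta}\left(\sin\theta\frac{\partial}{\partial\theta}\right)+\frac{1}{\sin^2\theta}\frac{\partial^2}{\partial\varphi^2}$. *)

theory Defs
  imports "HOL-Probability.Probability" "HOL-Computational_Algebra.Polynomial"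
begin

section \<open>The unit sphere in colatitude-longitude coordinates\<close>

abbreviation S2 :: "(real ^ 3) set" where
  "S2 \<equiv> sphere 0 1"

definition sph_point :: "real \<Rightarrow> real \<Rightarrow> real ^ 3" where
  "sph_point \<theta> \<phi> = vector [sin \<theta> * cos \<phi>, sin \<theta> * sin \<phi>, cos \<theta>]"

definition colat :: "real ^ 3 \<Rightarrow> real" where
  "colat x = arccos (x $ 3)"

text \<open>Longitude in \<open>[0, 2\<pi>)\<close>; it is 0 at the two poles.\<close>

definition longi :: "real ^ 3 \<Rightarrow> real" where
  "longi x = Arg2pi (Complex (x $ 1) (x $ 2))"

definition great_circle_dist :: "real ^ 3 \<Rightarrow> real ^ 3 \<Rightarrow> real" where
  "great_circle_dist x y = arccos (x \<bullet> y)"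

text \<open>Surface measure \<open>sin \<theta> d\<theta> d\<phi>\<close>, transported to the sphere.\<close>

definition surface_measure :: "(real ^ 3) measure" where
  "surface_measure =
     distr (density (restrict_space lborel ({0..pi} \<times> {0..<2*pi})) (\<lambda>(\<theta>, \<phi>). ennreal (sin \<theta>)))
       (restrict_space borel S2) (\<lambda>(\<theta>, \<phi>). sph_point \<theta> \<phi>)"

section \<open>Spherical harmonics\<close>

text \<open>Rodrigues' formula.\<close>

definition legendre_poly :: "nat \<Rightarrow> real poly" where
  "legendre_poly l = smult (1 / (2 ^ l * fact l)) ((pderiv ^^ l) ([:-1, 0, 1:] ^ l))"

text \<open>Associated Legendre functions on \<open>[-1, 1]\<close>, with the Condon-Shortley phase
  \<open>(-1)^m\<close>; negative orders are reduced to positive ones by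
  \<open>P\<^sub>l\<^sup>-\<^sup>m = (-1)^m (l - m)! / (l + m)! P\<^sub>l\<^sup>m\<close>.\<close>

definition assoc_legendre_nat :: "nat \<Rightarrow> nat \<Rightarrow> real \<Rightarrow> real" where
  "assoc_legendre_nat l m x =
     (-1) ^ m * sqrt (1 - x\<^sup>2) ^ m * poly ((pderiv ^^ m) (legendre_poly l)) x"

definition assoc_legendre :: "nat \<Rightarrow> int \<Rightarrow> real \<Rightarrow> real" where
  "assoc_legendre l m x =
     (if 0 \<le> m then assoc_legendre_nat l (nat m) x
      else (-1) ^ nat (-m) * (fact (l - nat (-m)) / fact (l + nat (-m)))
             * assoc_legendre_nat l (nat (-m)) x)"

definition sph_harm :: "nat \<Rightarrow> int \<Rightarrow> real \<Rightarrow> real \<Rightarrow> complex" where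
  "sph_harm l m \<theta> \<phi> =
     exp (\<i> * of_int m * of_real \<phi>)
     * of_real (sqrt ((2 * real l + 1) * fact (nat (int l - m)) / (4 * pi * fact (nat (int l + m)))))
     * of_real (assoc_legendre l m (cos \<theta>))"

definition sph_harm_at :: "nat \<Rightarrow> int \<Rightarrow> real ^ 3 \<Rightarrow> complex" where
  "sph_harm_at l m x = sph_harm l m (colat x) (longi x)"

section \<open>Spherical random fields and their spectra\<close>

definition cov_fun :: "'w measure \<Rightarrow> ('w \<Rightarrow> real ^ 3 \<Rightarrow> real) \<Rightarrow> real ^ 3 \<Rightarrow> real ^ 3 \<Rightarrow> real" where
  "cov_fun M T x y =
     (\<integral>\<omega>. (T \<omega> x - (\<integral>\<omega>'. T \<omega>' x \<partial>M)) * (T \<omega> y - (\<integral>\<omega>'. T \<omega>' y \<partial>M)) \<partial>M)"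

text \<open>Joint measurability is what gives a meaning to the pathwise integrals defining the
  harmonic coefficients.\<close>

definition spherical_random_field :: "'w measure \<Rightarrow> ('w \<Rightarrow> real ^ 3 \<Rightarrow> real) \<Rightarrow> bool" where
  "spherical_random_field M T \<longleftrightarrow>
     prob_space M \<and>
     (\<lambda>(\<omega>, x). T \<omega> x) \<in> borel_measurable (M \<Otimes>\<^sub>M surface_measure) \<and>
     (\<forall>x\<in>S2. integrable M (\<lambda>\<omega>. (T \<omega> x)\<^sup>2) \<and> (\<integral>\<omega>. T \<omega> x \<partial>M) = 0) \<and>
     continuous_on (S2 \<times> S2) (\<lambda>(x, y). cov_fun M T x y) \<and>
     \<not> (\<exists>c. \<forall>x\<in>S2. \<forall>y\<in>S2. cov_fun M T x y = c)"

definition harm_coeff :: "('w \<Rightarrow> real ^ 3 \<Rightarrow> real) \<Rightarrow> nat \<Rightarrow> int \<Rightarrow> 'w \<Rightarrow> complex" where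
  "harm_coeff T l m \<omega> =
     (\<integral>x. of_real (T \<omega> x) * cnj (sph_harm_at l m x) \<partial>surface_measure)"

definition partial_expansion ::
    "('w \<Rightarrow> real ^ 3 \<Rightarrow> real) \<Rightarrow> nat \<Rightarrow> 'w \<Rightarrow> real ^ 3 \<Rightarrow> complex" where
  "partial_expansion T L \<omega> x =
     (\<Sum>l\<le>L. \<Sum>m = - int l..int l. harm_coeff T l m \<omega> * sph_harm_at l m x)"

text \<open>\<open>T\<close> is the sum of its harmonic series in \<open>L\<^sub>2(\<Omega> \<times> S\<^sup>2)\<close> and,
  at each point of the sphere, in \<open>L\<^sub>2(\<Omega>)\<close>.\<close>

definition harmonic_expansion :: "'w measure \<Rightarrow> ('w \<Rightarrow> real ^ 3 \<Rightarrow> real) \<Rightarrow> bool" where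
  "harmonic_expansion M T \<longleftrightarrow>
     (\<lambda>L. \<integral>\<^sup>+(\<omega>, x). ennreal ((cmod (of_real (T \<omega> x) - partial_expansion T L \<omega> x))\<^sup>2)
            \<partial>(M \<Otimes>\<^sub>M surface_measure)) \<longlonglongrightarrow> 0 \<and>
     (\<forall>x\<in>S2. (\<lambda>L. \<integral>\<^sup>+\<omega>. ennreal ((cmod (of_real (T \<omega> x) - partial_expansion T L \<omega> x))\<^sup>2) \<partial>M)
            \<longlonglongrightarrow> 0)"

definition spectrum ::
    "'w measure \<Rightarrow> ('w \<Rightarrow> real ^ 3 \<Rightarrow> real) \<Rightarrow> nat \<Rightarrow> nat \<Rightarrow> int \<Rightarrow> int \<Rightarrow> complex" where
  "spectrum M T l l' m m' = (\<integral>\<omega>. harm_coeff T l m \<omega> * cnj (harm_coeff T l' m' \<omega>) \<partial>M)"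

section \<open>The classes of fields\<close>

definition isotropic :: "'w measure \<Rightarrow> ('w \<Rightarrow> real ^ 3 \<Rightarrow> real) \<Rightarrow> bool" where
  "isotropic M T \<longleftrightarrow>
     (\<exists>g. \<forall>x\<in>S2. \<forall>y\<in>S2. cov_fun M T x y = g (great_circle_dist x y))"

definition degree_diagonal_spectrum ::
    "'w measure \<Rightarrow> ('w \<Rightarrow> real ^ 3 \<Rightarrow> real) \<Rightarrow> (nat \<Rightarrow> int \<Rightarrow> int \<Rightarrow> complex) \<Rightarrow> bool" where
  "degree_diagonal_spectrum M T Ct \<longleftrightarrow>
     (\<forall>l l'. \<forall>m\<in>{- int l..int l}. \<forall>m'\<in>{- int l'..int l'}.
        spectrum M T l l' m m' = (if l = l' then Ct l m m' else 0))"

definition harmonic_order_dependent :: "'w measure \<Rightarrow> ('w \<Rightarrow> real ^ 3 \<Rightarrow> real) \<Rightarrow> bool" where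
  "harmonic_order_dependent M T \<longleftrightarrow>
     (\<exists>Ct. degree_diagonal_spectrum M T Ct \<and>
        (\<exists>l. \<exists>m\<in>{- int l..int l}. \<exists>m'\<in>{- int l..int l}. m \<noteq> m' \<and> Ct l m m' \<noteq> 0))"

definition diagonal_anisotropic :: "'w measure \<Rightarrow> ('w \<Rightarrow> real ^ 3 \<Rightarrow> real) \<Rightarrow> bool" where
  "diagonal_anisotropic M T \<longleftrightarrow>
     (\<exists>c :: nat \<Rightarrow> int \<Rightarrow> complex.
        (\<forall>l l'. \<forall>m\<in>{- int l..int l}. \<forall>m'\<in>{- int l'..int l'}.
           spectrum M T l l' m m' = (if l = l' \<and> m = m' then c l m else 0)) \<and>
        (\<exists>l. \<exists>m\<in>{- int l..int l}. \<exists>m'\<in>{- int l..int l}. m \<noteq> m' \<and> c l m \<noteq> c l m'))"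

section \<open>Differentiability and the Laplace-Beltrami operator\<close>

definition twice_differentiable_on ::
    "('a::real_normed_vector \<Rightarrow> real) \<Rightarrow> 'a set \<Rightarrow> bool" where
  "twice_differentiable_on f U \<longleftrightarrow>
     (\<exists>f' :: 'a \<Rightarrow> 'a \<Rightarrow>\<^sub>L real.
        \<forall>z\<in>U. (f has_derivative blinfun_apply (f' z)) (at z) \<and> f' differentiable (at z))"

text \<open>Differentiability on the manifold \<open>S\<^sup>2 \<times> S\<^sup>2\<close>, expressed through the extension
  constant along rays: \<open>sgn x = x / \<parallel>x\<parallel>\<close> is a smooth submersion onto the sphere,
  so this agrees with differentiability in charts, the poles included.\<close>

definition twice_differentiable_sphere :: "(real ^ 3 \<Rightarrow> real ^ 3 \<Rightarrow> real) \<Rightarrow> bool" where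
  "twice_differentiable_sphere C \<longleftrightarrow>
     twice_differentiable_on (\<lambda>(x, y). C (sgn x) (sgn y)) ((- {0}) \<times> (- {0}))"

definition laplace_coords :: "(real \<Rightarrow> real \<Rightarrow> real) \<Rightarrow> real \<Rightarrow> real \<Rightarrow> real" where
  "laplace_coords g \<theta> \<phi> =
     1 / sin \<theta> * deriv (\<lambda>t. sin t * deriv (\<lambda>s. g s \<phi>) t) \<theta>
     + 1 / (sin \<theta>)\<^sup>2 * deriv (deriv (\<lambda>p. g \<theta> p)) \<phi>"

definition rotate_axes :: "real ^ 3 \<Rightarrow> real ^ 3" where
  "rotate_axes x = vector [x $ 3, x $ 1, x $ 2]"

text \<open>The coordinate expression is singular at the two poles. The operator being invariant
  under rotations, it is evaluated there in the rotated coordinates whose polar axis is the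
  first coordinate axis; the poles then have colatitude \<open>\<pi>/2\<close> and longitude \<open>\<plusminus>\<pi>/2\<close>.\<close>

definition laplace_beltrami :: "(real ^ 3 \<Rightarrow> real) \<Rightarrow> real ^ 3 \<Rightarrow> real" where
  "laplace_beltrami f x =
     (if x $ 1 = 0 \<and> x $ 2 = 0
      then laplace_coords (\<lambda>\<theta> \<phi>. f (rotate_axes (sph_point \<theta> \<phi>))) (pi / 2) (x $ 3 * pi / 2)
      else laplace_coords (\<lambda>\<theta> \<phi>. f (sph_point \<theta> \<phi>)) (colat x) (longi x))"

lemma sph_point_in_S2: "sph_point \<theta> \<phi> \<in> S2"
proof -
  have "(sin \<theta> * cos \<phi>)\<^sup>2 + (sin \<theta> * sin \<phi>)\<^sup>2 + (cos \<theta>)\<^sup>2 =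
        (sin \<theta>)\<^sup>2 * ((cos \<phi>)\<^sup>2 + (sin \<phi>)\<^sup>2) + (cos \<theta>)\<^sup>2"
    by (simp only: power_mult_distrib distrib_left)
  also have "\<dots> = 1" by simp
  finally show ?thesis
    by (simp add: sph_point_def norm_eq_1 inner_vec_def sum_3 power2_eq_square)
qed

lemma sph_point_colat_longi:
  assumes "x \<in> S2"
  shows "sph_point (colat x) (longi x) = x"
proof -
  let ?z = "Complex (x $ 1) (x $ 2)"
  have *: "(x $ 1)\<^sup>2 + (x $ 2)\<^sup>2 + (x $ 3)\<^sup>2 = 1"
    using assms by (simp add: norm_eq_1 inner_vec_def sum_3 power2_eq_square)
  have "(x $ 3)\<^sup>2 \<le> 1"
    using * zero_le_power2[of "x $ 1"] zero_le_power2[of "x $ 2"] by linarith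
  then have b: "\<bar>x $ 3\<bar> \<le> 1" by (simp add: abs_square_le_1)
  have "sin (colat x) = sqrt (1 - (x $ 3)\<^sup>2)"
    using b by (simp add: colat_def sin_arccos_abs)
  also have "1 - (x $ 3)\<^sup>2 = (x $ 1)\<^sup>2 + (x $ 2)\<^sup>2" using * by linarith
  finally have s: "sin (colat x) = cmod ?z" by (simp add: cmod_def)
  have "cos (colat x) = x $ 3" using b by (simp add: colat_def cos_arccos_abs)
  then show ?thesis
    using cos_Arg2pi[of ?z] sin_Arg2pi[of ?z]
    by (simp add: sph_point_def s longi_def vec_eq_iff forall_3)
qed

lemma rotate_axes_pole:
  assumes "x \<in> S2" "x $ 1 = 0" "x $ 2 = 0"
  shows "rotate_axes (sph_point (pi / 2) (x $ 3 * pi / 2)) = x"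
proof -
  have "(x $ 3)\<^sup>2 = 1"
    using assms by (simp add: norm_eq_1 inner_vec_def sum_3 power2_eq_square)
  then have "x $ 3 = 1 \<or> x $ 3 = - 1" by (simp add: power2_eq_1_iff)
  then show ?thesis
    using assms by (auto simp: rotate_axes_def sph_point_def vec_eq_iff forall_3)
qed

end

(* The forward Laplace-Beltrami direction cannot differentiate the harmonic series term by term.
   Instead, a degree-diagonal spectrum is equivalent to C commuting with all zonal averages
   (integration against a polynomial in the inner product, which acts on each degree as a scalar),
   and averages against the peaked kernels ((1 + v . x) / 2)^n recover, to second order in 1/n,
   the Laplace-Beltrami operator at v of any twice differentiable function.

   For the converse, let Y and Z be harmonics of degrees l and k. Green's identity in each
   variable gives (l (l + 1) - k (k + 1)) times the integral of C(x, y) Y(x) Z(y) as the integral of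
   the divergence of a vector field on a box in the four coordinates. The field is only
   differentiable, and only the difference of the two Laplacians of C, which vanishes, is under
   control, not its partial derivatives; Goursat's bisection argument yields the divergence
   theorem for such fields. Shrinking away from the poles, the boundary terms vanish. *)

theory Submission
  imports Defs
begin


section \<open>Legendre polynomials\<close>

text \<open>Twice differentiability leaves the second derivatives of the covariance possibly
  discontinuous and unbounded, and the L2 expansion says nothing about derivatives of its terms.
  Hence the two devices: a peaked average at v uses only the Peano expansion at v, and the bisection
  argument uses only the linear approximation of the field at one point together with a continuous
  divergence.

  Rotational symmetry enters through the addition theorem, which is itself proved by moving both
  points along a rotation: the derivative of the degree-l kernel telescopes in the order m. The
  theorem turns any polynomial in x . y into a finite combination of degree projections. So averages
  against such polynomials act as scalars on each degree, and they have the moments that rotation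
  invariance predicts.

  Isotropy is handled with the same kernels. Its profile is a uniform limit of polynomials on
  [-1, 1], which forces a spectrum that is scalar on each degree; conversely a scalar spectrum sums,
  by the addition theorem, to a function of x . y.\<close>

definition legendre_deriv :: "nat \<Rightarrow> nat \<Rightarrow> real poly" where
  "legendre_deriv l m = (pderiv ^^ m) (legendre_poly l)"

lemma pderiv_legendre_deriv: "pderiv (legendre_deriv l m) = legendre_deriv l (Suc m)"
  by (simp add: legendre_deriv_def)

lemma DERIV_legendre_deriv:
  "(poly (legendre_deriv l m) has_real_derivative poly (legendre_deriv l (Suc m)) x) (at x)"
  using poly_DERIV[of "legendre_deriv l m" x] by (simp add: pderiv_legendre_deriv)

text \<open>The function u = (x^2 - 1)^l satisfies the first-order equation (x^2 - 1) u' = 2 l x u.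
  Differentiating it once gives the case k = 0, and every further derivative raises k by
  one.\<close>

lemma rodrigues_power_ode:
  fixes l k :: nat
  defines "D \<equiv> \<lambda>k. (pderiv ^^ k) ([:-1, 0, 1:] ^ l :: real poly)"
  shows "[:-1, 0, 1:] * D (Suc (Suc k)) + [:0, 2 * (real k + 1 - real l):] * D (Suc k)
           + smult ((real k + 1) * (real k - 2 * real l)) (D k) = 0"
proof (induction k)
  case 0
  have *: "[:-1, 0, 1:] * D (Suc 0) = [:0, 2 * real l:] * D 0"
  proof (cases l)
    case 0
    then show ?thesis by (simp add: D_def)
  next
    case (Suc j)
    have "pderiv [:-1, 0, 1::real:] = [:0, 2:]" by (simp add: pderiv_pCons)
    then have "D (Suc 0) = smult (real l) ([:-1, 0, 1:] ^ j) * [:0, 2:]"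
      using Suc by (simp add: D_def pderiv_power_Suc del: power_Suc)
    moreover have "D 0 = [:-1, 0, 1:] * [:-1, 0, 1:] ^ j" using Suc by (simp add: D_def)
    ultimately show ?thesis
      unfolding poly_eq_poly_eq_iff[symmetric] fun_eq_iff
      by (simp add: mult_ac) (simp add: algebra_simps)
  qed
  have "pderiv ([:-1, 0, 1:] * D (Suc 0)) = pderiv ([:0, 2 * real l:] * D 0)"
    by (simp only: *)
  moreover have "pderiv (D j) = D (Suc j)" for j by (simp add: D_def)
  ultimately have "[:-1, 0, 1:] * D (Suc (Suc 0)) + D (Suc 0) * [:0, 2:]
      = [:0, 2 * real l:] * D (Suc 0) + D 0 * [:2 * real l:]"
    by (simp only: pderiv_mult) (simp add: pderiv_pCons)
  then show ?case
    unfolding poly_eq_poly_eq_iff[symmetric] fun_eq_iff by (simp add: algebra_simps)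
next
  case (Suc k)
  have "pderiv ([:-1, 0, 1:] * D (Suc (Suc k)) + [:0, 2 * (real k + 1 - real l):] * D (Suc k)
           + smult ((real k + 1) * (real k - 2 * real l)) (D k)) = 0"
    by (simp only: Suc pderiv_0)
  moreover have "pderiv (D j) = D (Suc j)" for j by (simp add: D_def)
  ultimately have "[:-1, 0, 1:] * D (Suc (Suc (Suc k))) + D (Suc (Suc k)) * [:0, 2:] +
     ([:0, 2 * (real k + 1 - real l):] * D (Suc (Suc k)) + D (Suc k) * [:2 * (real k + 1 - real l):])
           + smult ((real k + 1) * (real k - 2 * real l)) (D (Suc k)) = 0"
    by (simp only: pderiv_add pderiv_mult pderiv_smult) (simp add: pderiv_pCons)
  then show ?case
    unfolding poly_eq_poly_eq_iff[symmetric] fun_eq_iff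
    by (simp add: algebra_simps)
qed

text \<open>The associated Legendre equation with the factor (1 - x^2)^(m/2) removed. By Rodrigues'
  formula \<open>legendre_deriv l m\<close> is a multiple of derivative l + m of (x^2 - 1)^l, so the
  index in \<open>rodrigues_power_ode\<close> is k = l + m. The constant (l - m) (l + m + 1) returns
  below as the ladder constant between neighbouring orders.\<close>

lemma legendre_deriv_ode:
  "(1 - x\<^sup>2) * poly (legendre_deriv l (Suc (Suc m))) x
     - 2 * (real m + 1) * x * poly (legendre_deriv l (Suc m)) x
     + (real l - real m) * (real l + real m + 1) * poly (legendre_deriv l m) x = 0"
proof -
  define D where "D = (\<lambda>k. (pderiv ^^ k) ([:-1, 0, 1:] ^ l :: real poly))"
  define c where "c = 1 / (2 ^ l * fact l :: real)"
  have L: "legendre_deriv l j = smult c (D (l + j))" for j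
    by (simp add: legendre_deriv_def legendre_poly_def D_def c_def higher_pderiv_smult
        funpow_add add.commute)
  have "poly ([:-1, 0, 1:] * D (Suc (Suc (l+m))) + [:0, 2 * (real (l+m) + 1 - real l):] * D (Suc (l+m))
           + smult ((real (l+m) + 1) * (real (l+m) - 2 * real l)) (D (l+m))) x = 0"
    unfolding D_def rodrigues_power_ode by simp
  then have "(x\<^sup>2 - 1) * poly (D (Suc (Suc (l+m)))) x + 2 * (real m + 1) * x * poly (D (Suc (l+m))) x
       + (real l + real m + 1) * (real m - real l) * poly (D (l+m)) x = 0"
    by (simp add: algebra_simps power2_eq_square)
  then have "c * ((x\<^sup>2 - 1) * poly (D (Suc (Suc (l+m)))) x + 2 * (real m + 1) * x * poly (D (Suc (l+m))) x
       + (real l + real m + 1) * (real m - real l) * poly (D (l+m)) x) = 0" by simp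
  then show ?thesis unfolding L by (simp add: algebra_simps)
qed

section \<open>Degree, value at 1 and span of the Legendre polynomials\<close>

lemma degree_legendre_poly [simp]: "degree (legendre_poly l) = l"
  and legendre_poly_nonzero [simp]: "legendre_poly l \<noteq> 0"
proof -
  have d: "degree ([:-1, 0, 1::real:] ^ l) = 2 * l" by (simp add: degree_power_eq)
  then have d': "degree ((pderiv ^^ l) ([:-1, 0, 1::real:] ^ l)) = l"
    by (simp add: degree_higher_pderiv)
  then show "degree (legendre_poly l) = l" by (simp add: legendre_poly_def)
  have "(pderiv ^^ l) ([:-1, 0, 1::real:] ^ l) \<noteq> 0"
  proof (cases "l = 0")
    case False
    then show ?thesis using d' by (metis degree_0)
  qed simp
  then show "legendre_poly l \<noteq> 0" by (simp add: legendre_poly_def)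
qed

lemma legendre_deriv_eq_0: "l < m \<Longrightarrow> legendre_deriv l m = 0"
proof -
  assume "l < m"
  then obtain k where k: "m = k + Suc l" using less_imp_add_positive
    by (metis add.commute add_Suc_right less_imp_Suc_add)
  have "degree (legendre_deriv l l) = 0"
    by (simp add: legendre_deriv_def degree_higher_pderiv)
  then have "legendre_deriv l (Suc l) = 0"
    by (simp add: pderiv_eq_0_iff flip: pderiv_legendre_deriv)
  moreover have "legendre_deriv l m = (pderiv ^^ k) (legendre_deriv l (Suc l))"
    unfolding legendre_deriv_def k funpow_add by simp
  ultimately show ?thesis by simp
qed

text \<open>At x = 1 the differential equation loses its leading term and expresses each derivative
  at 1 as a multiple of the previous one. A zero at 1 would therefore pass to all derivatives, among
  them the nonzero constant \<open>legendre_deriv l l\<close>. This is what allows division by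
  \<open>zonal_coeff\<close>.\<close>

lemma legendre_poly_1_nonzero: "poly (legendre_poly l) 1 \<noteq> 0"
proof
  assume "poly (legendre_poly l) 1 = 0"
  then have 0: "poly (legendre_deriv l 0) 1 = 0" by (simp add: legendre_deriv_def)
  have "poly (legendre_deriv l m) 1 = 0" for m
  proof (induction m)
    case (Suc m)
    then show ?case using legendre_deriv_ode[of 1 l m] by simp
  qed (rule 0)
  moreover have "legendre_deriv l l \<noteq> 0 \<and> degree (legendre_deriv l l) = 0"
  proof -
    have "coeff (legendre_deriv l l) 0 \<noteq> 0"
      using leading_coeff_neq_0[OF legendre_poly_nonzero[of l]]
      by (simp add: legendre_deriv_def coeff_higher_pderiv pochhammer_eq_0_iff)
    then show ?thesis by (auto simp: legendre_deriv_def degree_higher_pderiv)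
  qed
  ultimately show False
    by (metis degree_eq_zeroE poly_0 poly_pCons mult_zero_right add_0_right pCons_0_0)
qed

text \<open>The degrees are exact, so a multiple of the Legendre polynomial of top degree removes
  the leading term.\<close>

lemma poly_eq_sum_legendre:
  "\<exists>c. p = (\<Sum>l\<le>degree p. smult (c l) (legendre_poly l))"
proof -
  have "\<exists>c. p = (\<Sum>l\<le>n. smult (c l) (legendre_poly l))" if "degree p \<le> n" for n and p :: "real poly"
    using that
  proof (induction n arbitrary: p)
    case 0
    obtain a where a: "p = [:a:]" using 0 by (auto elim: degree_eq_zeroE)
    obtain b where b: "legendre_poly 0 = [:b:]"
      using degree_legendre_poly[of 0] degree_eq_zeroE by blast
    then have "b \<noteq> 0" using legendre_poly_nonzero[of 0] by auto
    with a b have "p = [:a:]" "legendre_poly 0 = [:b:]" "b \<noteq> 0" by auto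
    then show ?case by (intro exI[of _ "\<lambda>_. a / b"]) simp
  next
    case (Suc n)
    let ?L = "legendre_poly (Suc n)"
    define a where "a = coeff p (Suc n) / lead_coeff ?L"
    have "lead_coeff ?L \<noteq> 0" using leading_coeff_neq_0 legendre_poly_nonzero by blast
    then have "coeff (p - smult a ?L) (Suc n) = 0" by (simp add: a_def)
    moreover have "degree (p - smult a ?L) \<le> Suc n"
      using Suc.prems by (intro degree_diff_le) (auto intro: order_trans[OF degree_smult_le])
    ultimately have "degree (p - smult a ?L) \<le> n"
      by (metis leading_coeff_0_iff degree_0 le_Suc_eq zero_le)
    then obtain c where c: "p - smult a ?L = (\<Sum>l\<le>n. smult (c l) (legendre_poly l))"
      using Suc.IH by blast
    then have "p = (\<Sum>l\<le>n. smult (c l) (legendre_poly l)) + smult a ?L" by (simp add: algebra_simps)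
    also have "\<dots> = (\<Sum>l\<le>Suc n. smult ((c(Suc n := a)) l) (legendre_poly l))" by simp
    finally show ?case by blast
  qed
  then show ?thesis by blast
qed

section \<open>Orthogonality of the associated Legendre functions\<close>

definition legendre_inner :: "nat \<Rightarrow> nat \<Rightarrow> nat \<Rightarrow> real" where
  "legendre_inner m l l' = integral {-1..1}
     (\<lambda>x. (1 - x\<^sup>2) ^ m * (poly (legendre_deriv l m) x * poly (legendre_deriv l' m) x))"

lemma legendre_inner_commute: "legendre_inner m l l' = legendre_inner m l' l"
  by (simp add: legendre_inner_def mult.commute)

text \<open>Integration by parts with the primitive \<open>G\<close>. The weight (1 - x^2)^(m+1)
  vanishes at both ends, and \<open>legendre_deriv_ode\<close> turns the derivative of (1 -
  x^2)^(m+1) \<open>Q (Suc m)\<close> into a multiple of (1 - x^2)^m \<open>Q m\<close>.\<close>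

lemma legendre_inner_Suc:
  "legendre_inner (Suc m) l l' = (real l' - real m) * (real l' + real m + 1) * legendre_inner m l l'"
proof -
  define P where "P j = poly (legendre_deriv l j)" for j
  define Q where "Q j = poly (legendre_deriv l' j)" for j
  define G where "G x = (1 - x\<^sup>2) ^ Suc m * (P m x * Q (Suc m) x)" for x
  let ?c = "(real l' - real m) * (real l' + real m + 1)"
  let ?g = "\<lambda>x. (1 - x\<^sup>2) ^ Suc m * (P (Suc m) x * Q (Suc m) x) - ?c * ((1 - x\<^sup>2) ^ m * (P m x * Q m x))"
  have "(G has_real_derivative ?g x) (at x)" for x
  proof -
    have dP: "(P m has_real_derivative P (Suc m) x) (at x)"
      and dQ: "(Q (Suc m) has_real_derivative Q (Suc (Suc m)) x) (at x)"
      unfolding P_def Q_def by (rule DERIV_legendre_deriv)+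
    have "(G has_real_derivative
       (real (Suc m) * (1 - x\<^sup>2) ^ m * (- (2 * x))) * (P m x * Q (Suc m) x) +
       (P (Suc m) x * Q (Suc m) x + Q (Suc (Suc m)) x * P m x) * (1 - x\<^sup>2) ^ Suc m) (at x)"
      unfolding G_def
      by (rule derivative_eq_intros dP dQ refl | simp)+
    moreover have "(real (Suc m) * (1 - x\<^sup>2) ^ m * (- (2 * x))) * (P m x * Q (Suc m) x) +
       (P (Suc m) x * Q (Suc m) x + Q (Suc (Suc m)) x * P m x) * (1 - x\<^sup>2) ^ Suc m
      = (1 - x\<^sup>2) ^ Suc m * (P (Suc m) x * Q (Suc m) x) + (1 - x\<^sup>2) ^ m * P m x *
         ((1 - x\<^sup>2) * Q (Suc (Suc m)) x - 2 * (real m + 1) * x * Q (Suc m) x)"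
      by (simp add: algebra_simps)
    moreover have "(1 - x\<^sup>2) * Q (Suc (Suc m)) x - 2 * (real m + 1) * x * Q (Suc m) x = - ?c * Q m x"
      using legendre_deriv_ode[of x l' m] unfolding Q_def by simp
    moreover have "(1 - x\<^sup>2) ^ Suc m * (P (Suc m) x * Q (Suc m) x) + (1 - x\<^sup>2) ^ m * P m x * (- ?c * Q m x) = ?g x"
      by simp
    ultimately show ?thesis by metis
  qed
  then have "(?g has_integral G 1 - G (-1)) {-1..1}"
    by (intro fundamental_theorem_of_calculus)
      (auto simp: has_real_derivative_iff_has_vector_derivative[symmetric] intro: DERIV_subset)
  then have "integral {-1..1} ?g = 0"
    by (simp add: G_def integral_unique)
  moreover have "integral {-1..1} ?g = legendre_inner (Suc m) l l' - ?c * legendre_inner m l l'"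
    unfolding legendre_inner_def P_def Q_def
    by (subst Henstock_Kurzweil_Integration.integral_diff)
      (auto intro!: integrable_continuous_real continuous_intros)
  ultimately show ?thesis by simp
qed

text \<open>Exchanging l and l' in the recursion changes the eigenvalue factor but not the left-hand
  side, so the difference of two distinct eigenvalues annihilates the inner product.\<close>

lemma legendre_inner_eq_0:
  assumes "l \<noteq> l'"
  shows "legendre_inner m l l' = 0"
proof -
  have "(real l' - real m) * (real l' + real m + 1) * legendre_inner m l l'
      = (real l - real m) * (real l + real m + 1) * legendre_inner m l l'"
    using legendre_inner_Suc[of m l l'] legendre_inner_Suc[of m l' l]
    by (simp add: legendre_inner_commute)
  then have "((real l' - real l) * (real l' + real l + 1)) * legendre_inner m l l' = 0"
    by (simp add: algebra_simps)
  moreover have "real l' + real l + 1 \<noteq> 0" by linarith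
  ultimately show ?thesis using assms by simp
qed

section \<open>Spherical harmonics in Cartesian coordinates\<close>

text \<open>On the sphere \<open>Y\<^sub>l\<^sub>m\<close> is, up to a constant, \<open>(x\<^sub>1 + \<i>x\<^sub>2)\<^sup>m P\<^sub>l\<^sup>(\<^sup>m\<^sup>)(x\<^sub>3)\<close> or its conjugate.\<close>

definition harm_fun :: "nat \<Rightarrow> nat \<Rightarrow> complex \<Rightarrow> real \<Rightarrow> complex" where
  "harm_fun l m w z = w ^ m * of_real (poly (legendre_deriv l m) z)"

definition harm_norm :: "nat \<Rightarrow> nat \<Rightarrow> real" where
  "harm_norm l m = sqrt ((2 * real l + 1) * fact (l - m) / (4 * pi * fact (l + m)))"

text \<open>The squared normalisations change from one order to the next by the inverse of the
  ladder constant in \<open>legendre_deriv_ode\<close>. This cancellation makes the sum over orders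
  telescope in the addition theorem and makes the norm of a harmonic independent of its
  order.\<close>

lemma harm_norm_Suc:
  assumes "m < l"
  shows "(harm_norm l (Suc m))\<^sup>2 * ((real l - real m) * (real l + real m + 1)) = (harm_norm l m)\<^sup>2"
proof -
  define p q A B :: real
    where "p = real l - real m" and "q = real l + real m + 1"
      and "A = fact (l - Suc m)" and "B = fact (l + m)"
  have f: "fact (l - m) = p * A" "fact (l + Suc m) = q * B"
    using assms Suc_diff_Suc[OF assms] fact_reduce[of "l - m", where 'a = real]
    by (simp_all add: p_def q_def A_def B_def of_nat_diff)
  have "0 < p" "0 < q" "0 < A" "0 < B" using assms by (simp_all add: p_def q_def A_def B_def)
  then show ?thesis
    unfolding harm_norm_def f A_def[symmetric] B_def[symmetric] p_def[symmetric] q_def[symmetric]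
    by (simp add: field_simps)
qed

abbreviation planar :: "real ^ 3 \<Rightarrow> complex" where
  "planar x \<equiv> Complex (x $ 1) (x $ 2)"

lemma planar_sph_point: "planar (sph_point \<theta> \<phi>) = of_real (sin \<theta>) * exp (\<i> * of_real \<phi>)"
  by (simp add: sph_point_def complex_eq_iff Re_exp Im_exp)

lemma sph_point_nth [simp]:
  "sph_point \<theta> \<phi> $ 1 = sin \<theta> * cos \<phi>" "sph_point \<theta> \<phi> $ 2 = sin \<theta> * sin \<phi>"
  "sph_point \<theta> \<phi> $ 3 = cos \<theta>"
  by (simp_all add: sph_point_def)

lemma assoc_legendre_nat_cos:
  assumes "\<theta> \<in> {0..pi}"
  shows "assoc_legendre_nat l m (cos \<theta>) = (-1) ^ m * sin \<theta> ^ m * poly (legendre_deriv l m) (cos \<theta>)"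
proof -
  have "sqrt (1 - (cos \<theta>)\<^sup>2) = sin \<theta>"
    using assms by (simp add: sin_ge_zero flip: sin_squared_eq)
  then show ?thesis by (simp add: assoc_legendre_nat_def legendre_deriv_def)
qed

lemma sph_harm_nonneg:
  assumes "\<theta> \<in> {0..pi}" "k \<le> l"
  shows "sph_harm l (int k) \<theta> \<phi> =
    of_real (harm_norm l k) * (-1) ^ k * harm_fun l k (planar (sph_point \<theta> \<phi>)) (cos \<theta>)"
proof -
  have "nat (int l - int k) = l - k" "nat (int l + int k) = l + k" using assms(2) by auto
  moreover have "exp (\<i> * of_int (int k) * of_real \<phi>) = exp (\<i> * of_real \<phi>) ^ k"
    by (simp add: mult_ac flip: exp_of_nat_mult)
  ultimately show ?thesis using assms(1)
    unfolding sph_harm_def harm_fun_def planar_sph_point assoc_legendre_def harm_norm_def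
    by (simp add: assoc_legendre_nat_cos power_mult_distrib mult_ac)
qed

text \<open>The two signs (-1)^k, one from the Condon-Shortley phase and one from the reflection
  formula for negative orders, cancel. The factorial ratio of that formula turns the normalisation
  of order -k into that of order k, so only the conjugation remains.\<close>

lemma sph_harm_nonpos:
  assumes "\<theta> \<in> {0..pi}" "k \<le> l"
  shows "sph_harm l (- int k) \<theta> \<phi> =
    of_real (harm_norm l k) * cnj (harm_fun l k (planar (sph_point \<theta> \<phi>)) (cos \<theta>))"
proof (cases "k = 0")
  case True
  then show ?thesis using sph_harm_nonneg[OF assms, of \<phi>]
    by (simp add: harm_fun_def)
next
  case False
  have *: "nat (int l + int k) = l + k" "nat (int l - int k) = l - k" using assms(2) by auto
  have a: "assoc_legendre l (- int k) (cos \<theta>) =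
     (fact (l - k) / fact (l + k)) * sin \<theta> ^ k * poly (legendre_deriv l k) (cos \<theta>)"
    using False assms(1) by (simp add: assoc_legendre_def assoc_legendre_nat_cos flip: power_mult_distrib)
  have n: "sqrt ((2 * real l + 1) * fact (l + k) / (4 * pi * fact (l - k))) * (fact (l - k) / fact (l + k))
      = harm_norm l k"
  proof -
    define A B c :: real where "A = fact (l - k)" and "B = fact (l + k)" and "c = 2 * real l + 1"
    have pos: "0 < A" "0 < B" "0 < c" by (simp_all add: A_def B_def c_def)
    then have "(sqrt (c * B / (4 * pi * A)) * (A / B))\<^sup>2 = c * A / (4 * pi * B)"
      unfolding power_mult_distrib by (simp add: field_simps power2_eq_square)
    then have "sqrt (c * A / (4 * pi * B)) = sqrt (c * B / (4 * pi * A)) * (A / B)"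
      by (rule real_sqrt_unique) (use pos in simp)
    then show ?thesis unfolding harm_norm_def A_def B_def c_def by simp
  qed
  have e: "cnj (exp (\<i> * of_real \<phi>)) = exp (- (\<i> * of_real \<phi>))" by (simp add: exp_cnj)
  have "sph_harm l (- int k) \<theta> \<phi> = exp (- (\<i> * of_nat k * of_real \<phi>)) *
     of_real (sqrt ((2 * real l + 1) * fact (l + k) / (4 * pi * fact (l - k))) * (fact (l - k) / fact (l + k)))
     * of_real (sin \<theta> ^ k * poly (legendre_deriv l k) (cos \<theta>))"
    unfolding sph_harm_def a by (simp add: * mult_ac)
  also have "exp (- (\<i> * of_nat k * of_real \<phi>)) = exp (- (\<i> * of_real \<phi>)) ^ k"
    by (simp add: mult_ac flip: exp_of_nat_mult)
  also have "exp (- (\<i> * of_real \<phi>)) ^ k * of_real (sqrt ((2 * real l + 1) * fact (l + k) / (4 * pi * fact (l - k))) * (fact (l - k) / fact (l + k)))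
     * of_real (sin \<theta> ^ k * poly (legendre_deriv l k) (cos \<theta>))
     = of_real (harm_norm l k) * cnj (harm_fun l k (planar (sph_point \<theta> \<phi>)) (cos \<theta>))"
    unfolding n harm_fun_def planar_sph_point
    by (simp add: e power_mult_distrib mult_ac)
  finally show ?thesis .
qed

lemma colat_range: "x \<in> S2 \<Longrightarrow> colat x \<in> {0..pi}"
proof -
  assume "x \<in> S2"
  then have "\<bar>x $ 3\<bar> \<le> 1" using component_le_norm_cart[of x 3] by simp
  then show ?thesis by (simp add: colat_def arccos_lbound arccos_ubound)
qed

lemma cos_colat: "x \<in> S2 \<Longrightarrow> cos (colat x) = x $ 3"
  using sph_point_colat_longi[of x] by (metis sph_point_nth(3))

lemma sph_harm_at_nonneg:
  assumes "x \<in> S2" "k \<le> l"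
  shows "sph_harm_at l (int k) x = of_real (harm_norm l k) * (-1) ^ k * harm_fun l k (planar x) (x $ 3)"
  using sph_harm_nonneg[OF colat_range[OF assms(1)] assms(2), of "longi x"]
  by (simp only: sph_harm_at_def sph_point_colat_longi[OF assms(1)] cos_colat[OF assms(1)])

lemma sph_harm_at_nonpos:
  assumes "x \<in> S2" "k \<le> l"
  shows "sph_harm_at l (- int k) x = of_real (harm_norm l k) * cnj (harm_fun l k (planar x) (x $ 3))"
  using sph_harm_nonpos[OF colat_range[OF assms(1)] assms(2), of "longi x"]
  by (simp only: sph_harm_at_def sph_point_colat_longi[OF assms(1)] cos_colat[OF assms(1)])

lemma sph_harm_at_sph_point:
  assumes "\<theta> \<in> {0..pi}" "m \<in> {- int l..int l}"
  shows "sph_harm_at l m (sph_point \<theta> \<phi>) = sph_harm l m \<theta> \<phi>"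
proof -
  define k where "k = nat \<bar>m\<bar>"
  then have k: "k \<le> l" "m = int k \<or> m = - int k" using assms(2) by auto
  then show ?thesis
    using assms(1) sph_point_in_S2[of \<theta> \<phi>]
    by (auto simp: sph_harm_nonneg sph_harm_nonpos sph_harm_at_nonneg sph_harm_at_nonpos)
qed

text \<open>The longitude jumps along a meridian and has no limit at the poles, so continuity is
  read off the Cartesian form, which is polynomial in the coordinates.\<close>

lemma continuous_on_sph_harm_at:
  assumes "m \<in> {- int l..int l}"
  shows "continuous_on S2 (sph_harm_at l m)"
proof -
  define k where "k = nat \<bar>m\<bar>"
  then have k: "k \<le> l" "m = int k \<or> m = - int k" using assms by auto
  have p: "planar x = of_real (x $ 1) + \<i> * of_real (x $ 2)" for x by (simp add: complex_eq_iff)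
  have "continuous_on S2 (\<lambda>x. harm_fun l k (planar x) (x $ 3))"
    unfolding harm_fun_def p by (intro continuous_intros)
  from k(2) show ?thesis
  proof
    assume "m = int k"
    then have "continuous_on S2 (sph_harm_at l m) \<longleftrightarrow> continuous_on S2
      (\<lambda>x. of_real (harm_norm l k) * (-1) ^ k * harm_fun l k (planar x) (x $ 3))"
      using k by (intro continuous_on_cong) (simp_all add: sph_harm_at_nonneg)
    then show ?thesis using \<open>continuous_on S2 (\<lambda>x. harm_fun l k (planar x) (x $ 3))\<close>
      by (simp add: continuous_on_mult_left)
  next
    assume "m = - int k"
    then have "continuous_on S2 (sph_harm_at l m) \<longleftrightarrow> continuous_on S2
      (\<lambda>x. of_real (harm_norm l k) * cnj (harm_fun l k (planar x) (x $ 3)))"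
      using k by (intro continuous_on_cong) (simp_all add: sph_harm_at_nonpos)
    then show ?thesis using \<open>continuous_on S2 (\<lambda>x. harm_fun l k (planar x) (x $ 3))\<close>
      by (simp add: continuous_on_mult_left continuous_on_cnj)
  qed
qed

section \<open>The addition theorem\<close>

text \<open>The sum of Y(x) times the conjugate of Y(y) over all orders of degree l, with m and -m
  paired into a real part. It takes free planar parts and heights as arguments so that it can be
  differentiated along curves.\<close>

definition harm_kernel :: "nat \<Rightarrow> complex \<Rightarrow> real \<Rightarrow> complex \<Rightarrow> real \<Rightarrow> real" where
  "harm_kernel l w z w' z' =
     (harm_norm l 0)\<^sup>2 * (poly (legendre_deriv l 0) z * poly (legendre_deriv l 0) z')
     + 2 * (\<Sum>m=1..l. (harm_norm l m)\<^sup>2 * Re (harm_fun l m w z * cnj (harm_fun l m w' z')))"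

lemma sum_symmetric_int:
  fixes f :: "int \<Rightarrow> 'a::comm_monoid_add"
  shows "(\<Sum>m=- int l..int l. f m) = f 0 + (\<Sum>k=1..l. f (int k) + f (- int k))"
proof (induction l)
  case (Suc l)
  have "{- int (Suc l)..int (Suc l)} = insert (int (Suc l)) (insert (- int (Suc l)) {- int l..int l})"
    by auto
  then have "(\<Sum>m=- int (Suc l)..int (Suc l). f m)
    = f (int (Suc l)) + (f (- int (Suc l)) + (\<Sum>m=- int l..int l. f m))" by simp
  then show ?case by (simp add: Suc.IH ac_simps)
qed simp

lemma sum_sph_harm_at:
  assumes "x \<in> S2" "y \<in> S2"
  shows "(\<Sum>m=- int l..int l. sph_harm_at l m x * cnj (sph_harm_at l m y))
    = of_real (harm_kernel l (planar x) (x $ 3) (planar y) (y $ 3))"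
proof -
  let ?h = "\<lambda>k. harm_fun l k (planar x) (x $ 3) * cnj (harm_fun l k (planar y) (y $ 3))"
  have "sph_harm_at l (int k) x * cnj (sph_harm_at l (int k) y)
      + sph_harm_at l (- int k) x * cnj (sph_harm_at l (- int k) y)
      = of_real (2 * ((harm_norm l k)\<^sup>2 * Re (?h k)))" if "k \<le> l" for k
  proof -
    have s: "((-1) ^ k * (-1) ^ k :: complex) = 1" by (simp flip: power_mult_distrib)
    have "sph_harm_at l (int k) x * cnj (sph_harm_at l (int k) y)
      = of_real ((harm_norm l k)\<^sup>2) * (((-1) ^ k * (-1) ^ k) * ?h k)"
      using assms that by (simp add: sph_harm_at_nonneg power2_eq_square mult_ac)
    moreover have "sph_harm_at l (- int k) x * cnj (sph_harm_at l (- int k) y)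
      = of_real ((harm_norm l k)\<^sup>2) * cnj (?h k)"
      using assms that by (simp add: sph_harm_at_nonpos power2_eq_square mult_ac)
    ultimately show ?thesis
      unfolding s by (simp only: mult_1_left distrib_left[symmetric] complex_add_cnj of_real_mult) simp
  qed
  moreover have "sph_harm_at l 0 x * cnj (sph_harm_at l 0 y)
     = of_real ((harm_norm l 0)\<^sup>2 * (poly (legendre_deriv l 0) (x$3) * poly (legendre_deriv l 0) (y$3)))"
    using sph_harm_at_nonneg[OF assms(1), of 0 l] sph_harm_at_nonneg[OF assms(2), of 0 l]
    by (simp add: harm_fun_def power2_eq_square)
  ultimately show ?thesis
    unfolding sum_symmetric_int harm_kernel_def
    by (simp add: sum_distrib_left)
qed

text \<open>The operators that raise and lower the order \<open>m\<close>, restricted to a rotation about the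
  second axis.\<close>

lemma harm_fun_rotation_derivative:
  assumes w: "(w has_vector_derivative of_real (z t)) (at t)"
    and z: "(z has_real_derivative - Re (w t)) (at t)"
    and n: "(cmod (w t))\<^sup>2 + (z t)\<^sup>2 = 1"
  shows "((\<lambda>t. harm_fun l (Suc m) (w t) (z t)) has_vector_derivative
       - (harm_fun l (Suc (Suc m)) (w t) (z t)
          - of_real ((real l - real m) * (real l + real m + 1)) * harm_fun l m (w t) (z t)) / 2) (at t)"
proof -
  let ?P = "\<lambda>j. poly (legendre_deriv l j) (z t)"
  have dP: "((\<lambda>t. complex_of_real (poly (legendre_deriv l (Suc m)) (z t))) has_vector_derivative
      of_real (?P (Suc (Suc m)) * - Re (w t))) (at t)"
    using DERIV_chain2[OF DERIV_legendre_deriv z, of l "Suc m"]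
    by (intro has_vector_derivative_of_real) (simp add: has_real_derivative_iff_has_vector_derivative)
  have dw: "((\<lambda>t. w t ^ Suc m) has_vector_derivative (of_nat (Suc m) * w t ^ m) * of_real (z t)) (at t)"
  proof -
    have "((\<lambda>x. x ^ Suc m) has_field_derivative of_nat (Suc m) * w t ^ m) (at (w t))"
      using DERIV_power_Suc[OF DERIV_ident, of m "w t"] by simp
    from field_vector_diff_chain_at[OF w this] show ?thesis by (simp add: o_def mult.commute)
  qed
  have "((\<lambda>t. harm_fun l (Suc m) (w t) (z t)) has_vector_derivative
     w t ^ Suc m * of_real (?P (Suc (Suc m)) * - Re (w t))
      + (of_nat (Suc m) * w t ^ m) * of_real (z t) * of_real (?P (Suc m))) (at t)"
    unfolding harm_fun_def by (rule has_vector_derivative_mult[OF dw dP])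
  moreover have "w t ^ Suc m * of_real (?P (Suc (Suc m)) * - Re (w t))
      + (of_nat (Suc m) * w t ^ m) * of_real (z t) * of_real (?P (Suc m))
    = - (harm_fun l (Suc (Suc m)) (w t) (z t)
          - of_real ((real l - real m) * (real l + real m + 1)) * harm_fun l m (w t) (z t)) / 2"
  proof -
    \<comment> \<open>On the sphere 1 - z^2 is |w|^2, and writing it as w times its conjugate
      exposes the power of w that the order-raising term contains.\<close>
    have ode: "(real l - real m) * (real l + real m + 1) * ?P m =
       2 * (real m + 1) * z t * ?P (Suc m) - (cmod (w t))\<^sup>2 * ?P (Suc (Suc m))"
    proof -
      have "(cmod (w t))\<^sup>2 = 1 - (z t)\<^sup>2" using n by simp
      then show ?thesis using legendre_deriv_ode[of "z t" l m] by simp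
    qed
    have "of_real ((real l - real m) * (real l + real m + 1)) * harm_fun l m (w t) (z t)
      = w t ^ m * of_real ((real l - real m) * (real l + real m + 1) * ?P m)"
      by (simp add: harm_fun_def mult_ac)
    also have "\<dots> = w t ^ m * (of_real (2 * (real m + 1) * z t * ?P (Suc m))
        - (w t * cnj (w t)) * of_real (?P (Suc (Suc m))))"
      unfolding ode by (simp flip: complex_norm_square)
    finally have *: "of_real ((real l - real m) * (real l + real m + 1)) * harm_fun l m (w t) (z t) = \<dots>" .
    have "2 * of_real (Re (w t)) = w t + cnj (w t)" by (simp add: complex_add_cnj)
    then have r: "complex_of_real (Re (w t)) = (w t + cnj (w t)) / 2" by (simp add: mult.commute)
    show ?thesis unfolding * by (simp add: r harm_fun_def field_simps)
  qed
  ultimately show ?thesis by metis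
qed

text \<open>Order m + 1 contributes a difference of \<open>E m\<close> and \<open>E (Suc m)\<close>,
  and since \<open>c (Suc m) * b m = c m\<close> the weighted sum telescopes to
  \<open>c 0 * E 0 - c l * E l\<close>. The order-0 term cancels the first part; \<open>E l\<close>
  is 0 because a polynomial of degree l has no derivative of order l + 1.\<close>

lemma harm_kernel_rotation_derivative:
  assumes w: "(w has_vector_derivative of_real (z t)) (at t)"
    and z: "(z has_real_derivative - Re (w t)) (at t)"
    and n: "(cmod (w t))\<^sup>2 + (z t)\<^sup>2 = 1"
    and w': "(w' has_vector_derivative of_real (z' t)) (at t)"
    and z': "(z' has_real_derivative - Re (w' t)) (at t)"
    and n': "(cmod (w' t))\<^sup>2 + (z' t)\<^sup>2 = 1"
  shows "((\<lambda>t. harm_kernel l (w t) (z t) (w' t) (z' t)) has_real_derivative 0) (at t)"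
proof -
  define U where "U m = harm_fun l m (w t) (z t)" for m
  define V where "V m = harm_fun l m (w' t) (z' t)" for m
  define E where "E m = Re (U (Suc m) * cnj (V m) + U m * cnj (V (Suc m)))" for m
  define c where "c m = (harm_norm l m)\<^sup>2" for m
  define b where "b m = (real l - real m) * (real l + real m + 1)" for m
  have cb: "c (Suc m) * b m = c m" if "m < l" for m
    using harm_norm_Suc[OF that] by (simp add: c_def b_def)
  have d: "((\<lambda>t. Re (harm_fun l (Suc m) (w t) (z t) * cnj (harm_fun l (Suc m) (w' t) (z' t))))
     has_real_derivative (b m * E m - E (Suc m)) / 2) (at t)" for m
  proof -
    have "((\<lambda>t. harm_fun l (Suc m) (w t) (z t) * cnj (harm_fun l (Suc m) (w' t) (z' t)))
       has_vector_derivative (U (Suc m) * cnj (- (V (Suc (Suc m)) - of_real (b m) * V m) / 2)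
         + (- (U (Suc (Suc m)) - of_real (b m) * U m) / 2) * cnj (V (Suc m)))) (at t)"
      unfolding U_def V_def b_def
      by (intro has_vector_derivative_mult has_vector_derivative_cnj
          harm_fun_rotation_derivative assms)
    then have "((\<lambda>t. Re (harm_fun l (Suc m) (w t) (z t) * cnj (harm_fun l (Suc m) (w' t) (z' t))))
       has_vector_derivative Re (U (Suc m) * cnj (- (V (Suc (Suc m)) - of_real (b m) * V m) / 2)
         + (- (U (Suc (Suc m)) - of_real (b m) * U m) / 2) * cnj (V (Suc m)))) (at t)"
      by (rule bounded_linear.has_vector_derivative[OF bounded_linear_Re])
    then show ?thesis
      unfolding has_real_derivative_iff_has_vector_derivative E_def
      by (rule back_subst) (simp add: field_simps)
  qed
  have d0: "((\<lambda>t. poly (legendre_deriv l 0) (z t) * poly (legendre_deriv l 0) (z' t))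
     has_real_derivative - E 0) (at t)"
  proof -
    have "((\<lambda>t. poly (legendre_deriv l 0) (z t) * poly (legendre_deriv l 0) (z' t)) has_real_derivative
       poly (legendre_deriv l (Suc 0)) (z t) * - Re (w t) * poly (legendre_deriv l 0) (z' t) +
       poly (legendre_deriv l (Suc 0)) (z' t) * - Re (w' t) * poly (legendre_deriv l 0) (z t)) (at t)"
      by (intro DERIV_mult DERIV_chain2[OF DERIV_legendre_deriv] z z')
    then show ?thesis
      by (rule back_subst) (simp add: E_def U_def V_def harm_fun_def algebra_simps)
  qed
  have s: "(\<Sum>m=1..l. f m) = (\<Sum>m<l. f (Suc m))" for f :: "nat \<Rightarrow> real"
    by (rule sum.reindex_bij_witness[of _ Suc "\<lambda>m. m - 1"]) auto
  have "((\<lambda>t. harm_kernel l (w t) (z t) (w' t) (z' t)) has_real_derivative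
     c 0 * - E 0 + 2 * (\<Sum>m<l. c (Suc m) * ((b m * E m - E (Suc m)) / 2))) (at t)"
    unfolding harm_kernel_def s c_def[symmetric]
    by (intro DERIV_add DERIV_cmult DERIV_sum d d0)
  moreover have "2 * (\<Sum>m<l. c (Suc m) * ((b m * E m - E (Suc m)) / 2)) = (\<Sum>m<l. c m * E m - c (Suc m) * E (Suc m))"
    unfolding sum_distrib_left
  proof (intro sum.cong refl)
    fix m assume "m \<in> {..<l}"
    moreover have "2 * (c (Suc m) * ((b m * E m - E (Suc m)) / 2)) = (c (Suc m) * b m) * E m - c (Suc m) * E (Suc m)"
      by (simp add: field_simps)
    ultimately show "2 * (c (Suc m) * ((b m * E m - E (Suc m)) / 2)) = c m * E m - c (Suc m) * E (Suc m)"
      using cb by simp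
  qed
  moreover have "\<dots> = c 0 * E 0 - c l * E l" by (rule sum_lessThan_telescope')
  moreover have "E l = 0"
    by (simp add: E_def U_def V_def harm_fun_def legendre_deriv_eq_0)
  ultimately show ?thesis by simp
qed

lemma harm_fun_rotate_plane:
  "cmod u = 1 \<Longrightarrow> harm_fun l m (u * w) z * cnj (harm_fun l m (u * w') z')
     = harm_fun l m w z * cnj (harm_fun l m w' z')"
proof -
  assume "cmod u = 1"
  then have "u * cnj u = 1" by (simp flip: complex_norm_square)
  then have "u ^ m * cnj u ^ m = 1" by (simp flip: power_mult_distrib)
  moreover have "harm_fun l m (u * w) z * cnj (harm_fun l m (u * w') z')
    = (u ^ m * cnj u ^ m) * (harm_fun l m w z * cnj (harm_fun l m w' z'))"
    by (simp add: harm_fun_def power_mult_distrib mult_ac)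
  ultimately show ?thesis by simp
qed

lemma harm_kernel_rotate_plane:
  "cmod u = 1 \<Longrightarrow> harm_kernel l (u * w) z (u * w') z' = harm_kernel l w z w' z'"
  by (simp add: harm_kernel_def harm_fun_rotate_plane)

text \<open>The pair of points is turned about the third axis until w is real and nonnegative, then
  about the second axis until the first point is the north pole; neither motion changes the kernel.
  At the pole every positive order vanishes, and the height of the second point has become the inner
  product of the two.\<close>

theorem harm_kernel_addition:
  assumes n: "(cmod w)\<^sup>2 + z\<^sup>2 = 1" and n': "(cmod w')\<^sup>2 + z'\<^sup>2 = 1"
  shows "harm_kernel l w z w' z' = (harm_norm l 0)\<^sup>2 * poly (legendre_poly l) 1
     * poly (legendre_poly l) (Re (w * cnj w') + z * z')"
proof -
  \<comment> \<open>For w = 0 the first point is a pole and any unit factor serves.\<close>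
  define u where "u = (if w = 0 then 1 else cnj (sgn w))"
  have u: "cmod u = 1" by (simp add: u_def norm_sgn)
  have "w * cnj w = of_real (cmod w) * of_real (cmod w)"
    by (metis complex_norm_square of_real_mult power2_eq_square)
  then have uw: "u * w = of_real (cmod w)"
    by (simp add: u_def sgn_div_norm scaleR_conv_of_real field_simps)
  define v where "v = u * w'"
  have nv: "(cmod v)\<^sup>2 + z'\<^sup>2 = 1" using n' u by (simp add: v_def norm_mult)
  obtain a where a: "cmod w = sin a" "z = cos a" using sincos_total_2pi[of z "cmod w"] n
    by (metis add.commute)
  define W where "W t = complex_of_real (sin (a + t))" for t
  define Z where "Z t = cos (a + t)" for t
  define W' where "W' t = Complex (Re v * cos t + z' * sin t) (Im v)" for t
  define Z' where "Z' t = - Re v * sin t + z' * cos t" for t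
  have "((\<lambda>t. harm_kernel l (W t) (Z t) (W' t) (Z' t)) has_real_derivative 0) (at t)" for t
  proof (rule harm_kernel_rotation_derivative)
    show "(W has_vector_derivative of_real (Z t)) (at t)"
      unfolding W_def Z_def
      by (intro has_vector_derivative_of_real)
        (auto simp flip: has_real_derivative_iff_has_vector_derivative intro!: derivative_eq_intros)
    show "(Z has_real_derivative - Re (W t)) (at t)"
      unfolding W_def Z_def by (auto intro!: derivative_eq_intros)
    show "(cmod (W t))\<^sup>2 + (Z t)\<^sup>2 = 1" by (simp add: W_def Z_def)
    show "(W' has_vector_derivative of_real (Z' t)) (at t)"
      unfolding W'_def Z'_def has_vector_derivative_complex_iff
      by (auto simp flip: has_real_derivative_iff_has_vector_derivative intro!: derivative_eq_intros)
    show "(Z' has_real_derivative - Re (W' t)) (at t)"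
      unfolding W'_def Z'_def by (auto intro!: derivative_eq_intros)
    have "(cmod (W' t))\<^sup>2 + (Z' t)\<^sup>2 = (Im v)\<^sup>2 + ((Re v)\<^sup>2 + z'\<^sup>2) * ((cos t)\<^sup>2 + (sin t)\<^sup>2)"
      unfolding W'_def Z'_def cmod_power2 complex.sel by algebra
    then show "(cmod (W' t))\<^sup>2 + (Z' t)\<^sup>2 = 1" using nv by (simp add: cmod_power2)
  qed
  then have const: "harm_kernel l (W 0) (Z 0) (W' 0) (Z' 0) = harm_kernel l (W (- a)) (Z (- a)) (W' (- a)) (Z' (- a))"
    by (rule DERIV_isconst_all[rule_format])
  have start: "harm_kernel l (W 0) (Z 0) (W' 0) (Z' 0) = harm_kernel l w z w' z'"
  proof -
    have "W' 0 = u * w'" by (simp add: W'_def v_def complex_eq_iff)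
    moreover have "W 0 = u * w" by (simp add: W_def uw a)
    ultimately show ?thesis using harm_kernel_rotate_plane[OF u] by (simp add: Z_def Z'_def a)
  qed
  have fin: "Z' (- a) = Re (w * cnj w') + z * z'"
  proof -
    have "Re (w * cnj w') = Re ((u * w) * cnj (u * w'))"
    proof -
      have "(u * w) * cnj (u * w') = (u * cnj u) * (w * cnj w')" by (simp add: mult_ac)
      moreover have "u * cnj u = 1" using u by (simp flip: complex_norm_square)
      ultimately show ?thesis by (simp only: mult_1_left)
    qed
    also have "\<dots> = cmod w * Re v" unfolding uw v_def[symmetric] by simp
    finally show ?thesis by (simp add: Z'_def a mult_ac)
  qed
  have pole: "W (- a) = 0" "Z (- a) = 1" by (simp_all add: W_def Z_def)
  have "harm_kernel l 0 1 q s = (harm_norm l 0)\<^sup>2 * poly (legendre_poly l) 1 * poly (legendre_poly l) s" for q s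
  proof -
    have "harm_fun l m 0 1 = 0" if "m \<in> {1..l}" for m using that by (simp add: harm_fun_def)
    then show ?thesis by (simp add: harm_kernel_def) (simp add: legendre_deriv_def)
  qed
  from this[of "W' (- a)" "Z' (- a)"] show ?thesis
    unfolding start[symmetric] const pole fin .
qed

text \<open>The classical constant (2 l + 1) / (4 pi), since P_l(1) = 1 in Rodrigues'
  normalisation.\<close>

definition zonal_coeff :: "nat \<Rightarrow> real" where
  "zonal_coeff l = (harm_norm l 0)\<^sup>2 * poly (legendre_poly l) 1"

lemma zonal_coeff_nonzero: "zonal_coeff l \<noteq> 0"
  by (simp add: zonal_coeff_def legendre_poly_1_nonzero harm_norm_def)

lemma S2_iff: "x \<in> S2 \<longleftrightarrow> (x $ 1)\<^sup>2 + (x $ 2)\<^sup>2 + (x $ 3)\<^sup>2 = 1"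
  by (simp add: norm_eq_1 inner_vec_def sum_3 power2_eq_square)

theorem addition_theorem:
  assumes "x \<in> S2" "y \<in> S2"
  shows "(\<Sum>m=- int l..int l. sph_harm_at l m x * cnj (sph_harm_at l m y))
    = of_real (zonal_coeff l * poly (legendre_poly l) (x \<bullet> y))"
proof -
  have "x \<bullet> y = Re (planar x * cnj (planar y)) + x $ 3 * y $ 3"
    by (simp add: inner_vec_def sum_3)
  moreover have "(cmod (planar x))\<^sup>2 + (x $ 3)\<^sup>2 = 1" "(cmod (planar y))\<^sup>2 + (y $ 3)\<^sup>2 = 1"
    using assms[unfolded S2_iff] by (simp_all add: cmod_power2)
  ultimately show ?thesis
    using harm_kernel_addition[of "planar x" "x $ 3" "planar y" "y $ 3" l]
    by (simp add: sum_sph_harm_at[OF assms] zonal_coeff_def)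
qed

text \<open>A Legendre expansion of p followed by the addition theorem. The factor of each
  reproducing kernel depends on the degree alone, which is the source of every scalar action
  below.\<close>

lemma zonal_expansion:
  fixes p :: "real poly"
  shows "\<exists>\<mu> N. \<forall>x\<in>S2. \<forall>y\<in>S2. complex_of_real (poly p (x \<bullet> y))
     = (\<Sum>l\<le>N. of_real (\<mu> l) * (\<Sum>m=- int l..int l. sph_harm_at l m x * cnj (sph_harm_at l m y)))"
proof -
  obtain c where c: "p = (\<Sum>l\<le>degree p. smult (c l) (legendre_poly l))"
    using poly_eq_sum_legendre by blast
  have p: "poly p t = (\<Sum>l\<le>degree p. c l * poly (legendre_poly l) t)" for t
    by (subst c) (simp add: poly_sum)
  have "complex_of_real (poly p (x \<bullet> y)) = (\<Sum>l\<le>degree p. of_real (c l / zonal_coeff l) *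
     (\<Sum>m=- int l..int l. sph_harm_at l m x * cnj (sph_harm_at l m y)))" if "x \<in> S2" "y \<in> S2" for x y
    unfolding addition_theorem[OF that] p using zonal_coeff_nonzero by simp
  then show ?thesis
    by (intro exI[of _ "\<lambda>l. c l / zonal_coeff l"] exI[of _ "degree p"] ballI)
qed

section \<open>Integration over the sphere\<close>

lemma space_surface_measure [simp]: "space surface_measure = S2"
  by (simp add: surface_measure_def space_restrict_space)

lemma sets_surface_measure: "sets surface_measure = sets (restrict_space borel S2)"
  by (simp add: surface_measure_def)

lemma norm_sph_point [simp]: "norm (sph_point \<theta> \<phi>) = 1"
  using sph_point_in_S2[of \<theta> \<phi>] by simp

lemma sph_point_eq_axis:
  "sph_point \<theta> \<phi> = (sin \<theta> * cos \<phi>) *\<^sub>R axis 1 1 + (sin \<theta> * sin \<phi>) *\<^sub>R axis 2 1 + cos \<theta> *\<^sub>R axis 3 1"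
  by (simp add: vec_eq_iff forall_3 axis_def)

lemma continuous_on_sph_point: "continuous_on A (\<lambda>(\<theta>, \<phi>). sph_point \<theta> \<phi>)"
  unfolding case_prod_beta sph_point_eq_axis by (intro continuous_intros)

lemma measurable_sph_point:
  "(\<lambda>(\<theta>, \<phi>). sph_point \<theta> \<phi>) \<in> restrict_space lborel ({0..pi} \<times> {0..<2*pi}) \<rightarrow>\<^sub>M restrict_space borel S2"
proof (rule measurable_restrict_space2)
  show "(\<lambda>(\<theta>, \<phi>). sph_point \<theta> \<phi>) \<in> borel_measurable (restrict_space lborel ({0..pi} \<times> {0..<2*pi}))"
    by (intro measurable_restrict_space1)
      (simp add: borel_measurable_continuous_onI continuous_on_sph_point)
qed auto

lemma measurable_sin_density:
  "(\<lambda>(\<theta>, \<phi>). sin \<theta>) \<in> borel_measurable (restrict_space lborel ({0..pi} \<times> {0..<2*pi}))"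
  by (intro measurable_restrict_space1)
    (simp add: borel_measurable_continuous_onI continuous_intros case_prod_beta)

lemma borel_measurable_surface:
  "continuous_on S2 g \<Longrightarrow> g \<in> borel_measurable surface_measure"
  by (subst measurable_cong_sets[OF sets_surface_measure refl])
    (rule borel_measurable_continuous_on_restrict)

lemma finite_measure_surface: "finite_measure surface_measure"
proof (rule finite_measureI)
  let ?A = "{0..pi} \<times> {0..<2*pi}"
  let ?R = "restrict_space lborel ?A"
  have A: "?A \<in> sets borel" by (intro borel_Times) auto
  have "emeasure surface_measure (space surface_measure)
      = emeasure (density ?R (\<lambda>(\<theta>, \<phi>). ennreal (sin \<theta>))) (space ?R)"
  proof -
    have "S2 \<in> sets (restrict_space borel S2)"
      using sets.top[of "restrict_space borel S2"] by (simp add: space_restrict_space)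
    then show ?thesis
      unfolding surface_measure_def using measurable_sph_point
      by (subst emeasure_distr)
        (auto simp: space_restrict_space case_prod_beta intro!: arg_cong2[where f = emeasure])
  qed
  also have "\<dots> = (\<integral>\<^sup>+x. (case x of (\<theta>, \<phi>) \<Rightarrow> ennreal (sin \<theta>)) * indicator (space ?R) x \<partial>?R)"
    using measurable_compose[OF measurable_sin_density measurable_ennreal]
    by (subst emeasure_density) (auto simp: case_prod_beta)
  also have "\<dots> \<le> (\<integral>\<^sup>+x. 1 \<partial>?R)"
    by (intro nn_integral_mono) (auto simp: indicator_def case_prod_beta ennreal_le_1)
  also have "\<dots> = emeasure lborel ?A"
    using A by (simp add: emeasure_restrict_space space_restrict_space)
  also have "\<dots> = emeasure lborel {0..pi} * emeasure lborel {0..<2*pi}"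
    by (subst lborel_prod[symmetric], subst lborel.emeasure_pair_measure_Times) auto
  also have "\<dots> < \<infinity>" by (simp add: ennreal_mult_less_top)
  finally show "emeasure surface_measure (space surface_measure) \<noteq> \<infinity>" by simp
qed

interpretation surface: finite_measure surface_measure
  by (rule finite_measure_surface)

lemma integrable_surface:
  fixes g :: "real ^ 3 \<Rightarrow> 'b::{banach, second_countable_topology}"
  assumes "continuous_on S2 g"
  shows "integrable surface_measure g"
proof -
  have "bounded (g ` S2)"
    using assms by (intro compact_imp_bounded compact_continuous_image) auto
  then obtain B where "\<forall>x\<in>S2. norm (g x) \<le> B" unfolding bounded_iff by blast
  then show ?thesis
    by (intro surface.integrable_const_bound[where B = B] AE_I2 borel_measurable_surface assms) auto
qed

text \<open>Passes to a closed box in the coordinates, where iterated integrals of continuous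
  functions, limits under the integral and the divergence theorem are available.\<close>

lemma integral_surface:
  fixes g :: "real ^ 3 \<Rightarrow> 'b::euclidean_space"
  assumes "continuous_on S2 g"
  shows "(\<integral>x. g x \<partial>surface_measure)
    = integral (cbox (0, 0) (pi, 2*pi)) (\<lambda>(\<theta>, \<phi>). sin \<theta> *\<^sub>R g (sph_point \<theta> \<phi>))"
proof -
  let ?A = "{0..pi} \<times> {0..<2*pi}" and ?B = "cbox (0, 0) (pi, 2*pi)"
  let ?h = "\<lambda>x. sin (fst x) *\<^sub>R g (sph_point (fst x) (snd x))"
  have A: "?A \<in> sets borel" by (intro borel_Times) auto
  have c: "continuous_on UNIV ?h"
  proof (intro continuous_intros)
    show "continuous_on UNIV (\<lambda>x. g (sph_point (fst x) (snd x)))"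
      using continuous_on_sph_point[of UNIV]
      by (intro continuous_on_compose2[OF assms]) (auto simp: case_prod_beta)
  qed
  have hB: "set_integrable lborel ?B ?h"
    unfolding set_integrable_def
    by (rule borel_integrable_compact) (auto intro: continuous_on_subset[OF c] compact_cbox)
  have AB: "?A \<subseteq> ?B" by (auto simp: cbox_Pair_eq)
  then have hA: "set_integrable lborel ?A ?h"
    using A by (intro set_integrable_subset[OF hB]) auto
  have "(\<integral>x. g x \<partial>surface_measure)
     = (\<integral>x. g (case x of (\<theta>, \<phi>) \<Rightarrow> sph_point \<theta> \<phi>)
         \<partial>density (restrict_space lborel ?A) (\<lambda>(\<theta>, \<phi>). ennreal (sin \<theta>)))"
    unfolding surface_measure_def
    by (rule integral_distr)
      (use measurable_sph_point borel_measurable_continuous_on_restrict[OF assms] in auto)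
  also have "\<dots> = (\<integral>x. (case x of (\<theta>, \<phi>) \<Rightarrow> sin \<theta>) *\<^sub>R g (case x of (\<theta>, \<phi>) \<Rightarrow> sph_point \<theta> \<phi>)
         \<partial>restrict_space lborel ?A)"
  proof -
    have "density (restrict_space lborel ?A) (\<lambda>(\<theta>, \<phi>). ennreal (sin \<theta>))
        = density (restrict_space lborel ?A) (\<lambda>x. ennreal (case x of (\<theta>, \<phi>) \<Rightarrow> sin \<theta>))"
      by (intro arg_cong[where f = "density (restrict_space lborel ?A)"]) auto
    then show ?thesis
      using measurable_compose[OF measurable_sph_point borel_measurable_continuous_on_restrict[OF assms]]
        measurable_sin_density
      by (simp only:) (subst integral_density, auto intro!: AE_I2 simp: space_restrict_space sin_ge_zero)
  qed
  also have "\<dots> = (LINT x:?A|lborel. ?h x)"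
    using A by (subst integral_restrict_space) (auto simp: set_lebesgue_integral_def case_prod_beta)
  also have "\<dots> = integral ?A ?h"
    by (rule set_borel_integral_eq_integral[OF hA])
  \<comment> \<open>The half-open longitude interval and the closed one differ only in the segment
    where the longitude is 2 pi, a negligible set.\<close>
  also have "\<dots> = integral ?B ?h"
  proof (rule integral_spike_set)
    have "{x \<in> ?B - ?A. ?h x \<noteq> 0} \<subseteq> {x. x \<bullet> (0, 1) = 2*pi}" by (auto simp: cbox_Pair_eq)
    moreover have "negligible {x::real\<times>real. x \<bullet> (0, 1) = 2*pi}"
      by (rule negligible_standard_hyperplane) (simp add: Basis_prod_def)
    ultimately show "negligible {x \<in> ?B - ?A. ?h x \<noteq> 0}" by (rule negligible_subset[rotated])
    have "{x \<in> ?A - ?B. ?h x \<noteq> 0} = {}" using AB by auto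
    then show "negligible {x \<in> ?A - ?B. ?h x \<noteq> 0}" by (simp only: negligible_empty)
  qed
  finally show ?thesis by (simp add: case_prod_unfold)
qed

text \<open>The colatitude factor of a harmonic, written with a power of sin in place of the square
  root in the associated Legendre function. In this form it is smooth for every real \<theta>, also
  at 0 and pi.\<close>

definition harm_amp :: "nat \<Rightarrow> int \<Rightarrow> real \<Rightarrow> real" where
  "harm_amp l m \<theta> = (if m < 0 then 1 else (-1) ^ nat \<bar>m\<bar>) * harm_norm l (nat \<bar>m\<bar>)
     * (sin \<theta> ^ nat \<bar>m\<bar> * poly (legendre_deriv l (nat \<bar>m\<bar>)) (cos \<theta>))"

lemma sph_harm_eq_amp:
  assumes "\<theta> \<in> {0..pi}" "m \<in> {- int l..int l}"
  shows "sph_harm l m \<theta> \<phi> = exp (\<i> * of_int m * of_real \<phi>) * of_real (harm_amp l m \<theta>)"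
proof (cases "m < 0")
  case True
  define k where "k = nat \<bar>m\<bar>"
  then have m: "m = - int k" and k: "k \<le> l" using True assms(2) by auto
  have "cnj (exp (\<i> * of_real \<phi>)) ^ k = exp (\<i> * of_int m * of_real \<phi>)"
    by (simp add: m exp_cnj mult_ac flip: exp_of_nat_mult)
  with True show ?thesis using sph_harm_nonpos[OF assms(1) k, of \<phi>]
    by (simp add: m harm_amp_def harm_fun_def planar_sph_point power_mult_distrib mult_ac del: sph_point_nth)
next
  case False
  define k where "k = nat \<bar>m\<bar>"
  then have m: "m = int k" and k: "k \<le> l" using False assms(2) by auto
  have "exp (\<i> * of_real \<phi>) ^ k = exp (\<i> * of_int m * of_real \<phi>)"
    by (simp add: m mult_ac flip: exp_of_nat_mult)
  with False show ?thesis using sph_harm_nonneg[OF assms(1) k, of \<phi>]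
    by (simp add: m harm_amp_def harm_fun_def planar_sph_point power_mult_distrib mult_ac del: sph_point_nth)
qed

section \<open>Orthogonality of the spherical harmonics\<close>

lemma integral_sin_cos:
  fixes h :: "real \<Rightarrow> real"
  assumes "continuous_on {-1..1} h"
  shows "integral {0..pi} (\<lambda>\<theta>. sin \<theta> * h (cos \<theta>)) = integral {-1..1} h"
proof -
  \<comment> \<open>The substitution u = - cos \<theta> is increasing, so the limits stay ordered;
    the sign is undone by a reflection at the end.\<close>
  have c: "continuous_on {-1..1} (\<lambda>u. h (- u))"
    by (rule continuous_on_compose2[OF assms]) (auto intro: continuous_intros)
  have "((\<lambda>\<theta>. sin \<theta> *\<^sub>R h (- (- cos \<theta>))) has_integral integral {- cos 0..- cos pi} (\<lambda>u. h (- u))) {0..pi}"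
    by (rule has_integral_substitution[where c = "-1" and d = 1])
      (auto intro!: derivative_eq_intros c)
  then have "integral {0..pi} (\<lambda>\<theta>. sin \<theta> * h (cos \<theta>)) = integral {-1..1} (\<lambda>u. h (- u))"
    by (simp add: integral_unique)
  also have "\<dots> = integral {-1..1} h"
    using Henstock_Kurzweil_Integration.integral_reflect_real[of 1 "-1" h] by simp
  finally show ?thesis .
qed

lemma integral_harm_amp:
  "integral {0..pi} (\<lambda>\<theta>. sin \<theta> * (harm_amp l m \<theta> * harm_amp l' m \<theta>))
    = harm_norm l (nat \<bar>m\<bar>) * harm_norm l' (nat \<bar>m\<bar>) * legendre_inner (nat \<bar>m\<bar>) l l'"
proof -
  define k where "k = nat \<bar>m\<bar>"
  let ?h = "\<lambda>x. (1 - x\<^sup>2) ^ k * (poly (legendre_deriv l k) x * poly (legendre_deriv l' k) x)"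
  have "harm_amp l m \<theta> * harm_amp l' m \<theta> = harm_norm l k * harm_norm l' k * ?h (cos \<theta>)" for \<theta>
  proof -
    have "(if m < 0 then 1 else (-1) ^ k) * (if m < 0 then 1 else (-1) ^ k) = (1::real)"
      by (simp flip: power_mult_distrib)
    moreover have "sin \<theta> ^ k * sin \<theta> ^ k = (1 - (cos \<theta>)\<^sup>2) ^ k"
      by (metis power2_eq_square power_mult_distrib sin_squared_eq)
    moreover have "harm_amp l m \<theta> * harm_amp l' m \<theta> =
      ((if m < 0 then 1 else (-1) ^ k) * (if m < 0 then 1 else (-1) ^ k)) * (harm_norm l k * harm_norm l' k)
      * ((sin \<theta> ^ k * sin \<theta> ^ k) * (poly (legendre_deriv l k) (cos \<theta>) * poly (legendre_deriv l' k) (cos \<theta>)))"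
      unfolding harm_amp_def k_def by (simp only: mult_ac)
    ultimately show ?thesis by simp
  qed
  then have "integral {0..pi} (\<lambda>\<theta>. sin \<theta> * (harm_amp l m \<theta> * harm_amp l' m \<theta>))
     = integral {0..pi} (\<lambda>\<theta>. (harm_norm l k * harm_norm l' k) * (sin \<theta> * ?h (cos \<theta>)))"
    by (simp only: mult_ac)
  also have "\<dots> = (harm_norm l k * harm_norm l' k) * integral {-1..1} ?h"
    unfolding Henstock_Kurzweil_Integration.integral_mult_right
    by (subst integral_sin_cos) (auto intro!: continuous_intros)
  finally show ?thesis by (simp add: legendre_inner_def k_def)
qed

text \<open>The squared norm of a harmonic, formed at order 0. The orthonormal normalisation gives
  it the value 1; the arguments below rest on its dependence on the degree alone.\<close>

definition harm_sq_norm :: "nat \<Rightarrow> real" where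
  "harm_sq_norm l = 2 * pi * ((harm_norm l 0)\<^sup>2 * legendre_inner 0 l l)"

text \<open>From one order to the next, \<open>harm_norm_Suc\<close> and
  \<open>legendre_inner_Suc\<close> contribute inverse factors.\<close>

lemma harm_sq_norm_order:
  "k \<le> l \<Longrightarrow> 2 * pi * ((harm_norm l k)\<^sup>2 * legendre_inner k l l) = harm_sq_norm l"
proof (induction k)
  case (Suc k)
  then have "(harm_norm l (Suc k))\<^sup>2 * legendre_inner (Suc k) l l = (harm_norm l k)\<^sup>2 * legendre_inner k l l"
    using harm_norm_Suc[of k l] by (simp add: legendre_inner_Suc)
  then show ?case using Suc by simp
qed (simp add: harm_sq_norm_def)

lemma integral_exp_int:
  "integral {0..2*pi} (\<lambda>\<phi>. exp (\<i> * of_int j * of_real \<phi>)) = (if j = 0 then 2 * pi else 0)"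
proof (cases "j = 0")
  case False
  have "((\<lambda>\<phi>. exp (\<i> * of_int j * of_real \<phi>) / (\<i> * of_int j)) has_vector_derivative
      exp (\<i> * of_int j * of_real \<phi>)) (at \<phi> within {0..2*pi})" for \<phi>
  proof -
    have "((\<lambda>z. exp (\<i> * of_int j * z) / (\<i> * of_int j)) has_field_derivative
      exp (\<i> * of_int j * of_real \<phi>)) (at (of_real \<phi>))"
      using False by (auto intro!: derivative_eq_intros)
    then show ?thesis by (rule has_vector_derivative_real_field)
  qed
  then have "((\<lambda>\<phi>. exp (\<i> * of_int j * of_real \<phi>)) has_integral
     exp (\<i> * of_int j * of_real (2*pi)) / (\<i> * of_int j) - exp (\<i> * of_int j * of_real 0) / (\<i> * of_int j)) {0..2*pi}"
    by (intro fundamental_theorem_of_calculus) auto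
  moreover have "exp (\<i> * of_int j * of_real (2*pi)) = 1"
    using exp_integer_2pi[of "of_int j"] by (simp add: mult_ac)
  ultimately show ?thesis using False by (simp add: integral_unique)
qed (simp add: scaleR_conv_of_real)

lemma sph_harm_orthogonal:
  assumes m: "m \<in> {- int l..int l}" and m': "m' \<in> {- int l'..int l'}"
  shows "(\<integral>x. sph_harm_at l m x * cnj (sph_harm_at l' m' x) \<partial>surface_measure)
    = (if l = l' \<and> m = m' then of_real (harm_sq_norm l) else 0)"
proof -
  let ?a = "\<lambda>\<theta>. sin \<theta> * (harm_amp l m \<theta> * harm_amp l' m' \<theta>)"
  let ?e = "\<lambda>\<phi>. exp (\<i> * of_int (m - m') * of_real \<phi>)"
  have cont: "continuous_on S2 (\<lambda>x. sph_harm_at l m x * cnj (sph_harm_at l' m' x))"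
    by (intro continuous_intros continuous_on_sph_harm_at m m')
  have ca: "continuous_on A (harm_amp l m)" for A l m
    unfolding harm_amp_def by (intro continuous_intros)
  have "(\<integral>x. sph_harm_at l m x * cnj (sph_harm_at l' m' x) \<partial>surface_measure)
    = integral (cbox (0, 0) (pi, 2*pi)) (\<lambda>(\<theta>, \<phi>). of_real (?a \<theta>) * ?e \<phi>)"
    unfolding integral_surface[OF cont]
  proof (rule Henstock_Kurzweil_Integration.integral_cong)
    fix x :: "real \<times> real" assume "x \<in> cbox (0, 0) (pi, 2*pi)"
    moreover obtain \<theta> \<phi> where x: "x = (\<theta>, \<phi>)" by (cases x)
    ultimately have "\<theta> \<in> {0..pi}" by (auto simp: cbox_Pair_eq)
    moreover have "exp (\<i> * of_int m * of_real \<phi>) * cnj (exp (\<i> * of_int m' * of_real \<phi>)) = ?e \<phi>"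
      by (simp add: exp_cnj algebra_simps flip: exp_add)
    moreover have "sin \<theta> *\<^sub>R ((u * of_real p) * cnj (v * of_real q)) = of_real (sin \<theta> * (p * q)) * (u * cnj v)"
      for u v p q by (simp add: scaleR_conv_of_real mult_ac)
    ultimately show "(case x of (\<theta>, \<phi>) \<Rightarrow> sin \<theta> *\<^sub>R (sph_harm_at l m (sph_point \<theta> \<phi>) * cnj (sph_harm_at l' m' (sph_point \<theta> \<phi>))))
       = (case x of (\<theta>, \<phi>) \<Rightarrow> of_real (?a \<theta>) * ?e \<phi>)"
      unfolding x prod.case sph_harm_at_sph_point[OF _ m] sph_harm_at_sph_point[OF _ m']
      by (simp only: sph_harm_at_sph_point[OF _ m] sph_harm_at_sph_point[OF _ m'] sph_harm_eq_amp[OF _ m] sph_harm_eq_amp[OF _ m'])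
  qed
  also have "\<dots> = integral {0..pi} (\<lambda>\<theta>. integral {0..2*pi} (\<lambda>\<phi>. of_real (?a \<theta>) * ?e \<phi>))"
    by (subst integral_prod_continuous) (auto intro!: continuous_intros continuous_on_compose2[OF ca] simp: case_prod_beta)
  also have "\<dots> = of_real (integral {0..pi} ?a) * (if m = m' then 2 * pi else 0)"
  proof -
    have "?a integrable_on {0..pi}"
      by (intro integrable_continuous_real continuous_intros ca)
    then have "integral {0..pi} (\<lambda>\<theta>. complex_of_real (?a \<theta>)) = of_real (integral {0..pi} ?a)"
      using integral_linear[OF _ bounded_linear_of_real[where 'a = complex]]
      by (simp add: o_def del: of_real_mult)
    then show ?thesis
      unfolding Henstock_Kurzweil_Integration.integral_mult_right integral_exp_int
        Henstock_Kurzweil_Integration.integral_mult_left by simp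
  qed
  also have "\<dots> = (if l = l' \<and> m = m' then of_real (harm_sq_norm l) else 0)"
  proof (cases "m = m'")
    case True
    then have "integral {0..pi} ?a = harm_norm l (nat \<bar>m\<bar>) * harm_norm l' (nat \<bar>m\<bar>) * legendre_inner (nat \<bar>m\<bar>) l l'"
      using integral_harm_amp by simp
    moreover have "nat \<bar>m\<bar> \<le> l" using m by auto
    ultimately show ?thesis using True harm_sq_norm_order[of "nat \<bar>m\<bar>" l]
      by (cases "l = l'") (auto simp: legendre_inner_eq_0 power2_eq_square mult_ac simp flip: of_real_mult)
  qed simp
  finally show ?thesis .
qed

section \<open>The divergence theorem for differentiable vector fields\<close>

text \<open>No integrability of the partial derivatives is assumed, only continuity of the
  divergence: Goursat's bisection argument replaces the fundamental theorem of calculus.\<close>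

definition face_difference ::
    "'a::euclidean_space \<Rightarrow> 'a \<Rightarrow> 'a \<Rightarrow> ('a \<Rightarrow> 'b::real_vector) \<Rightarrow> 'a \<Rightarrow> 'b" where
  "face_difference a b i f t = f (t + ((b - t) \<bullet> i) *\<^sub>R i) - f (t + ((a - t) \<bullet> i) *\<^sub>R i)"

text \<open>Opposite faces are compared by projecting a point of the box onto both and integrating
  over the whole box. The integrand does not depend on coordinate i, so division by the edge length
  restores the face integral, and only integrals over full-dimensional boxes occur.\<close>

definition flux_defect ::
    "('a::euclidean_space \<Rightarrow> 'a \<Rightarrow> 'b::euclidean_space) \<Rightarrow> ('a \<Rightarrow> 'b) \<Rightarrow> 'a \<Rightarrow> 'a \<Rightarrow> 'b" where
  "flux_defect V h a b = (\<Sum>i\<in>Basis. (1 / ((b - a) \<bullet> i)) *\<^sub>R integral (cbox a b) (face_difference a b i (V i)))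
     - integral (cbox a b) h"

lemma shift_in_cbox:
  assumes "t \<in> cbox a b" "i \<in> Basis" "a \<bullet> i \<le> c" "c \<le> b \<bullet> i"
  shows "t + (c - t \<bullet> i) *\<^sub>R i \<in> cbox a b"
  using assms by (auto simp: mem_box inner_simps inner_Basis)

lemma continuous_on_face:
  assumes "continuous_on (cbox a b) f" "i \<in> Basis" "a \<bullet> i \<le> c" "c \<le> b \<bullet> i"
  shows "continuous_on (cbox a b) (\<lambda>t. f (t + (c - t \<bullet> i) *\<^sub>R i))"
  by (rule continuous_on_compose2[OF assms(1)])
    (use assms in \<open>auto intro!: continuous_intros shift_in_cbox\<close>)

lemma cbox_bisect:
  fixes a b :: "'a::euclidean_space"
  assumes j: "j \<in> Basis" and m: "a \<bullet> j \<le> m" "m \<le> b \<bullet> j"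
  shows "cbox a b \<inter> {x. x \<bullet> j \<le> m} = cbox a (b + (m - b \<bullet> j) *\<^sub>R j)"
    and "cbox a b \<inter> {x. x \<bullet> j \<ge> m} = cbox (a + (m - a \<bullet> j) *\<^sub>R j) b"
proof -
  define b1 where "b1 = b + (m - b \<bullet> j) *\<^sub>R j"
  define a2 where "a2 = a + (m - a \<bullet> j) *\<^sub>R j"
  have b1i: "b1 \<bullet> i = (if i = j then m else b \<bullet> i)" and a2i: "a2 \<bullet> i = (if i = j then m else a \<bullet> i)"
    if "i \<in> Basis" for i
    using that j by (auto simp: b1_def a2_def inner_simps inner_Basis)
  show "cbox a b \<inter> {x. x \<bullet> j \<le> m} = cbox a (b + (m - b \<bullet> j) *\<^sub>R j)"
    unfolding b1_def[symmetric]
  proof (intro set_eqI iffI)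
    fix x assume "x \<in> cbox a b1"
    then have *: "a \<bullet> i \<le> x \<bullet> i" "x \<bullet> i \<le> (if i = j then m else b \<bullet> i)" if "i \<in> Basis" for i
      using that by (auto simp: mem_box b1i)
    have "x \<bullet> i \<le> b \<bullet> i" if "i \<in> Basis" for i
      using *(2)[OF that] m(2) by (cases "i = j") auto
    then show "x \<in> cbox a b \<inter> {x. x \<bullet> j \<le> m}"
      using * *(2)[OF j] by (simp add: mem_box)
  qed (simp add: mem_box b1i)
  show "cbox a b \<inter> {x. x \<bullet> j \<ge> m} = cbox (a + (m - a \<bullet> j) *\<^sub>R j) b"
    unfolding a2_def[symmetric]
  proof (intro set_eqI iffI)
    fix x assume "x \<in> cbox a2 b"
    then have *: "(if i = j then m else a \<bullet> i) \<le> x \<bullet> i" "x \<bullet> i \<le> b \<bullet> i" if "i \<in> Basis" for i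
      using that by (auto simp: mem_box a2i)
    have "a \<bullet> i \<le> x \<bullet> i" if "i \<in> Basis" for i
      using *(1)[OF that] m(1) by (cases "i = j") auto
    then show "x \<in> cbox a b \<inter> {x. x \<bullet> j \<ge> m}"
      using * *(1)[OF j] by (simp add: mem_box)
  qed (simp add: mem_box a2i)
qed

lemma integral_bisect:
  fixes f :: "'a::euclidean_space \<Rightarrow> 'b::euclidean_space"
  assumes "f integrable_on cbox a b" "j \<in> Basis" "a \<bullet> j \<le> m" "m \<le> b \<bullet> j"
  shows "integral (cbox a b) f = integral (cbox a (b + (m - b \<bullet> j) *\<^sub>R j)) f
     + integral (cbox (a + (m - a \<bullet> j) *\<^sub>R j) b) f"
  using integral_split[OF assms(1,2), of m] by (simp only: cbox_bisect[OF assms(2-4)])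

text \<open>The two halves are translates of each other in the direction j, along which g is
  constant, so each carries half of the integral.\<close>

lemma integral_bisect_invariant:
  fixes g :: "'a::euclidean_space \<Rightarrow> 'b::euclidean_space"
  assumes g: "g integrable_on cbox a b" and j: "j \<in> Basis" and ab: "a \<bullet> j \<le> b \<bullet> j"
    and inv: "\<And>t s. g (t + s *\<^sub>R j) = g t"
    and m: "m = (a \<bullet> j + b \<bullet> j) / 2"
  shows "integral (cbox a (b + (m - b \<bullet> j) *\<^sub>R j)) g = (1/2) *\<^sub>R integral (cbox a b) g"
    and "integral (cbox (a + (m - a \<bullet> j) *\<^sub>R j) b) g = (1/2) *\<^sub>R integral (cbox a b) g"
proof -
  let ?s = "(m - a \<bullet> j) *\<^sub>R j"
  have "m - a \<bullet> j + (m - b \<bullet> j) = 0" by (simp add: m field_simps)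
  then have "(m - b \<bullet> j) *\<^sub>R j + ?s = 0"
    using scaleR_left_distrib[of "m - b \<bullet> j" "m - a \<bullet> j" j] by (simp add: add.commute)
  then have "b + (m - b \<bullet> j) *\<^sub>R j + ?s = b" by (simp only: add.assoc add_0_right)
  moreover have "g \<circ> (+) ?s = g" using inv by (auto simp: fun_eq_iff add.commute)
  ultimately have eq: "integral (cbox a (b + (m - b \<bullet> j) *\<^sub>R j)) g = integral (cbox (a + ?s) b) g"
    using integral_shift_cbox_plus[of a "b + (m - b \<bullet> j) *\<^sub>R j" g ?s] by (simp only:)
  have sum: "integral (cbox a b) g = integral (cbox a (b + (m - b \<bullet> j) *\<^sub>R j)) g + integral (cbox (a + ?s) b) g"
    by (rule integral_bisect[OF g j]) (use ab m in auto)
  then show "integral (cbox a (b + (m - b \<bullet> j) *\<^sub>R j)) g = (1/2) *\<^sub>R integral (cbox a b) g"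
    "integral (cbox (a + ?s) b) g = (1/2) *\<^sub>R integral (cbox a b) g"
    unfolding eq sum by (simp_all add: scaleR_add_right flip: scaleR_left_distrib)
qed

text \<open>Across directions other than j the integrals simply split. For j itself the two
  contributions of the common middle face \<open>I m\<close> cancel, and the factor 1/2 from halving
  the box is compensated by the halved edge length in the denominator.\<close>

lemma flux_defect_bisect:
  fixes V :: "'a::euclidean_space \<Rightarrow> 'a \<Rightarrow> 'b::euclidean_space"
  assumes V: "\<And>i. i \<in> Basis \<Longrightarrow> continuous_on (cbox a b) (V i)"
    and h: "continuous_on (cbox a b) h"
    and ab: "\<And>i. i \<in> Basis \<Longrightarrow> a \<bullet> i < b \<bullet> i" and j: "j \<in> Basis"
    and m: "m = (a \<bullet> j + b \<bullet> j) / 2"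
  shows "flux_defect V h a b = flux_defect V h a (b + (m - b \<bullet> j) *\<^sub>R j)
     + flux_defect V h (a + (m - a \<bullet> j) *\<^sub>R j) b"
proof -
  define b1 where "b1 = b + (m - b \<bullet> j) *\<^sub>R j"
  define a2 where "a2 = a + (m - a \<bullet> j) *\<^sub>R j"
  have mab: "a \<bullet> j < m" "m < b \<bullet> j" using ab[OF j] m by auto
  have b1i: "b1 \<bullet> i = (if i = j then m else b \<bullet> i)" and a2i: "a2 \<bullet> i = (if i = j then m else a \<bullet> i)"
    if "i \<in> Basis" for i
    using that j by (auto simp: b1_def a2_def inner_simps inner_Basis)
  have fd: "face_difference a' b' i f = (\<lambda>t. f (t + (b' \<bullet> i - t \<bullet> i) *\<^sub>R i) - f (t + (a' \<bullet> i - t \<bullet> i) *\<^sub>R i))"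
    for a' b' i and f :: "'a \<Rightarrow> 'b"
    by (simp add: face_difference_def fun_eq_iff inner_diff_left)
  have split: "integral (cbox a b) f = integral (cbox a b1) f + integral (cbox a2 b) f"
    if "f integrable_on cbox a b" for f :: "'a \<Rightarrow> 'b"
    unfolding b1_def a2_def by (rule integral_bisect[OF that j]) (use mab in auto)
  have "(1 / ((b - a) \<bullet> i)) *\<^sub>R integral (cbox a b) (face_difference a b i (V i))
      = (1 / ((b1 - a) \<bullet> i)) *\<^sub>R integral (cbox a b1) (face_difference a b1 i (V i))
      + (1 / ((b - a2) \<bullet> i)) *\<^sub>R integral (cbox a2 b) (face_difference a2 b i (V i))" if i: "i \<in> Basis" for i
  proof -
    have cont: "continuous_on (cbox a b) (\<lambda>t. V i (t + (c - t \<bullet> i) *\<^sub>R i))" if "a \<bullet> i \<le> c" "c \<le> b \<bullet> i" for c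
      by (rule continuous_on_face[OF V[OF i] i that])
    show ?thesis
    proof (cases "i = j")
      case False
      have "face_difference a b i (V i) integrable_on cbox a b"
        unfolding fd using ab[OF i] by (intro integrable_continuous continuous_on_diff cont) auto
      from split[OF this] show ?thesis
        using False i by (simp add: fd b1i a2i inner_diff_left scaleR_add_right)
    next
      case True
      define W where "W c t = V j (t + (c - t \<bullet> j) *\<^sub>R j)" for c t
      have W: "W c integrable_on cbox a b" if "a \<bullet> j \<le> c" "c \<le> b \<bullet> j" for c
        using cont that True unfolding W_def by (intro integrable_continuous) auto
      have inv: "W c (t + s *\<^sub>R j) = W c t" for c t s
        using j by (simp add: W_def inner_simps algebra_simps)
      define I where "I c = integral (cbox a b) (W c)" for c
      have I1: "integral (cbox a b1) (W c) = (1/2) *\<^sub>R I c" 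
        and I2: "integral (cbox a2 b) (W c) = (1/2) *\<^sub>R I c" if "a \<bullet> j \<le> c" "c \<le> b \<bullet> j" for c
        unfolding b1_def a2_def I_def
        using integral_bisect_invariant[OF W[OF that] j _ inv m] ab[OF j] by auto
      have sub: "cbox a b1 \<subseteq> cbox a b" "cbox a2 b \<subseteq> cbox a b"
        using mab b1i a2i by (auto simp: subset_box split: if_splits intro: less_imp_le) 
      have L: "integral (cbox a b) (face_difference a b j (V j)) = I (b \<bullet> j) - I (a \<bullet> j)"
        unfolding fd I_def using mab
        by (subst Henstock_Kurzweil_Integration.integral_diff[symmetric]) (auto simp: W W_def[symmetric])
      have L1: "integral (cbox a b1) (face_difference a b1 j (V j)) = (1/2) *\<^sub>R (I m - I (a \<bullet> j))"
        unfolding fd b1i[OF j] W_def[symmetric] using mab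
        by (subst Henstock_Kurzweil_Integration.integral_diff)
          (auto simp: I1 scaleR_diff_right intro: integrable_on_subcbox[OF W sub(1)])
      have L2: "integral (cbox a2 b) (face_difference a2 b j (V j)) = (1/2) *\<^sub>R (I (b \<bullet> j) - I m)"
        unfolding fd a2i[OF j] W_def[symmetric] using mab
        by (subst Henstock_Kurzweil_Integration.integral_diff)
          (auto simp: I2 scaleR_diff_right intro: integrable_on_subcbox[OF W sub(2)])
      define l where "l = b \<bullet> j - a \<bullet> j"
      have l: "(b - a) \<bullet> j = l" "(b1 - a) \<bullet> j = l / 2" "(b - a2) \<bullet> j = l / 2"
        using j by (simp_all add: l_def inner_diff_left b1i a2i m field_simps)
      show ?thesis unfolding True L L1 L2 l
        by (simp add: scaleR_diff_right)
    qed
  qed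
  then show ?thesis
    unfolding flux_defect_def b1_def[symmetric] a2_def[symmetric] split[OF integrable_continuous[OF h]]
    by (simp add: sum.distrib)
qed

text \<open>The directions are bisected one after another, each time keeping the half with the
  larger defect, which loses at most a factor 2. The induction runs over the set of directions
  already halved. Halving all of them keeps the new box similar to the old one.\<close>

lemma flux_defect_halve:
  fixes V :: "'a::euclidean_space \<Rightarrow> 'a \<Rightarrow> 'b::euclidean_space"
  assumes V: "\<And>i. i \<in> Basis \<Longrightarrow> continuous_on (cbox a b) (V i)"
    and h: "continuous_on (cbox a b) h"
    and ab: "\<And>i. i \<in> Basis \<Longrightarrow> a \<bullet> i < b \<bullet> i"
  obtains a' b' where "cbox a' b' \<subseteq> cbox a b" "b' - a' = (1/2) *\<^sub>R (b - a)"
    "norm (flux_defect V h a b) \<le> 2 ^ DIM('a) * norm (flux_defect V h a' b')"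
proof -
  have "\<exists>a' b'. cbox a' b' \<subseteq> cbox a b \<and> (\<forall>i\<in>Basis. (b' - a') \<bullet> i = (if i \<in> S then 1/2 else 1) * ((b - a) \<bullet> i))
     \<and> norm (flux_defect V h a b) \<le> 2 ^ card S * norm (flux_defect V h a' b')"
    if "finite S" "S \<subseteq> Basis" for S
    using that
  proof (induction S rule: finite_induct)
    case empty
    then show ?case by (intro exI[of _ a] exI[of _ b]) auto
  next
    case (insert j S)
    then obtain a' b' where sub: "cbox a' b' \<subseteq> cbox a b"
      and l: "\<And>i. i \<in> Basis \<Longrightarrow> (b' - a') \<bullet> i = (if i \<in> S then 1/2 else 1) * ((b - a) \<bullet> i)"
      and n: "norm (flux_defect V h a b) \<le> 2 ^ card S * norm (flux_defect V h a' b')"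
      by blast
    have j: "j \<in> Basis" using insert by auto
    have ab': "a' \<bullet> i < b' \<bullet> i" if "i \<in> Basis" for i
    proof -
      have "0 < (b' - a') \<bullet> i" unfolding l[OF that] using ab[OF that] by (simp add: inner_diff_left)
      then show ?thesis by (simp add: inner_diff_left)
    qed
    define m where "m = (a' \<bullet> j + b' \<bullet> j) / 2"
    define b1 where "b1 = b' + (m - b' \<bullet> j) *\<^sub>R j"
    define a2 where "a2 = a' + (m - a' \<bullet> j) *\<^sub>R j"
    have b1i: "b1 \<bullet> i = (if i = j then m else b' \<bullet> i)" and a2i: "a2 \<bullet> i = (if i = j then m else a' \<bullet> i)"
      if "i \<in> Basis" for i
      using that j by (auto simp: b1_def a2_def inner_simps inner_Basis)
    have "a' \<bullet> j < m" "m < b' \<bullet> j" using ab'[OF j] m_def by auto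
    then have subs: "cbox a' b1 \<subseteq> cbox a' b'" "cbox a2 b' \<subseteq> cbox a' b'"
      using b1i a2i by (auto intro!: subset_box_imp)
    have "flux_defect V h a' b' = flux_defect V h a' b1 + flux_defect V h a2 b'"
      unfolding b1_def a2_def
      by (rule flux_defect_bisect[OF _ _ ab' j m_def])
        (use V h sub in \<open>auto intro: continuous_on_subset\<close>)
    then have "norm (flux_defect V h a' b') \<le> norm (flux_defect V h a' b1) + norm (flux_defect V h a2 b')"
      by (simp add: norm_triangle_ineq)
    then have "norm (flux_defect V h a' b') \<le> 2 * norm (flux_defect V h a' b1) \<or>
        norm (flux_defect V h a' b') \<le> 2 * norm (flux_defect V h a2 b')" by linarith
    then obtain c d where cd: "norm (flux_defect V h a' b') \<le> 2 * norm (flux_defect V h c d)"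
      "c = a' \<and> d = b1 \<or> c = a2 \<and> d = b'" by blast
    have "(d - c) \<bullet> i = (if i \<in> insert j S then 1/2 else 1) * ((b - a) \<bullet> i)" if "i \<in> Basis" for i
    proof (cases "i = j")
      case True
      then have "(d - c) \<bullet> j = (b' - a') \<bullet> j / 2"
        using cd(2) b1i[OF j] a2i[OF j] by (auto simp: inner_diff_left m_def field_simps)
      then show ?thesis using l[OF j] insert.hyps True by simp
    next
      case False
      then have "(d - c) \<bullet> i = (b' - a') \<bullet> i"
        using cd(2) b1i[OF that] a2i[OF that] by (auto simp: inner_diff_left)
      then show ?thesis using l[OF that] False by simp
    qed
    moreover have "cbox c d \<subseteq> cbox a b" using cd(2) subs sub by auto
    moreover have "norm (flux_defect V h a b) \<le> 2 ^ card (insert j S) * norm (flux_defect V h c d)"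
    proof -
      note n
      also have "2 ^ card S * norm (flux_defect V h a' b') \<le> 2 ^ card S * (2 * norm (flux_defect V h c d))"
        by (rule mult_left_mono[OF cd(1)]) simp
      also have "\<dots> = 2 ^ Suc (card S) * norm (flux_defect V h c d)" by simp
      finally show ?thesis by (simp only: card_insert_disjoint[OF insert.hyps])
    qed
    ultimately show ?case by (intro exI[of _ c] exI[of _ d] conjI ballI)
  qed
  from this[OF finite_Basis order_refl] obtain a' b' where *: "cbox a' b' \<subseteq> cbox a b"
    "\<forall>i\<in>Basis. (b' - a') \<bullet> i = (if i \<in> Basis then 1/2 else 1) * ((b - a) \<bullet> i)"
    "norm (flux_defect V h a b) \<le> 2 ^ DIM('a) * norm (flux_defect V h a' b')" by metis
  have "b' - a' = (1/2) *\<^sub>R (b - a)"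
    by (rule euclidean_eqI) (use *(2) in simp)
  from that[OF *(1) this *(3)] show ?thesis .
qed

text \<open>The linear approximation of V at z has constant face quotients that sum to h z, so its
  defect against h z is 0. The error of the approximation is small compared with the diameter s K,
  and the edges of a similar box are proportional to s, hence the quotients are off by an
  arbitrarily small amount and the defect is small compared with the volume.\<close>

lemma flux_defect_local:
  fixes V :: "'a::euclidean_space \<Rightarrow> 'a \<Rightarrow> 'b::euclidean_space"
  assumes V: "\<And>i. i \<in> Basis \<Longrightarrow> continuous_on (cbox a b) (V i)"
    and h: "continuous_on (cbox a b) h"
    and ab: "\<And>i. i \<in> Basis \<Longrightarrow> a \<bullet> i < b \<bullet> i"
    and z: "z \<in> cbox a b"
    and V': "\<And>i. i \<in> Basis \<Longrightarrow> (V i has_derivative V' i) (at z within cbox a b)"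
    and div: "(\<Sum>i\<in>Basis. V' i i) = h z"
    and e: "e > 0"
  obtains d where "d > 0" "\<And>p q s. z \<in> cbox p q \<Longrightarrow> cbox p q \<subseteq> cbox a b \<Longrightarrow> q - p = s *\<^sub>R (b - a) \<Longrightarrow>
     0 < s \<Longrightarrow> s < d \<Longrightarrow> norm (flux_defect V h p q) \<le> e * s ^ DIM('a)"
proof -
  define K where "K = norm (b - a)"
  \<comment> \<open>Collects the loss in all terms: twice the ratio of diameter to edge length for
    each direction, from the two ends of the difference quotient, and 1 for the oscillation of
    h.\<close>
  define \<kappa> where "\<kappa> = (\<Sum>i\<in>Basis. 2 * K / ((b - a) \<bullet> i)) + 1"
  define c where "c = measure lborel (cbox a b)"
  have l: "0 < (b - a) \<bullet> i" if "i \<in> Basis" for i using ab[OF that] by (simp add: inner_diff_left)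
  have K: "0 < K"
  proof -
    obtain i :: 'a where "i \<in> Basis" using nonempty_Basis by blast
    then have "b - a \<noteq> 0" using l by fastforce
    then show ?thesis by (simp add: K_def)
  qed
  have \<kappa>: "0 < \<kappa>" unfolding \<kappa>_def
    using K l by (intro add_nonneg_pos sum_nonneg divide_nonneg_pos) auto
  have "0 \<le> c" by (simp add: c_def)
  define \<eta> where "\<eta> = e / (\<kappa> * (c + 1))"
  have \<eta>: "0 < \<eta>" "\<eta> * \<kappa> * c \<le> e"
  proof -
    have "\<eta> * \<kappa> = e / (c + 1)" using \<kappa> by (simp add: \<eta>_def)
    moreover have "e / (c + 1) * c \<le> e" using e \<open>0 \<le> c\<close> by (simp add: field_simps)
    ultimately show "\<eta> * \<kappa> * c \<le> e" by simp
    show "0 < \<eta>" using e \<kappa> \<open>0 \<le> c\<close> by (simp add: \<eta>_def)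
  qed
  have "\<forall>i\<in>Basis. \<exists>d>0. \<forall>t\<in>cbox a b. norm (t - z) < d \<longrightarrow>
     norm (V i t - V i z - V' i (t - z)) \<le> \<eta> * norm (t - z)"
    using V' \<eta>(1) unfolding has_derivative_within_alt by blast
  then obtain D where D: "\<And>i. i \<in> Basis \<Longrightarrow> D i > 0"
    "\<And>i t. i \<in> Basis \<Longrightarrow> t \<in> cbox a b \<Longrightarrow> norm (t - z) < D i \<Longrightarrow>
       norm (V i t - V i z - V' i (t - z)) \<le> \<eta> * norm (t - z)" by metis
  obtain dh where dh: "dh > 0" "\<And>t. t \<in> cbox a b \<Longrightarrow> dist t z < dh \<Longrightarrow> dist (h t) (h z) < \<eta>"
    using h z \<eta>(1) unfolding continuous_on_iff by blast
  define r where "r = Min (insert dh (D ` Basis))"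
  have "0 < r" unfolding r_def using dh(1) D(1) by (subst Min_gr_iff) auto
  moreover have "r \<le> dh" "r \<le> D i" if "i \<in> Basis" for i
    unfolding r_def using that by (auto intro!: Min_le simp del: Min_insert)
  ultimately have r: "0 < r" "r \<le> dh" "\<And>i. i \<in> Basis \<Longrightarrow> r \<le> D i"
    using nonempty_Basis by blast+
  show ?thesis
  proof (rule that[of "r / K"])
    show "0 < r / K" using r K by simp
    fix p q s assume zpq: "z \<in> cbox p q" and sub: "cbox p q \<subseteq> cbox a b" and pq: "q - p = s *\<^sub>R (b - a)"
      and s: "0 < s" "s < r / K"
    have sK: "norm (q - p) = s * K" using s pq by (simp add: K_def)
    also have "\<dots> < r" using s K by (simp add: field_simps)
    finally have small: "norm (q - p) < r" .
    have close: "norm (t - z) \<le> norm (q - p)" if "t \<in> cbox p q" for t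
    proof (rule norm_le_componentwise)
      fix i :: 'a assume "i \<in> Basis"
      then show "\<bar>(t - z) \<bullet> i\<bar> \<le> \<bar>(q - p) \<bullet> i\<bar>"
        using that zpq by (force simp: mem_box inner_diff_left)
    qed
    have li: "(q - p) \<bullet> i = s * ((b - a) \<bullet> i)" for i by (simp add: pq)
    have pqi: "p \<bullet> i < q \<bullet> i" if "i \<in> Basis" for i
      using li[of i] s l[OF that] by (simp add: inner_diff_left)
        (metis diff_gt_0_iff_gt l mult_pos_pos inner_diff_left that)
    define err where "err i t = (1 / ((q - p) \<bullet> i)) *\<^sub>R face_difference p q i (V i) t - V' i i" for i t
    have fd: "face_difference p q i f t = f (t + (q \<bullet> i - t \<bullet> i) *\<^sub>R i) - f (t + (p \<bullet> i - t \<bullet> i) *\<^sub>R i)"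
      for i t and f :: "'a \<Rightarrow> 'b"
      by (simp add: face_difference_def inner_diff_left)
    have err: "norm (err i t) \<le> \<eta> * (2 * K / ((b - a) \<bullet> i))" if i: "i \<in> Basis" and t: "t \<in> cbox p q" for i t
    proof -
      define u where "u = t + (q \<bullet> i - t \<bullet> i) *\<^sub>R i"
      define v where "v = t + (p \<bullet> i - t \<bullet> i) *\<^sub>R i"
      have uv: "u \<in> cbox p q" "v \<in> cbox p q"
        unfolding u_def v_def using pqi[OF i] by (auto intro!: shift_in_cbox t i)
      interpret V': bounded_linear "V' i" using V'[OF i] by (rule has_derivative_bounded_linear)
      have "u - v = ((q - p) \<bullet> i) *\<^sub>R i" by (simp add: u_def v_def inner_diff_left algebra_simps)
      then have lin: "V' i (u - z) - V' i (v - z) = ((q - p) \<bullet> i) *\<^sub>R V' i i"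
        by (simp add: V'.diff[symmetric] V'.scaleR)
      have bound: "norm (V i w - V i z - V' i (w - z)) \<le> \<eta> * (s * K)" if "w \<in> cbox p q" for w
      proof -
        have "norm (V i w - V i z - V' i (w - z)) \<le> \<eta> * norm (w - z)"
          using D(2)[OF i, of w] that sub close[OF that] small r(3)[OF i] by force
        also have "\<dots> \<le> \<eta> * (s * K)" using close[OF that] \<eta>(1) sK by simp
        finally show ?thesis .
      qed
      have "err i t = (1 / ((q - p) \<bullet> i)) *\<^sub>R (V i u - V i v - ((q - p) \<bullet> i) *\<^sub>R V' i i)"
        using pqi[OF i] by (simp add: err_def fd u_def v_def scaleR_diff_right inner_diff_left)
      also have "V i u - V i v - ((q - p) \<bullet> i) *\<^sub>R V' i i
         = (V i u - V i z - V' i (u - z)) - (V i v - V i z - V' i (v - z))"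
        by (simp flip: lin)
      finally have "norm (err i t) = (1 / ((q - p) \<bullet> i)) *
         norm ((V i u - V i z - V' i (u - z)) - (V i v - V i z - V' i (v - z)))"
        using pqi[OF i] by (simp add: inner_diff_left)
      also have "\<dots> \<le> (1 / ((q - p) \<bullet> i)) * (\<eta> * (s * K) + \<eta> * (s * K))"
        by (rule mult_left_mono[OF order_trans[OF norm_triangle_ineq4 add_mono[OF bound[OF uv(1)] bound[OF uv(2)]]]])
          (use pqi[OF i] in \<open>simp add: inner_diff_left less_imp_le\<close>)
      also have "\<dots> = \<eta> * (2 * K / ((b - a) \<bullet> i))" unfolding li using s by (simp add: field_simps)
      finally show ?thesis .
    qed
    have conth: "continuous_on (cbox p q) h" using h sub by (rule continuous_on_subset)
    have contf: "continuous_on (cbox p q) (face_difference p q i (V i))" if "i \<in> Basis" for i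
      unfolding fd[abs_def] using pqi[OF that] continuous_on_subset[OF V[OF that] sub]
      by (intro continuous_on_diff continuous_on_face that) auto
    have "flux_defect V h p q = integral (cbox p q)
       (\<lambda>t. (\<Sum>i\<in>Basis. (1 / ((q - p) \<bullet> i)) *\<^sub>R face_difference p q i (V i) t) - h t)"
    proof -
      have "integral (cbox p q) (\<lambda>t. \<Sum>i\<in>Basis. (1 / ((q - p) \<bullet> i)) *\<^sub>R face_difference p q i (V i) t)
        = (\<Sum>i\<in>Basis. (1 / ((q - p) \<bullet> i)) *\<^sub>R integral (cbox p q) (face_difference p q i (V i)))"
        by (subst Henstock_Kurzweil_Integration.integral_sum)
          (auto intro!: integrable_continuous continuous_intros contf)
      then show ?thesis unfolding flux_defect_def
        by (subst Henstock_Kurzweil_Integration.integral_diff)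
          (auto intro!: integrable_continuous continuous_intros contf conth)
    qed
    moreover have "norm (integral (cbox p q)
       (\<lambda>t. (\<Sum>i\<in>Basis. (1 / ((q - p) \<bullet> i)) *\<^sub>R face_difference p q i (V i) t) - h t)) \<le> \<eta> * \<kappa> * measure lborel (cbox p q)"
    proof (rule has_integral_bound[OF _ integrable_integral])
      show "0 \<le> \<eta> * \<kappa>" using \<eta> \<kappa> by simp
      show "(\<lambda>t. (\<Sum>i\<in>Basis. (1 / ((q - p) \<bullet> i)) *\<^sub>R face_difference p q i (V i) t) - h t) integrable_on cbox p q"
        by (auto intro!: integrable_continuous continuous_intros contf conth)
      fix t assume t: "t \<in> cbox p q"
      have "dist t z < dh" using close[OF t] small r(2) by (simp add: dist_norm)
      then have "norm (h t - h z) \<le> \<eta>"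
        using dh(2)[of t] t sub by (force simp: dist_norm)
      have "(\<Sum>i\<in>Basis. (1 / ((q - p) \<bullet> i)) *\<^sub>R face_difference p q i (V i) t) - h t
         = (\<Sum>i\<in>Basis. err i t) - (h t - h z)"
        by (simp add: err_def sum_subtractf div)
      then have "norm ((\<Sum>i\<in>Basis. (1 / ((q - p) \<bullet> i)) *\<^sub>R face_difference p q i (V i) t) - h t)
         \<le> norm (\<Sum>i\<in>Basis. err i t) + norm (h t - h z)"
        by (simp only: norm_triangle_ineq4)
      also have "\<dots> \<le> (\<Sum>i\<in>Basis. \<eta> * (2 * K / ((b - a) \<bullet> i))) + \<eta>"
        using \<open>norm (h t - h z) \<le> \<eta>\<close> by (intro add_mono sum_norm_le err t)
      also have "\<dots> = \<eta> * \<kappa>" by (simp add: \<kappa>_def sum_distrib_left distrib_left)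
      finally show "norm ((\<Sum>i\<in>Basis. (1 / ((q - p) \<bullet> i)) *\<^sub>R face_difference p q i (V i) t) - h t) \<le> \<eta> * \<kappa>" .
    qed
    moreover have "measure lborel (cbox p q) = s ^ DIM('a) * c"
    proof -
      have "measure lborel (cbox p q) = (\<Prod>i\<in>Basis. (q - p) \<bullet> i)"
        using pqi by (subst content_cbox) (auto simp: less_imp_le inner_diff_left)
      also have "\<dots> = s ^ DIM('a) * (\<Prod>i\<in>Basis. (b - a) \<bullet> i)"
        unfolding li by (simp add: prod.distrib)
      also have "(\<Prod>i\<in>Basis. (b - a) \<bullet> i) = c"
        unfolding c_def using ab by (subst content_cbox) (auto simp: less_imp_le inner_diff_left)
      finally show ?thesis .
    qed
    ultimately have "norm (flux_defect V h p q) \<le> (\<eta> * \<kappa> * c) * s ^ DIM('a)" by (simp add: mult_ac)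
    also have "\<dots> \<le> e * s ^ DIM('a)" using \<eta>(2) s by (intro mult_right_mono) auto
    finally show "norm (flux_defect V h p q) \<le> e * s ^ DIM('a)" .
  qed
qed

text \<open>If the defect had norm E > 0, repeated halving would give nested boxes at scale 2^-n
  whose defect is at least E times 2^-n to the power of the dimension. At their common point
  \<open>flux_defect_local\<close> bounds it by half of that once n is large.\<close>

theorem flux_defect_eq_0:
  fixes V :: "'a::euclidean_space \<Rightarrow> 'a \<Rightarrow> 'b::euclidean_space"
  assumes ab: "\<And>i. i \<in> Basis \<Longrightarrow> a \<bullet> i < b \<bullet> i"
    and h: "continuous_on (cbox a b) h"
    and V': "\<And>i z. i \<in> Basis \<Longrightarrow> z \<in> cbox a b \<Longrightarrow> (V i has_derivative V' z i) (at z within cbox a b)"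
    and div: "\<And>z. z \<in> cbox a b \<Longrightarrow> (\<Sum>i\<in>Basis. V' z i i) = h z"
  shows "flux_defect V h a b = 0"
proof (rule ccontr)
  assume "flux_defect V h a b \<noteq> 0"
  define E where "E = norm (flux_defect V h a b)"
  have E: "0 < E" using \<open>flux_defect V h a b \<noteq> 0\<close> by (simp add: E_def)
  have V: "continuous_on (cbox a b) (V i)" if "i \<in> Basis" for i
    using V'[OF that] by (auto simp: continuous_on_eq_continuous_within intro: has_derivative_continuous)
  define P where "P n pq \<longleftrightarrow> (case pq of (p, q) \<Rightarrow> cbox p q \<subseteq> cbox a b \<and> q - p = (1/2) ^ n *\<^sub>R (b - a)
     \<and> E \<le> (2 ^ n) ^ DIM('a) * norm (flux_defect V h p q))" for n :: nat and pq
  have "\<exists>f. \<forall>n. P n (f n) \<and> cbox (fst (f (Suc n))) (snd (f (Suc n))) \<subseteq> cbox (fst (f n)) (snd (f n))"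
  proof (rule dependent_nat_choice)
    show "\<exists>x. P 0 x" by (intro exI[of _ "(a, b)"]) (simp add: P_def E_def)
    fix x n assume "P n x"
    moreover obtain p q where x: "x = (p, q)" by (cases x)
    ultimately have pq: "cbox p q \<subseteq> cbox a b" "q - p = (1/2) ^ n *\<^sub>R (b - a)"
      "E \<le> (2 ^ n) ^ DIM('a) * norm (flux_defect V h p q)" by (auto simp: P_def)
    have pqi: "p \<bullet> i < q \<bullet> i" if "i \<in> Basis" for i
    proof -
      have "(q - p) \<bullet> i = (1/2) ^ n * ((b - a) \<bullet> i)" using pq(2) by simp
      moreover have "0 < (1/2) ^ n * ((b - a) \<bullet> i)" using ab[OF that] by (simp add: inner_diff_left)
      ultimately show ?thesis by (simp add: inner_diff_left)
    qed
    obtain p' q' where *: "cbox p' q' \<subseteq> cbox p q" "q' - p' = (1/2) *\<^sub>R (q - p)"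
      "norm (flux_defect V h p q) \<le> 2 ^ DIM('a) * norm (flux_defect V h p' q')"
      using flux_defect_halve[of p q V h, OF continuous_on_subset[OF V pq(1)] continuous_on_subset[OF h pq(1)] pqi]
      by blast
    have "E \<le> (2 ^ n) ^ DIM('a) * (2 ^ DIM('a) * norm (flux_defect V h p' q'))"
    proof -
      note pq(3)
      also have "(2 ^ n) ^ DIM('a) * norm (flux_defect V h p q)
          \<le> (2 ^ n) ^ DIM('a) * (2 ^ DIM('a) * norm (flux_defect V h p' q'))"
        by (rule mult_left_mono[OF *(3)]) simp
      finally show ?thesis .
    qed
    moreover have "(2 ^ n) ^ DIM('a) * (2 ^ DIM('a) * norm (flux_defect V h p' q'))
        = (2 ^ Suc n) ^ DIM('a) * norm (flux_defect V h p' q')"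
      by (simp add: power_mult_distrib)
    moreover have "q' - p' = (1/2) ^ Suc n *\<^sub>R (b - a)" using *(2) pq(2) by simp
    ultimately have "P (Suc n) (p', q')"
      using *(1) pq(1) by (simp only: P_def prod.case) blast
    then show "\<exists>y. P (Suc n) y \<and> cbox (fst y) (snd y) \<subseteq> cbox (fst x) (snd x)"
      using *(1) x by (intro exI[of _ "(p', q')"]) auto
  qed
  then obtain f where f: "\<And>n. P n (f n)"
    "\<And>n. cbox (fst (f (Suc n))) (snd (f (Suc n))) \<subseteq> cbox (fst (f n)) (snd (f n))" by blast
  define F where "F n = cbox (fst (f n)) (snd (f n))" for n
  have Pn: "F n \<subseteq> cbox a b" "snd (f n) - fst (f n) = (1/2) ^ n *\<^sub>R (b - a)"
    "E \<le> (2 ^ n) ^ DIM('a) * norm (flux_defect V h (fst (f n)) (snd (f n)))" for n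
    using f(1)[of n] by (auto simp: P_def F_def case_prod_beta)
  have "\<Inter>(range F) \<noteq> {}"
  proof (rule compact_nest)
    show "compact (F n)" for n by (simp add: F_def)
    show "F n \<noteq> {}" for n
    proof -
      have "fst (f n) \<bullet> i \<le> snd (f n) \<bullet> i" if "i \<in> Basis" for i
      proof -
        have "(snd (f n) - fst (f n)) \<bullet> i = (1/2) ^ n * ((b - a) \<bullet> i)" by (simp add: Pn(2))
        moreover have "0 \<le> (1/2) ^ n * ((b - a) \<bullet> i)" using ab[OF that] by (simp add: inner_diff_left)
        ultimately show ?thesis by (simp add: inner_diff_left)
      qed
      then show ?thesis by (simp add: F_def box_ne_empty)
    qed
    show "F n \<subseteq> F m" if "m \<le> n" for m n
      using that f(2) unfolding F_def by (rule lift_Suc_antimono_le[rotated])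
  qed
  then obtain z where z: "\<And>n. z \<in> F n" by blast
  then have zab: "z \<in> cbox a b" using Pn(1) by blast
  obtain d where d: "d > 0" "\<And>p q s. z \<in> cbox p q \<Longrightarrow> cbox p q \<subseteq> cbox a b \<Longrightarrow> q - p = s *\<^sub>R (b - a) \<Longrightarrow>
     0 < s \<Longrightarrow> s < d \<Longrightarrow> norm (flux_defect V h p q) \<le> (E / 2) * s ^ DIM('a)"
    using flux_defect_local[OF V h ab zab V'[OF _ zab] div[OF zab], of "E / 2"] E by auto
  obtain n where n: "(1/2) ^ n < d" using d(1) real_arch_pow_inv[of d "1/2"] by auto
  have "norm (flux_defect V h (fst (f n)) (snd (f n))) \<le> (E / 2) * ((1/2) ^ n) ^ DIM('a)"
    using z[of n] Pn(1)[of n] Pn(2)[of n] n by (intro d(2)) (auto simp: F_def)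
  then have "(2 ^ n) ^ DIM('a) * norm (flux_defect V h (fst (f n)) (snd (f n)))
      \<le> (2 ^ n) ^ DIM('a) * ((E / 2) * ((1/2) ^ n) ^ DIM('a))"
    by (intro mult_left_mono) auto
  also have "\<dots> = E / 2" by (simp add: power_one_over power_divide)
  finally show False using Pn(3)[of n] E by linarith
qed

section \<open>Square integrable random variables\<close>

definition sq_integrable :: "'w measure \<Rightarrow> ('w \<Rightarrow> complex) \<Rightarrow> bool" where
  "sq_integrable M X \<longleftrightarrow> X \<in> borel_measurable M \<and> integrable M (\<lambda>\<omega>. (cmod (X \<omega>))\<^sup>2)"

lemma sq_integrable_cnj:
  assumes "sq_integrable M X"
  shows "sq_integrable M (\<lambda>\<omega>. cnj (X \<omega>))"
proof -
  have "cnj \<in> borel_measurable borel"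
    by (intro borel_measurable_continuous_onI continuous_intros)
  then show ?thesis using assms measurable_compose[of X M borel cnj]
    by (simp add: sq_integrable_def)
qed

lemma sq_integrable_add:
  assumes "sq_integrable M X" "sq_integrable M Y"
  shows "sq_integrable M (\<lambda>\<omega>. X \<omega> + Y \<omega>)"
proof -
  have [measurable]: "X \<in> borel_measurable M" "Y \<in> borel_measurable M"
    using assms by (simp_all add: sq_integrable_def)
  have "integrable M (\<lambda>\<omega>. (cmod (X \<omega> + Y \<omega>))\<^sup>2)"
  proof (rule Bochner_Integration.integrable_bound)
    show "integrable M (\<lambda>\<omega>. 2 * (cmod (X \<omega>))\<^sup>2 + 2 * (cmod (Y \<omega>))\<^sup>2)"
      using assms by (simp add: sq_integrable_def)
    have "(cmod (x + y))\<^sup>2 \<le> 2 * (cmod x)\<^sup>2 + 2 * (cmod y)\<^sup>2" for x y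
    proof -
      have "(cmod (x + y))\<^sup>2 \<le> (cmod x + cmod y)\<^sup>2"
        by (intro power_mono norm_triangle_ineq) simp
      also have "\<dots> \<le> 2 * (cmod x)\<^sup>2 + 2 * (cmod y)\<^sup>2"
        using sum_squares_bound[of "cmod x" "cmod y"] by (simp add: power2_sum)
      finally show ?thesis .
    qed
    then show "AE \<omega> in M. norm ((cmod (X \<omega> + Y \<omega>))\<^sup>2) \<le> norm (2 * (cmod (X \<omega>))\<^sup>2 + 2 * (cmod (Y \<omega>))\<^sup>2)"
      by (intro AE_I2) simp
  qed simp
  then show ?thesis by (simp add: sq_integrable_def)
qed

lemma sq_integrable_cmult:
  assumes "sq_integrable M X"
  shows "sq_integrable M (\<lambda>\<omega>. c * X \<omega>)"
  using assms borel_measurable_times[of "\<lambda>_. c" M X]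
  by (simp add: sq_integrable_def norm_mult power_mult_distrib)

lemma sq_integrable_0: "sq_integrable M (\<lambda>\<omega>. 0)"
  by (simp add: sq_integrable_def)

lemma sq_integrable_sum:
  "(\<And>i. i \<in> I \<Longrightarrow> sq_integrable M (X i)) \<Longrightarrow> sq_integrable M (\<lambda>\<omega>. \<Sum>i\<in>I. X i \<omega>)"
  by (induction I rule: infinite_finite_induct) (auto intro: sq_integrable_add sq_integrable_0)

lemma sq_integrable_diff:
  assumes "sq_integrable M X" "sq_integrable M Y"
  shows "sq_integrable M (\<lambda>\<omega>. X \<omega> - Y \<omega>)"
  using sq_integrable_add[OF assms(1) sq_integrable_cmult[OF assms(2), of "-1"]] by simp

lemma integrable_norm_mult:
  assumes "sq_integrable M X" "sq_integrable M Y"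
  shows "integrable M (\<lambda>\<omega>. cmod (X \<omega>) * cmod (Y \<omega>))"
proof (rule Bochner_Integration.integrable_bound)
  have [measurable]: "X \<in> borel_measurable M" "Y \<in> borel_measurable M"
    using assms by (simp_all add: sq_integrable_def)
  show "integrable M (\<lambda>\<omega>. (cmod (X \<omega>))\<^sup>2 + (cmod (Y \<omega>))\<^sup>2)"
    using assms by (simp add: sq_integrable_def)
  show "(\<lambda>\<omega>. cmod (X \<omega>) * cmod (Y \<omega>)) \<in> borel_measurable M" by measurable
  have "u * v \<le> u\<^sup>2 + v\<^sup>2" if "0 \<le> u" "0 \<le> v" for u v :: real
    using sum_squares_bound[of u v] mult_nonneg_nonneg[OF that] by linarith
  then show "AE \<omega> in M. norm (cmod (X \<omega>) * cmod (Y \<omega>)) \<le> norm ((cmod (X \<omega>))\<^sup>2 + (cmod (Y \<omega>))\<^sup>2)"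
    by (intro AE_I2) simp
qed

lemma integrable_sq_mult:
  assumes "sq_integrable M X" "sq_integrable M Y"
  shows "integrable M (\<lambda>\<omega>. X \<omega> * Y \<omega>)"
proof (rule Bochner_Integration.integrable_bound[OF integrable_norm_mult[OF assms]])
  have [measurable]: "X \<in> borel_measurable M" "Y \<in> borel_measurable M"
    using assms by (simp_all add: sq_integrable_def)
  show "(\<lambda>\<omega>. X \<omega> * Y \<omega>) \<in> borel_measurable M" by measurable
qed (simp add: norm_mult)

lemma Cauchy_Schwarz_integral:
  assumes "sq_integrable M X" "sq_integrable M Y"
  shows "(cmod (\<integral>\<omega>. X \<omega> * Y \<omega> \<partial>M))\<^sup>2 \<le> (\<integral>\<omega>. (cmod (X \<omega>))\<^sup>2 \<partial>M) * (\<integral>\<omega>. (cmod (Y \<omega>))\<^sup>2 \<partial>M)"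
proof -
  have [measurable]: "X \<in> borel_measurable M" "Y \<in> borel_measurable M"
    using assms by (simp_all add: sq_integrable_def)
  define B where "B = (\<integral>\<omega>. cmod (X \<omega>) * cmod (Y \<omega>) \<partial>M)"
  have B: "0 \<le> B" unfolding B_def by (intro Bochner_Integration.integral_nonneg) simp
  have "(\<integral>\<^sup>+\<omega>. ennreal (cmod (X \<omega>)) * ennreal (cmod (Y \<omega>)) \<partial>M)\<^sup>2
     \<le> (\<integral>\<^sup>+\<omega>. (ennreal (cmod (X \<omega>)))\<^sup>2 \<partial>M) * (\<integral>\<^sup>+\<omega>. (ennreal (cmod (Y \<omega>)))\<^sup>2 \<partial>M)"
    by (rule Cauchy_Schwarz_nn_integral) measurable
  also have "(\<integral>\<^sup>+\<omega>. ennreal (cmod (X \<omega>)) * ennreal (cmod (Y \<omega>)) \<partial>M) = ennreal B"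
    unfolding B_def using nn_integral_eq_integral[OF integrable_norm_mult[OF assms]]
    by (simp add: ennreal_mult)
  also have "(\<integral>\<^sup>+\<omega>. (ennreal (cmod (X \<omega>)))\<^sup>2 \<partial>M) = ennreal (\<integral>\<omega>. (cmod (X \<omega>))\<^sup>2 \<partial>M)"
    using assms(1) by (simp add: ennreal_power nn_integral_eq_integral sq_integrable_def)
  also have "(\<integral>\<^sup>+\<omega>. (ennreal (cmod (Y \<omega>)))\<^sup>2 \<partial>M) = ennreal (\<integral>\<omega>. (cmod (Y \<omega>))\<^sup>2 \<partial>M)"
    using assms(2) by (simp add: ennreal_power nn_integral_eq_integral sq_integrable_def)
  finally have "B\<^sup>2 \<le> (\<integral>\<omega>. (cmod (X \<omega>))\<^sup>2 \<partial>M) * (\<integral>\<omega>. (cmod (Y \<omega>))\<^sup>2 \<partial>M)"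
    using B by (simp add: ennreal_power flip: ennreal_mult)
  moreover have "cmod (\<integral>\<omega>. X \<omega> * Y \<omega> \<partial>M) \<le> B"
    unfolding B_def using integral_norm_bound[of M "\<lambda>\<omega>. X \<omega> * Y \<omega>"] by (simp add: norm_mult)
  then have "(cmod (\<integral>\<omega>. X \<omega> * Y \<omega> \<partial>M))\<^sup>2 \<le> B\<^sup>2" by (intro power_mono) simp_all
  ultimately show ?thesis by linarith
qed

definition L2_limit :: "'w measure \<Rightarrow> (nat \<Rightarrow> 'w \<Rightarrow> complex) \<Rightarrow> ('w \<Rightarrow> complex) \<Rightarrow> bool" where
  "L2_limit M Xn X \<longleftrightarrow> (\<forall>n. sq_integrable M (Xn n)) \<and> sq_integrable M X
     \<and> (\<lambda>n. \<integral>\<omega>. (cmod (Xn n \<omega> - X \<omega>))\<^sup>2 \<partial>M) \<longlonglongrightarrow> 0"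

lemma L2_limit_const: "sq_integrable M X \<Longrightarrow> L2_limit M (\<lambda>n. X) X"
  by (simp add: L2_limit_def)

lemma L2_limit_cnj: "L2_limit M Xn X \<Longrightarrow> L2_limit M (\<lambda>n \<omega>. cnj (Xn n \<omega>)) (\<lambda>\<omega>. cnj (X \<omega>))"
  by (simp add: L2_limit_def sq_integrable_cnj flip: complex_cnj_diff)

text \<open>The difference of the products is (Xn - X) (Yn - Y) + (Xn - X) Y + (Yn - Y) X, and
  Cauchy-Schwarz makes each term tend to 0. With one factor held constant this lets an expectation
  pass to the limit of the partial expansions.\<close>

lemma L2_limit_integral_mult:
  assumes X: "L2_limit M Xn X" and Y: "L2_limit M Yn Y"
  shows "(\<lambda>n. \<integral>\<omega>. Xn n \<omega> * Yn n \<omega> \<partial>M) \<longlonglongrightarrow> (\<integral>\<omega>. X \<omega> * Y \<omega> \<partial>M)"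
proof -
  have sX: "sq_integrable M (Xn n)" "sq_integrable M X" for n using X by (simp_all add: L2_limit_def)
  have sY: "sq_integrable M (Yn n)" "sq_integrable M Y" for n using Y by (simp_all add: L2_limit_def)
  let ?A = "\<lambda>n. \<integral>\<omega>. (Xn n \<omega> - X \<omega>) * (Yn n \<omega> - Y \<omega>) \<partial>M"
  let ?B = "\<lambda>n. \<integral>\<omega>. (Xn n \<omega> - X \<omega>) * Y \<omega> \<partial>M"
  let ?C = "\<lambda>n. \<integral>\<omega>. (Yn n \<omega> - Y \<omega>) * X \<omega> \<partial>M"
  let ?x = "\<lambda>n. \<integral>\<omega>. (cmod (Xn n \<omega> - X \<omega>))\<^sup>2 \<partial>M" and ?y = "\<lambda>n. \<integral>\<omega>. (cmod (Yn n \<omega> - Y \<omega>))\<^sup>2 \<partial>M"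
  have lim: "?x \<longlonglongrightarrow> 0" "?y \<longlonglongrightarrow> 0" using X Y by (simp_all add: L2_limit_def)
  have null: "u \<longlonglongrightarrow> 0" if "\<And>n. (cmod (u n))\<^sup>2 \<le> v n" "v \<longlonglongrightarrow> 0" for u :: "nat \<Rightarrow> complex" and v
  proof -
    have "(\<lambda>n. (cmod (u n))\<^sup>2) \<longlonglongrightarrow> 0"
      by (rule tendsto_sandwich[OF _ _ tendsto_const that(2)]) (use that(1) in auto)
    then show ?thesis by (simp add: tendsto_norm_zero_iff)
  qed
  have "?A \<longlonglongrightarrow> 0"
    using Cauchy_Schwarz_integral[OF sq_integrable_diff[OF sX] sq_integrable_diff[OF sY]]
      tendsto_mult[OF lim] by (intro null[where v = "\<lambda>n. ?x n * ?y n"]) auto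
  moreover have "?B \<longlonglongrightarrow> 0"
    using Cauchy_Schwarz_integral[OF sq_integrable_diff[OF sX] sY(2)] tendsto_mult_right[OF lim(1)]
    by (intro null[where v = "\<lambda>n. ?x n * (\<integral>\<omega>. (cmod (Y \<omega>))\<^sup>2 \<partial>M)"]) auto
  moreover have "?C \<longlonglongrightarrow> 0"
    using Cauchy_Schwarz_integral[OF sq_integrable_diff[OF sY] sX(2)] tendsto_mult_right[OF lim(2)]
    by (intro null[where v = "\<lambda>n. ?y n * (\<integral>\<omega>. (cmod (X \<omega>))\<^sup>2 \<partial>M)"]) auto
  ultimately have "(\<lambda>n. ?A n + ?B n + ?C n + (\<integral>\<omega>. X \<omega> * Y \<omega> \<partial>M)) \<longlonglongrightarrow> 0 + 0 + 0 + (\<integral>\<omega>. X \<omega> * Y \<omega> \<partial>M)"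
    by (intro tendsto_add tendsto_const)
  moreover have "(\<integral>\<omega>. Xn n \<omega> * Yn n \<omega> \<partial>M) = ?A n + ?B n + ?C n + (\<integral>\<omega>. X \<omega> * Y \<omega> \<partial>M)" for n
  proof -
    have "Xn n \<omega> * Yn n \<omega> = (Xn n \<omega> - X \<omega>) * (Yn n \<omega> - Y \<omega>) + (Xn n \<omega> - X \<omega>) * Y \<omega> + (Yn n \<omega> - Y \<omega>) * X \<omega> + X \<omega> * Y \<omega>" for \<omega>
      by (simp add: algebra_simps)
    then show ?thesis
      by (simp add: integrable_sq_mult sq_integrable_diff sX sY)
  qed
  ultimately show ?thesis by simp
qed

lemma bounded_on_S2:
  fixes g :: "real ^ 3 \<Rightarrow> 'b::real_normed_vector"
  assumes "continuous_on S2 g"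
  obtains B where "\<forall>x\<in>S2. norm (g x) \<le> B"
proof -
  have "bounded (g ` S2)"
    by (rule compact_imp_bounded[OF compact_continuous_image[OF assms compact_sphere]])
  then obtain B where "\<forall>x\<in>S2. norm (g x) \<le> B" unfolding bounded_iff by blast
  then show ?thesis by (rule that)
qed

lemma emeasure_S2: "emeasure surface_measure S2 < top"
  using surface.emeasure_finite[of S2] by (simp add: less_top[symmetric])

section \<open>Spectral analysis of spherical random fields\<close>

locale expanded_field = prob_space M for M :: "'w measure" +
  fixes T :: "'w \<Rightarrow> real ^ 3 \<Rightarrow> real"
  assumes field: "spherical_random_field M T"
    and expansion: "harmonic_expansion M T"
begin

sublocale pair_sigma_finite M surface_measure ..

abbreviation C :: "real ^ 3 \<Rightarrow> real ^ 3 \<Rightarrow> real" where "C \<equiv> cov_fun M T"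

lemma measurable_field:
  "(\<lambda>(\<omega>, x). T \<omega> x) \<in> borel_measurable (M \<Otimes>\<^sub>M surface_measure)"
  using field by (simp add: spherical_random_field_def)

lemma measurable_field_pair [measurable]:
  "(\<lambda>z. T (fst z) (snd z)) \<in> borel_measurable (M \<Otimes>\<^sub>M surface_measure)"
  using measurable_field by (simp only: case_prod_unfold)

lemma measurable_field_sq:
  "(\<lambda>z. ennreal ((T (fst z) (snd z))\<^sup>2)) \<in> borel_measurable (M \<Otimes>\<^sub>M surface_measure)"
  by (rule measurable_compose[OF borel_measurable_power[OF measurable_field_pair] measurable_ennreal])

lemma measurable_field_at:
  assumes "x \<in> S2"
  shows "(\<lambda>\<omega>. T \<omega> x) \<in> borel_measurable M"
  using measurable_compose[OF measurable_Pair2'[of x surface_measure M] measurable_field_pair] assms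
  by simp

lemma sq_integrable_field:
  assumes "x \<in> S2"
  shows "sq_integrable M (\<lambda>\<omega>. of_real (T \<omega> x))"
  using field measurable_field_at[OF assms] assms
  by (simp add: sq_integrable_def spherical_random_field_def)

lemma cov_eq:
  assumes "x \<in> S2" "y \<in> S2"
  shows "C x y = (\<integral>\<omega>. T \<omega> x * T \<omega> y \<partial>M)"
  using field assms by (simp add: cov_fun_def spherical_random_field_def)

lemma cov_commute: "C x y = C y x"
  by (simp add: cov_fun_def mult.commute)

lemma continuous_on_cov: "continuous_on (S2 \<times> S2) (\<lambda>(x, y). C x y)"
  using field by (simp add: spherical_random_field_def)

lemma continuous_on_cov_left:
  assumes "y \<in> S2"
  shows "continuous_on S2 (\<lambda>x. C x y)"
proof -
  have "continuous_on S2 ((\<lambda>(x, y). C x y) \<circ> (\<lambda>x. (x, y)))"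
    using assms
    by (intro continuous_on_compose continuous_on_subset[OF continuous_on_cov] continuous_intros) auto
  then show ?thesis by (simp add: o_def)
qed

lemma continuous_on_cov_right:
  assumes "x \<in> S2"
  shows "continuous_on S2 (\<lambda>y. C x y)"
  using continuous_on_cov_left[OF assms] by (simp add: cov_commute)

text \<open>By Tonelli the inner integral is the variance \<open>C x x\<close>, which is bounded
  because C is continuous on a compact set, and the sphere has finite area.\<close>

lemma nn_integral_field_sq: "(\<integral>\<^sup>+(\<omega>, x). ennreal ((T \<omega> x)\<^sup>2) \<partial>(M \<Otimes>\<^sub>M surface_measure)) < \<infinity>"
proof -
  have "compact ((\<lambda>(x, y). C x y) ` (S2 \<times> S2))"
    by (rule compact_continuous_image[OF continuous_on_cov compact_Times[OF compact_sphere compact_sphere]])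
  then obtain B where "\<forall>z\<in>(\<lambda>(x, y). C x y) ` (S2 \<times> S2). norm z \<le> B"
    unfolding compact_eq_bounded_closed bounded_iff by (elim conjE) (erule exE, rule that)
  then have B: "\<bar>C x y\<bar> \<le> B" if "x \<in> S2" "y \<in> S2" for x y using that by force
  have "(\<integral>\<^sup>+(\<omega>, x). ennreal ((T \<omega> x)\<^sup>2) \<partial>(M \<Otimes>\<^sub>M surface_measure))
      = (\<integral>\<^sup>+x. (\<integral>\<^sup>+\<omega>. ennreal ((T \<omega> x)\<^sup>2) \<partial>M) \<partial>surface_measure)"
    using nn_integral_snd[OF measurable_field_sq] by (simp only: case_prod_unfold fst_conv snd_conv)
  also have "\<dots> \<le> (\<integral>\<^sup>+x. ennreal B \<partial>surface_measure)"
  proof (rule nn_integral_mono)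
    fix x :: "real ^ 3" assume "x \<in> space surface_measure"
    then have x: "x \<in> S2" by simp
    have "(\<integral>\<^sup>+\<omega>. ennreal ((T \<omega> x)\<^sup>2) \<partial>M) = ennreal (C x x)"
      using sq_integrable_field[OF x] cov_eq[OF x x]
      by (simp add: nn_integral_eq_integral sq_integrable_def power2_eq_square)
    also have "\<dots> \<le> ennreal B" using B[OF x x] by (intro ennreal_leI) simp
    finally show "(\<integral>\<^sup>+\<omega>. ennreal ((T \<omega> x)\<^sup>2) \<partial>M) \<le> ennreal B" .
  qed
  also have "\<dots> = ennreal B * emeasure surface_measure (space surface_measure)" by simp
  also have "\<dots> < \<infinity>" by (simp add: ennreal_mult_less_top emeasure_S2)
  finally show ?thesis .
qed

lemma integrable_field_sq: "integrable (M \<Otimes>\<^sub>M surface_measure) (\<lambda>(\<omega>, x). (T \<omega> x)\<^sup>2)"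
  unfolding case_prod_unfold
proof (rule integrableI_bounded)
  show "(\<integral>\<^sup>+z. ennreal (norm ((T (fst z) (snd z))\<^sup>2)) \<partial>(M \<Otimes>\<^sub>M surface_measure)) < \<infinity>"
    using nn_integral_field_sq by (simp add: case_prod_unfold)
  show "(\<lambda>z. (T (fst z) (snd z))\<^sup>2) \<in> borel_measurable (M \<Otimes>\<^sub>M surface_measure)"
    by (rule borel_measurable_power[OF measurable_field_pair])
qed

section \<open>Random surface integrals of the field and the spectrum as a double integral of the
  covariance\<close>

definition surface_functional :: "(real ^ 3 \<Rightarrow> complex) \<Rightarrow> 'w \<Rightarrow> complex" where
  "surface_functional g \<omega> = (\<integral>x. of_real (T \<omega> x) * g x \<partial>surface_measure)"

lemma sq_integrable_surface_functional:
  assumes g: "continuous_on S2 g"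
  shows "sq_integrable M (surface_functional g)"
proof -
  have [measurable]: "g \<in> borel_measurable surface_measure" by (rule borel_measurable_surface[OF g])
  have m [measurable]: "surface_functional g \<in> borel_measurable M"
    unfolding surface_functional_def by measurable
  obtain B where B: "\<forall>x\<in>S2. cmod (g x) \<le> B" using bounded_on_S2[OF g] .
  let ?V = "\<integral>\<^sup>+x. (ennreal B)\<^sup>2 \<partial>surface_measure"
  have "?V < \<infinity>" by (simp add: ennreal_mult_less_top emeasure_S2 power_less_top_ennreal)
  have bound: "ennreal ((cmod (surface_functional g \<omega>))\<^sup>2) \<le> (\<integral>\<^sup>+x. ennreal ((T \<omega> x)\<^sup>2) \<partial>surface_measure) * ?V"
    if w: "\<omega> \<in> space M" for \<omega>
  proof -
    have [measurable]: "(\<lambda>x. T \<omega> x) \<in> borel_measurable surface_measure"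
      using measurable_compose[OF measurable_Pair1'[OF w] measurable_field_pair] by simp
    have "ennreal (cmod (surface_functional g \<omega>)) \<le> (\<integral>\<^sup>+x. ennreal (cmod (of_real (T \<omega> x) * g x)) \<partial>surface_measure)"
    \<comment> \<open>A path that is not integrable against g has integral 0 by convention, so the
      bound holds for every \<omega>, not just almost surely.\<close>
    proof (cases "integrable surface_measure (\<lambda>x. complex_of_real (T \<omega> x) * g x)")
      case True
      then show ?thesis unfolding surface_functional_def by (rule integral_norm_bound_ennreal)
    next
      case False
      then show ?thesis unfolding surface_functional_def by (simp add: not_integrable_integral_eq)
    qed
    also have "\<dots> \<le> (\<integral>\<^sup>+x. ennreal \<bar>T \<omega> x\<bar> * ennreal B \<partial>surface_measure)"
    proof (rule nn_integral_mono)
      fix x :: "real ^ 3" assume "x \<in> space surface_measure"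
      then have "cmod (g x) \<le> B" using B by simp
      then have "cmod (of_real (T \<omega> x) * g x) \<le> \<bar>T \<omega> x\<bar> * B" by (simp add: norm_mult mult_left_mono)
      moreover have "0 \<le> B" using \<open>cmod (g x) \<le> B\<close> norm_ge_zero order_trans by blast
      ultimately show "ennreal (cmod (of_real (T \<omega> x) * g x)) \<le> ennreal \<bar>T \<omega> x\<bar> * ennreal B"
        by (metis abs_ge_zero ennreal_leI ennreal_mult)
    qed
    finally have "(ennreal (cmod (surface_functional g \<omega>)))\<^sup>2 \<le> (\<integral>\<^sup>+x. ennreal \<bar>T \<omega> x\<bar> * ennreal B \<partial>surface_measure)\<^sup>2"
      by (simp add: power_mono)
    also have "\<dots> \<le> (\<integral>\<^sup>+x. (ennreal \<bar>T \<omega> x\<bar>)\<^sup>2 \<partial>surface_measure) * ?V"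
      by (rule Cauchy_Schwarz_nn_integral) measurable
    finally show ?thesis by (simp add: ennreal_power)
  qed
  have "(\<integral>\<^sup>+\<omega>. ennreal ((cmod (surface_functional g \<omega>))\<^sup>2) \<partial>M)
     \<le> (\<integral>\<^sup>+\<omega>. (\<integral>\<^sup>+x. ennreal ((T \<omega> x)\<^sup>2) \<partial>surface_measure) * ?V \<partial>M)"
    by (rule nn_integral_mono) (rule bound)
  also have "\<dots> = (\<integral>\<^sup>+\<omega>. (\<integral>\<^sup>+x. ennreal ((T \<omega> x)\<^sup>2) \<partial>surface_measure) \<partial>M) * ?V"
    by (rule nn_integral_multc) measurable
  also have "(\<integral>\<^sup>+\<omega>. (\<integral>\<^sup>+x. ennreal ((T \<omega> x)\<^sup>2) \<partial>surface_measure) \<partial>M)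
      = (\<integral>\<^sup>+(\<omega>, x). ennreal ((T \<omega> x)\<^sup>2) \<partial>(M \<Otimes>\<^sub>M surface_measure))"
    using surface.nn_integral_fst[OF measurable_field_sq] by (simp only: case_prod_unfold fst_conv snd_conv)
  also have "\<dots> * ?V < \<infinity>" using nn_integral_field_sq \<open>?V < \<infinity>\<close> by (simp add: ennreal_mult_less_top)
  finally show ?thesis
    unfolding sq_integrable_def by (intro conjI m integrableI_bounded) auto
qed

text \<open>Fubini, with the integrand dominated by B (|Z|^2 + T^2). This is integrable over the
  product because the surface measure is finite and the field has a finite total second
  moment.\<close>

lemma integral_surface_functional:
  assumes Z: "sq_integrable M Z" and g: "continuous_on S2 g"
  shows "(\<integral>\<omega>. Z \<omega> * surface_functional g \<omega> \<partial>M)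
    = (\<integral>x. (\<integral>\<omega>. Z \<omega> * of_real (T \<omega> x) \<partial>M) * g x \<partial>surface_measure)"
proof -
  have [measurable]: "g \<in> borel_measurable surface_measure" "Z \<in> borel_measurable M"
    using borel_measurable_surface[OF g] Z by (simp_all add: sq_integrable_def)
  obtain B where B: "\<forall>x\<in>S2. cmod (g x) \<le> B" using bounded_on_S2[OF g] .
  let ?f = "\<lambda>\<omega> x. Z \<omega> * (of_real (T \<omega> x) * g x)"
  have "integrable (M \<Otimes>\<^sub>M surface_measure) (\<lambda>(\<omega>, x). ?f \<omega> x)"
  proof (rule Bochner_Integration.integrable_bound)
    have "integrable (M \<Otimes>\<^sub>M surface_measure) (\<lambda>(\<omega>, x). (cmod (Z \<omega>))\<^sup>2)"
    proof (rule Fubini_integrable)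
      show "integrable M (\<lambda>\<omega>. \<integral>y. norm (case (\<omega>, y) of (\<omega>, x) \<Rightarrow> (cmod (Z \<omega>))\<^sup>2) \<partial>surface_measure)"
        using Z by (simp add: sq_integrable_def)
    qed (simp_all add: case_prod_unfold)
    then show "integrable (M \<Otimes>\<^sub>M surface_measure)
        (\<lambda>(\<omega>, x). B * ((cmod (Z \<omega>))\<^sup>2 + (T \<omega> x)\<^sup>2))"
      using integrable_field_sq by (simp add: case_prod_unfold)
    show "AE z in M \<Otimes>\<^sub>M surface_measure. norm (case z of (\<omega>, x) \<Rightarrow> ?f \<omega> x)
        \<le> norm (case z of (\<omega>, x) \<Rightarrow> B * ((cmod (Z \<omega>))\<^sup>2 + (T \<omega> x)\<^sup>2))"
    proof (rule AE_I2)
      fix z assume "z \<in> space (M \<Otimes>\<^sub>M surface_measure)"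
      then obtain \<omega> x where z: "z = (\<omega>, x)" and x: "x \<in> S2" by (auto simp: space_pair_measure)
      have gB: "cmod (g x) \<le> B" "0 \<le> B" using B x norm_ge_zero order_trans by blast+
      have "u * v \<le> u\<^sup>2 + v\<^sup>2" if "0 \<le> u" "0 \<le> v" for u v :: real
        using sum_squares_bound[of u v] mult_nonneg_nonneg[OF that] by linarith
      from this[of "cmod (Z \<omega>)" "\<bar>T \<omega> x\<bar>"] have "cmod (Z \<omega>) * \<bar>T \<omega> x\<bar> \<le> (cmod (Z \<omega>))\<^sup>2 + (T \<omega> x)\<^sup>2" by simp
      from mult_mono[OF this gB(1)] have "cmod (?f \<omega> x) \<le> ((cmod (Z \<omega>))\<^sup>2 + (T \<omega> x)\<^sup>2) * B"
        by (simp add: norm_mult mult.assoc)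
      then show "norm (case z of (\<omega>, x) \<Rightarrow> ?f \<omega> x)
        \<le> norm (case z of (\<omega>, x) \<Rightarrow> B * ((cmod (Z \<omega>))\<^sup>2 + (T \<omega> x)\<^sup>2))"
        using gB(2) by (simp add: z mult.commute)
    qed
  qed measurable
  then have "(\<integral>\<omega>. (\<integral>x. ?f \<omega> x \<partial>surface_measure) \<partial>M) = (\<integral>x. (\<integral>\<omega>. ?f \<omega> x \<partial>M) \<partial>surface_measure)"
    by (rule Fubini_integral[symmetric])
  moreover have "(\<integral>x. ?f \<omega> x \<partial>surface_measure) = Z \<omega> * surface_functional g \<omega>" for \<omega>
    unfolding surface_functional_def by (rule integral_mult_right_zero)
  moreover have "(\<integral>\<omega>. ?f \<omega> x \<partial>M) = (\<integral>\<omega>. Z \<omega> * of_real (T \<omega> x) \<partial>M) * g x" for x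
    unfolding mult.assoc[symmetric] by (rule integral_mult_left_zero)
  ultimately show ?thesis by (simp only:)
qed

lemma harm_coeff_eq: "harm_coeff T l m = surface_functional (\<lambda>x. cnj (sph_harm_at l m x))"
  by (simp add: harm_coeff_def surface_functional_def fun_eq_iff)

lemma cnj_harm_coeff: "cnj (harm_coeff T l m \<omega>) = surface_functional (sph_harm_at l m) \<omega>"
  unfolding harm_coeff_def surface_functional_def by (subst Bochner_Integration.integral_cnj[symmetric]) simp

lemma sq_integrable_harm_coeff:
  "m \<in> {- int l..int l} \<Longrightarrow> sq_integrable M (harm_coeff T l m)"
  unfolding harm_coeff_eq
  by (intro sq_integrable_surface_functional continuous_on_cnj continuous_on_sph_harm_at)

lemma covariance_functional:
  assumes x: "x \<in> S2" and g: "continuous_on S2 g"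
  shows "(\<integral>\<omega>. of_real (T \<omega> x) * surface_functional g \<omega> \<partial>M)
    = (\<integral>y. of_real (C x y) * g y \<partial>surface_measure)"
  unfolding integral_surface_functional[OF sq_integrable_field[OF x] g]
  by (rule Bochner_Integration.integral_cong) (use x in \<open>auto simp: cov_eq simp flip: of_real_mult\<close>)

text \<open>Fubini is applied once for each coefficient. The spectrum thereby becomes a linear
  functional of the kernel C, to which approximation of C and Green's identity can be
  applied.\<close>

lemma spectrum_eq_integral:
  assumes m: "m \<in> {- int l..int l}" and m': "m' \<in> {- int l'..int l'}"
  shows "spectrum M T l l' m m' = (\<integral>y. (\<integral>x. of_real (C x y) * cnj (sph_harm_at l m x) \<partial>surface_measure)
     * sph_harm_at l' m' y \<partial>surface_measure)"
proof -
  have "spectrum M T l l' m m' = (\<integral>y. (\<integral>\<omega>. harm_coeff T l m \<omega> * of_real (T \<omega> y) \<partial>M) * sph_harm_at l' m' y \<partial>surface_measure)"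
    unfolding spectrum_def cnj_harm_coeff
    by (rule integral_surface_functional[OF sq_integrable_harm_coeff[OF m] continuous_on_sph_harm_at[OF m']])
  also have "\<dots> = (\<integral>y. (\<integral>x. of_real (C x y) * cnj (sph_harm_at l m x) \<partial>surface_measure)
     * sph_harm_at l' m' y \<partial>surface_measure)"
  proof (rule Bochner_Integration.integral_cong)
    fix y :: "real ^ 3" assume "y \<in> space surface_measure"
    then have "y \<in> S2" by simp
    then have "(\<integral>\<omega>. harm_coeff T l m \<omega> * of_real (T \<omega> y) \<partial>M) = (\<integral>x. of_real (C x y) * cnj (sph_harm_at l m x) \<partial>surface_measure)"
      using covariance_functional[of y "\<lambda>x. cnj (sph_harm_at l m x)"] m
      by (simp add: harm_coeff_eq mult.commute[of "surface_functional _ _"] cov_commute[of y]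
          continuous_on_cnj continuous_on_sph_harm_at)
    then show "(\<integral>\<omega>. harm_coeff T l m \<omega> * of_real (T \<omega> y) \<partial>M) * sph_harm_at l' m' y
       = (\<integral>x. of_real (C x y) * cnj (sph_harm_at l m x) \<partial>surface_measure) * sph_harm_at l' m' y" by simp
  qed simp
  finally show ?thesis .
qed

section \<open>Series for cross moments and for the covariance\<close>

lemma L2_limit_partial_expansion:
  assumes x: "x \<in> S2"
  shows "L2_limit M (\<lambda>L \<omega>. partial_expansion T L \<omega> x) (\<lambda>\<omega>. of_real (T \<omega> x))"
proof -
  have s: "sq_integrable M (\<lambda>\<omega>. partial_expansion T L \<omega> x)" for L
    unfolding partial_expansion_def mult.commute[of "harm_coeff _ _ _ _"]
    by (intro sq_integrable_sum sq_integrable_cmult sq_integrable_harm_coeff)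
  have "(\<integral>\<^sup>+\<omega>. ennreal ((cmod (of_real (T \<omega> x) - partial_expansion T L \<omega> x))\<^sup>2) \<partial>M)
    = ennreal (\<integral>\<omega>. (cmod (partial_expansion T L \<omega> x - of_real (T \<omega> x)))\<^sup>2 \<partial>M)" for L
    using sq_integrable_diff[OF s sq_integrable_field[OF x], of L]
    by (subst norm_minus_commute, subst nn_integral_eq_integral) (auto simp: sq_integrable_def)
  moreover have "(\<lambda>L. \<integral>\<^sup>+\<omega>. ennreal ((cmod (of_real (T \<omega> x) - partial_expansion T L \<omega> x))\<^sup>2) \<partial>M) \<longlonglongrightarrow> 0"
    using expansion x by (simp add: harmonic_expansion_def)
  ultimately have "(\<lambda>L. ennreal (\<integral>\<omega>. (cmod (partial_expansion T L \<omega> x - of_real (T \<omega> x)))\<^sup>2 \<partial>M)) \<longlonglongrightarrow> ennreal 0"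
    by simp
  then have "(\<lambda>L. \<integral>\<omega>. (cmod (partial_expansion T L \<omega> x - of_real (T \<omega> x)))\<^sup>2 \<partial>M) \<longlonglongrightarrow> 0"
    by (subst (asm) tendsto_ennreal_iff) (auto intro!: always_eventually Bochner_Integration.integral_nonneg)
  then show ?thesis using s sq_integrable_field[OF x] by (simp add: L2_limit_def)
qed

text \<open>By Fubini this is also the harmonic coefficient of C( . , y), which is how it enters
  zonal averages.\<close>

definition harm_cross :: "nat \<Rightarrow> int \<Rightarrow> real ^ 3 \<Rightarrow> complex" where
  "harm_cross l m y = (\<integral>\<omega>. harm_coeff T l m \<omega> * of_real (T \<omega> y) \<partial>M)"

lemma harm_cross_lim:
  assumes m: "m \<in> {- int l..int l}" and y: "y \<in> S2"
  shows "(\<lambda>L. \<Sum>l'\<le>L. \<Sum>m'=- int l'..int l'. spectrum M T l l' m m' * cnj (sph_harm_at l' m' y)) \<longlonglongrightarrow> harm_cross l m y"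
proof -
  have "(\<lambda>L. \<integral>\<omega>. harm_coeff T l m \<omega> * cnj (partial_expansion T L \<omega> y) \<partial>M)
     \<longlonglongrightarrow> (\<integral>\<omega>. harm_coeff T l m \<omega> * cnj (of_real (T \<omega> y)) \<partial>M)"
    by (intro L2_limit_integral_mult L2_limit_const L2_limit_cnj L2_limit_partial_expansion y
        sq_integrable_harm_coeff m)
  moreover have "(\<integral>\<omega>. harm_coeff T l m \<omega> * cnj (partial_expansion T L \<omega> y) \<partial>M)
     = (\<Sum>l'\<le>L. \<Sum>m'=- int l'..int l'. spectrum M T l l' m m' * cnj (sph_harm_at l' m' y))" for L
  proof -
    have i: "integrable M (\<lambda>\<omega>. harm_coeff T l m \<omega> * cnj (harm_coeff T l' m' \<omega>))" if "m' \<in> {- int l'..int l'}" for l' m'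
      using m that by (intro integrable_sq_mult sq_integrable_cnj sq_integrable_harm_coeff)
    have "harm_coeff T l m \<omega> * cnj (partial_expansion T L \<omega> y) = (\<Sum>l'\<le>L. \<Sum>m'=- int l'..int l'.
       (harm_coeff T l m \<omega> * cnj (harm_coeff T l' m' \<omega>)) * cnj (sph_harm_at l' m' y))" for \<omega>
      by (simp add: partial_expansion_def sum_distrib_left mult_ac)
    then show ?thesis
      unfolding spectrum_def using i
      by (simp add: Bochner_Integration.integral_sum Bochner_Integration.integrable_sum del: atLeastAtMost_iff)
  qed
  ultimately show ?thesis by (simp add: harm_cross_def)
qed

text \<open>For a degree-diagonal spectrum the series of \<open>harm_cross_lim\<close> has one
  nonzero degree, so its partial sums are constant from l on and the limit is a finite sum of
  harmonics of degree l in y.\<close>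

lemma harm_cross_degree_diagonal:
  assumes D: "degree_diagonal_spectrum M T Ct" and m: "m \<in> {- int l..int l}" and y: "y \<in> S2"
  shows "harm_cross l m y = (\<Sum>m'=- int l..int l. Ct l m m' * cnj (sph_harm_at l m' y))"
proof (rule LIMSEQ_unique[OF harm_cross_lim[OF m y]])
  let ?s = "\<lambda>l'. \<Sum>m'=- int l'..int l'. spectrum M T l l' m m' * cnj (sph_harm_at l' m' y)"
  have 0: "?s l' = 0" if "l' \<noteq> l" for l'
    using D m that by (intro sum.neutral ballI) (simp add: degree_diagonal_spectrum_def)
  have "?s l = (\<Sum>m'=- int l..int l. Ct l m m' * cnj (sph_harm_at l m' y))"
    using D m by (intro sum.cong refl) (simp add: degree_diagonal_spectrum_def)
  moreover have "(\<Sum>l'\<le>L. ?s l') = ?s l" if "L \<ge> l" for L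
    using sum.mono_neutral_right[of "{..L}" "{l}" ?s] that 0 by auto
  ultimately show "(\<lambda>L. \<Sum>l'\<le>L. ?s l') \<longlonglongrightarrow> (\<Sum>m'=- int l..int l. Ct l m m' * cnj (sph_harm_at l m' y))"
    by (intro tendsto_eventually) (auto simp: eventually_sequentially)
qed

text \<open>Only the first factor T(x) is expanded; the second one is paired as it stands and then
  evaluated by \<open>harm_cross_degree_diagonal\<close>. Hence a single limit over the degree
  occurs instead of a double one.\<close>

lemma cov_sums:
  assumes D: "degree_diagonal_spectrum M T Ct" and x: "x \<in> S2" and y: "y \<in> S2"
  shows "(\<lambda>l. \<Sum>m=- int l..int l. \<Sum>m'=- int l..int l. Ct l m m' * (sph_harm_at l m x * cnj (sph_harm_at l m' y)))
     sums of_real (C x y)"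
  unfolding sums_def_le
proof -
  have "(\<lambda>L. \<integral>\<omega>. partial_expansion T L \<omega> x * of_real (T \<omega> y) \<partial>M)
     \<longlonglongrightarrow> (\<integral>\<omega>. of_real (T \<omega> x) * of_real (T \<omega> y) \<partial>M)"
    by (intro L2_limit_integral_mult L2_limit_const L2_limit_partial_expansion x y sq_integrable_field)
  moreover have "(\<integral>\<omega>. partial_expansion T L \<omega> x * of_real (T \<omega> y) \<partial>M)
    = (\<Sum>l\<le>L. \<Sum>m=- int l..int l. harm_cross l m y * sph_harm_at l m x)" for L
  proof -
    have i: "integrable M (\<lambda>\<omega>. harm_coeff T l m \<omega> * of_real (T \<omega> y))" if "m \<in> {- int l..int l}" for l m
      using that y by (intro integrable_sq_mult sq_integrable_harm_coeff sq_integrable_field)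
    have "partial_expansion T L \<omega> x * of_real (T \<omega> y) = (\<Sum>l\<le>L. \<Sum>m=- int l..int l.
       (harm_coeff T l m \<omega> * of_real (T \<omega> y)) * sph_harm_at l m x)" for \<omega>
      by (simp add: partial_expansion_def sum_distrib_right sum_distrib_left mult_ac)
    then show ?thesis
      unfolding harm_cross_def using i
      by (simp add: Bochner_Integration.integral_sum Bochner_Integration.integrable_sum del: atLeastAtMost_iff)
  qed
  moreover have "(\<Sum>m=- int l..int l. harm_cross l m y * sph_harm_at l m x)
    = (\<Sum>m=- int l..int l. \<Sum>m'=- int l..int l. Ct l m m' * (sph_harm_at l m x * cnj (sph_harm_at l m' y)))" for l
    by (intro sum.cong refl) (simp add: harm_cross_degree_diagonal[OF D _ y] sum_distrib_left sum_distrib_right mult_ac)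
  moreover have "(\<integral>\<omega>. of_real (T \<omega> x) * of_real (T \<omega> y) \<partial>M) = complex_of_real (C x y)"
    by (simp add: cov_eq[OF x y] flip: of_real_mult)
  ultimately show "(\<lambda>n. \<Sum>l\<le>n. \<Sum>m=- int l..int l. \<Sum>m'=- int l..int l. Ct l m m' * (sph_harm_at l m x * cnj (sph_harm_at l m' y)))
     \<longlonglongrightarrow> complex_of_real (C x y)" by simp
qed

lemma spectrum_cnj: "spectrum M T l' l m' m = cnj (spectrum M T l l' m m')"
  by (simp add: spectrum_def mult.commute flip: Bochner_Integration.integral_cnj)

end

section \<open>Zonal kernels\<close>

lemma surface_integral_bound:
  fixes g :: "real ^ 3 \<Rightarrow> complex"
  assumes "continuous_on S2 g" "\<And>x. x \<in> S2 \<Longrightarrow> cmod (g x) \<le> B"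
  shows "cmod (\<integral>x. g x \<partial>surface_measure) \<le> B * measure surface_measure S2"
proof -
  have "cmod (\<integral>x. g x \<partial>surface_measure) \<le> (\<integral>x. cmod (g x) \<partial>surface_measure)"
    by (rule integral_norm_bound)
  also have "\<dots> \<le> (\<integral>x. B \<partial>surface_measure)"
    using assms by (intro integral_mono integrable_surface continuous_on_norm) auto
  also have "\<dots> = B * measure surface_measure S2" by simp
  finally show ?thesis .
qed

lemma inner_S2_bound: "x \<in> S2 \<Longrightarrow> y \<in> S2 \<Longrightarrow> x \<bullet> y \<in> {-1..1}"
  using Cauchy_Schwarz_ineq2[of x y] by auto

lemma continuous_on_poly_inner:
  "continuous_on A (\<lambda>x. complex_of_real (poly p (v \<bullet> x)))"
  "continuous_on A (\<lambda>x. complex_of_real (poly p (x \<bullet> v)))"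
  by (intro continuous_intros)+

text \<open>The quantifiers carry the point: \<mu> and N are chosen from p before g and x, so the
  same scalars serve for every function and every centre.\<close>

lemma zonal_integral:
  fixes p :: "real poly"
  shows "\<exists>\<mu> N. \<forall>g. continuous_on S2 g \<longrightarrow> (\<forall>x\<in>S2.
       (\<integral>z. complex_of_real (poly p (x \<bullet> z)) * g z \<partial>surface_measure)
       = (\<Sum>l\<le>N. of_real (\<mu> l) * (\<Sum>m=- int l..int l. sph_harm_at l m x *
           (\<integral>z. g z * cnj (sph_harm_at l m z) \<partial>surface_measure))))"
proof -
  obtain \<mu> N where "\<forall>x\<in>S2. \<forall>y\<in>S2. complex_of_real (poly p (x \<bullet> y))
       = (\<Sum>l\<le>N. of_real (\<mu> l) * (\<Sum>m=- int l..int l. sph_harm_at l m x * cnj (sph_harm_at l m y)))"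
    using zonal_expansion[of p] by blast
  note \<mu> = this[rule_format]
  have "(\<integral>z. complex_of_real (poly p (x \<bullet> z)) * g z \<partial>surface_measure)
       = (\<Sum>l\<le>N. of_real (\<mu> l) * (\<Sum>m=- int l..int l. sph_harm_at l m x *
           (\<integral>z. g z * cnj (sph_harm_at l m z) \<partial>surface_measure)))"
    if g: "continuous_on S2 g" and x: "x \<in> S2" for g x
  proof -
    have "(\<integral>z. complex_of_real (poly p (x \<bullet> z)) * g z \<partial>surface_measure)
      = (\<integral>z. (\<Sum>l\<le>N. \<Sum>m=- int l..int l. (of_real (\<mu> l) * sph_harm_at l m x) * (g z * cnj (sph_harm_at l m z))) \<partial>surface_measure)"
    proof (rule Bochner_Integration.integral_cong)
      fix z :: "real ^ 3" assume "z \<in> space surface_measure"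
      then have "z \<in> S2" by simp
      then show "complex_of_real (poly p (x \<bullet> z)) * g z
        = (\<Sum>l\<le>N. \<Sum>m=- int l..int l. (of_real (\<mu> l) * sph_harm_at l m x) * (g z * cnj (sph_harm_at l m z)))"
        by (simp only: \<mu>[OF x]) (simp add: sum_distrib_left sum_distrib_right mult_ac)
    qed simp
    also have "\<dots> = (\<Sum>l\<le>N. \<Sum>m=- int l..int l. (of_real (\<mu> l) * sph_harm_at l m x) *
           (\<integral>z. g z * cnj (sph_harm_at l m z) \<partial>surface_measure))"
    proof -
      have i: "integrable surface_measure (\<lambda>z. g z * cnj (sph_harm_at l m z))" if "m \<in> {- int l..int l}" for l m
        using that by (intro integrable_surface continuous_on_mult g continuous_on_cnj continuous_on_sph_harm_at)
      then show ?thesis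
        by (simp add: Bochner_Integration.integral_sum Bochner_Integration.integrable_sum del: atLeastAtMost_iff)
    qed
    also have "\<dots> = (\<Sum>l\<le>N. of_real (\<mu> l) * (\<Sum>m=- int l..int l. sph_harm_at l m x *
           (\<integral>z. g z * cnj (sph_harm_at l m z) \<partial>surface_measure)))"
      by (simp add: sum_distrib_left mult_ac)
    finally show ?thesis .
  qed
  then show ?thesis by (intro exI[of _ \<mu>] exI[of _ N] allI impI ballI)
qed

text \<open>The Funk-Hecke formula for polynomial kernels: in \<open>zonal_integral\<close>
  orthogonality leaves the single term of the same degree and order. The eigenvalue is 0 above the
  degree N at which the kernel expansion stops.\<close>

lemma funk_hecke:
  fixes p :: "real poly"
  shows "\<exists>\<kappa>. \<forall>l. \<forall>m\<in>{- int l..int l}. \<forall>x\<in>S2.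
    (\<integral>z. complex_of_real (poly p (x \<bullet> z)) * sph_harm_at l m z \<partial>surface_measure) = of_real (\<kappa> l) * sph_harm_at l m x"
proof -
  obtain \<mu> N where "\<forall>g. continuous_on S2 g \<longrightarrow> (\<forall>x\<in>S2.
       (\<integral>z. complex_of_real (poly p (x \<bullet> z)) * g z \<partial>surface_measure)
       = (\<Sum>l\<le>N. of_real (\<mu> l) * (\<Sum>m=- int l..int l. sph_harm_at l m x *
           (\<integral>z. g z * cnj (sph_harm_at l m z) \<partial>surface_measure))))"
    using zonal_integral[of p] by blast
  note \<mu> = this[rule_format]
  define \<kappa> where "\<kappa> l = (if l \<le> N then \<mu> l * harm_sq_norm l else 0)" for l
  have "(\<integral>z. complex_of_real (poly p (x \<bullet> z)) * sph_harm_at l m z \<partial>surface_measure) = of_real (\<kappa> l) * sph_harm_at l m x"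
    if m: "m \<in> {- int l..int l}" and x: "x \<in> S2" for l m x
  proof -
    have "(\<integral>z. complex_of_real (poly p (x \<bullet> z)) * sph_harm_at l m z \<partial>surface_measure)
      = (\<Sum>l'\<le>N. of_real (\<mu> l') * (\<Sum>m'=- int l'..int l'. sph_harm_at l' m' x * (if l = l' \<and> m = m' then of_real (harm_sq_norm l) else 0)))"
      unfolding \<mu>[OF continuous_on_sph_harm_at[OF m] x]
      by (intro sum.cong arg_cong2[where f = "(*)"] refl) (rule sph_harm_orthogonal[OF m])
    also have "\<dots> = (\<Sum>l'\<le>N. if l' = l then of_real (\<mu> l * harm_sq_norm l) * sph_harm_at l m x else 0)"
    proof (rule sum.cong[OF refl])
      fix l' assume "l' \<in> {..N}"
      show "of_real (\<mu> l') * (\<Sum>m'=- int l'..int l'. sph_harm_at l' m' x * (if l = l' \<and> m = m' then of_real (harm_sq_norm l) else 0))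
         = (if l' = l then of_real (\<mu> l * harm_sq_norm l) * sph_harm_at l m x else 0)"
      proof (cases "l' = l")
        case True
        have "(\<Sum>m'=- int l..int l. sph_harm_at l m' x * (if m = m' then of_real (harm_sq_norm l) else 0))
          = (\<Sum>m'=- int l..int l. if m' = m then sph_harm_at l m x * of_real (harm_sq_norm l) else 0)"
          by (intro sum.cong) auto
        also have "\<dots> = sph_harm_at l m x * of_real (harm_sq_norm l)"
          using m by simp
        finally show ?thesis using True by simp
      qed simp
    qed
    also have "\<dots> = of_real (\<kappa> l) * sph_harm_at l m x" by (simp add: \<kappa>_def)
    finally show ?thesis .
  qed
  then show ?thesis by blast
qed

text \<open>The expression of \<open>spectrum_eq_integral\<close> for an arbitrary kernel, so that C
  can be replaced by polynomial approximations.\<close>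

definition kernel_form :: "(real ^ 3 \<Rightarrow> real ^ 3 \<Rightarrow> real) \<Rightarrow> nat \<Rightarrow> nat \<Rightarrow> int \<Rightarrow> int \<Rightarrow> complex" where
  "kernel_form K l l' m m' = (\<integral>y. (\<integral>x. of_real (K x y) * cnj (sph_harm_at l m x) \<partial>surface_measure)
     * sph_harm_at l' m' y \<partial>surface_measure)"

lemma continuous_on_surface_integral:
  fixes f :: "real ^ 3 \<Rightarrow> real ^ 3 \<Rightarrow> complex"
  assumes f: "continuous_on (S2 \<times> S2) (\<lambda>(x, y). f x y)"
  shows "continuous_on S2 (\<lambda>y. \<integral>x. f x y \<partial>surface_measure)"
proof -
  have "continuous_on (S2 \<times> cbox (0, 0) (pi, 2*pi)) (\<lambda>z. f (sph_point (fst (snd z)) (snd (snd z))) (fst z))"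
  proof -
    have "continuous_on (S2 \<times> cbox (0, 0) (pi, 2*pi)) (\<lambda>z. (\<lambda>(x, y). f x y) (sph_point (fst (snd z)) (snd (snd z)), fst z))"
    proof (rule continuous_on_compose2[OF f])
      show "continuous_on (S2 \<times> cbox (0, 0) (pi, 2*pi)) (\<lambda>z. (sph_point (fst (snd z)) (snd (snd z)), fst z))"
        unfolding sph_point_eq_axis by (intro continuous_intros)
    qed auto
    then show ?thesis by simp
  qed
  then have "continuous_on S2 (\<lambda>y. integral (cbox (0, 0) (pi, 2*pi)) (\<lambda>t. sin (fst t) *\<^sub>R f (sph_point (fst t) (snd t)) y))"
    by (intro integral_continuous_on_param) (auto simp: case_prod_unfold intro!: continuous_intros)
  moreover have "(\<integral>x. f x y \<partial>surface_measure)
      = integral (cbox (0, 0) (pi, 2*pi)) (\<lambda>t. sin (fst t) *\<^sub>R f (sph_point (fst t) (snd t)) y)" if "y \<in> S2" for y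
  proof -
    have "continuous_on S2 (\<lambda>x. (\<lambda>(x, y). f x y) (x, y))"
      by (rule continuous_on_compose2[OF f]) (use that in \<open>auto intro!: continuous_intros\<close>)
    then show ?thesis by (subst integral_surface) (simp_all add: case_prod_unfold)
  qed
  ultimately show ?thesis by (subst continuous_on_cong[OF refl]) auto
qed

section \<open>Isotropy and spectra that are scalar on each degree\<close>

lemma isotropic_cov_profile:
  assumes "expanded_field M T" and iso: "isotropic M T"
  shows "\<exists>G. continuous_on {-1..1} G \<and> (\<forall>x\<in>S2. \<forall>y\<in>S2. cov_fun M T x y = G (x \<bullet> y))"
proof -
  interpret expanded_field M T by fact
  obtain g where g: "\<And>x y. x \<in> S2 \<Longrightarrow> y \<in> S2 \<Longrightarrow> C x y = g (arccos (x \<bullet> y))"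
    using iso unfolding isotropic_def great_circle_dist_def by blast
  let ?q = "\<lambda>u. sph_point (arccos u) 0"
  \<comment> \<open>Along a meridian the inner product with the north pole takes every value in
    [-1, 1] once, so the profile inherits continuity from C.\<close>
  have "sph_point 0 0 \<bullet> ?q u = u" if "u \<in> {-1..1}" for u
    using that by (simp add: inner_vec_def sum_3)
  then have eq: "g (arccos u) = C (sph_point 0 0) (?q u)" if "u \<in> {-1..1}" for u
    using g[OF sph_point_in_S2 sph_point_in_S2, of 0 0 "arccos u" 0] that by simp
  have q: "continuous_on {-1..1} ?q"
    unfolding sph_point_eq_axis by (intro continuous_intros) auto
  have "continuous_on {-1..1} (\<lambda>u. C (sph_point 0 0) (?q u))"
    by (rule continuous_on_compose2[OF continuous_on_cov_right[OF sph_point_in_S2] q]) auto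
  then have "continuous_on {-1..1} (\<lambda>u. g (arccos u))"
    by (subst continuous_on_cong[OF refl eq]) auto
  then show ?thesis using g by (intro exI[of _ "\<lambda>u. g (arccos u)"]) blast
qed

lemma poly_approximation:
  fixes G :: "real \<Rightarrow> real"
  assumes "continuous_on {-1..1} G" "0 < e"
  shows "\<exists>p. \<forall>u\<in>{-1..1}. \<bar>G u - poly p u\<bar> < e"
proof -
  obtain h where h: "real_polynomial_function h" "\<And>u. u \<in> {-1..1} \<Longrightarrow> \<bar>G u - h u\<bar> < e"
    using Stone_Weierstrass_real_polynomial_function[OF _ assms] by (metis compact_Icc)
  obtain a n where "h = (\<lambda>x. \<Sum>i\<le>n. a i * x ^ i)"
    using h(1) real_polynomial_function_iff_sum by blast
  then have "h u = poly (\<Sum>i\<le>n. monom (a i) i) u" for u by (simp add: poly_sum poly_monom)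
  with h(2) show ?thesis by (intro exI[of _ "\<Sum>i\<le>n. monom (a i) i"] ballI) metis
qed

text \<open>The profile is approximated uniformly by polynomials. For a polynomial kernel
  \<open>funk_hecke\<close> and orthogonality give a form that is diagonal with entries depending
  only on the degree, and these forms converge to the spectrum.\<close>

lemma isotropic_spectrum:
  assumes "expanded_field M T" and iso: "isotropic M T"
  shows "\<exists>c. \<forall>l l'. \<forall>m\<in>{- int l..int l}. \<forall>m'\<in>{- int l'..int l'}.
     spectrum M T l l' m m' = (if l = l' \<and> m = m' then c l else 0)"
proof -
  interpret expanded_field M T by fact
  obtain G where G: "continuous_on {-1..1} G" "\<And>x y. x \<in> S2 \<Longrightarrow> y \<in> S2 \<Longrightarrow> C x y = G (x \<bullet> y)"
    using isotropic_cov_profile[OF assms] by blast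
  have "\<forall>n. \<exists>p. \<forall>u\<in>{-1..1}. \<bar>G u - poly p u\<bar> < 1 / real (Suc n)"
    by (intro allI poly_approximation[OF G(1)]) simp
  then obtain p where "\<forall>n. \<forall>u\<in>{-1..1}. \<bar>G u - poly (p n) u\<bar> < 1 / real (Suc n)"
    by (rule choice[THEN exE])
  note p = this[rule_format]
  have "\<exists>\<kappa>. \<forall>n l. \<forall>m\<in>{- int l..int l}. \<forall>x\<in>S2.
    (\<integral>z. complex_of_real (poly (p n) (x \<bullet> z)) * sph_harm_at l m z \<partial>surface_measure) = complex_of_real (\<kappa> n l) * sph_harm_at l m x"
    by (intro choice allI funk_hecke)
  then obtain \<kappa> where "\<forall>n l. \<forall>m\<in>{- int l..int l}. \<forall>x\<in>S2.
    (\<integral>z. complex_of_real (poly (p n) (x \<bullet> z)) * sph_harm_at l m z \<partial>surface_measure) = complex_of_real (\<kappa> n l) * sph_harm_at l m x"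
    by (rule exE)
  note \<kappa> = this[rule_format]
  have lim: "(\<lambda>n. if l = l' \<and> m = m' then complex_of_real (\<kappa> n l * harm_sq_norm l) else 0) \<longlonglongrightarrow> spectrum M T l l' m m'"
    if m: "m \<in> {- int l..int l}" and m': "m' \<in> {- int l'..int l'}" for l l' m m'
  proof -
    let ?K = "\<lambda>n x y. poly (p n) (x \<bullet> y)"
    let ?Y = "sph_harm_at l m" and ?Y' = "sph_harm_at l' m'"
    note cY = continuous_on_sph_harm_at[OF m] and cY' = continuous_on_sph_harm_at[OF m']
    have inner: "(\<integral>x. complex_of_real (?K n x y) * cnj (?Y x) \<partial>surface_measure) = complex_of_real (\<kappa> n l) * cnj (?Y y)" if "y \<in> S2" for n y
    proof -
      have "(\<integral>x. complex_of_real (?K n x y) * cnj (?Y x) \<partial>surface_measure) = (\<integral>x. cnj (complex_of_real (?K n y x) * ?Y x) \<partial>surface_measure)"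
        by (simp add: inner_commute)
      also have "\<dots> = cnj (of_real (\<kappa> n l) * ?Y y)"
        unfolding Bochner_Integration.integral_cnj using \<kappa>[OF m that] by simp
      finally show ?thesis by simp
    qed
    have form: "kernel_form (?K n) l l' m m' = (if l = l' \<and> m = m' then complex_of_real (\<kappa> n l * harm_sq_norm l) else 0)" for n
    proof -
      have "kernel_form (?K n) l l' m m' = (\<integral>y. complex_of_real (\<kappa> n l) * (?Y' y * cnj (?Y y)) \<partial>surface_measure)"
        unfolding kernel_form_def
        by (rule Bochner_Integration.integral_cong) (use inner in \<open>auto simp: mult_ac\<close>)
      also have "\<dots> = complex_of_real (\<kappa> n l) * (\<integral>y. ?Y' y * cnj (?Y y) \<partial>surface_measure)" by simp
      finally show ?thesis unfolding sph_harm_orthogonal[OF m' m] by simp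
    qed
    obtain B where B: "\<forall>x\<in>S2. cmod (?Y x) \<le> B" using bounded_on_S2[OF cY] .
    obtain B' where B': "\<forall>x\<in>S2. cmod (?Y' x) \<le> B'" using bounded_on_S2[OF cY'] .
    define S where "S = measure surface_measure S2"
    have "B \<ge> 0" using B sph_point_in_S2[of 0 0] norm_ge_zero order_trans by blast
    \<comment> \<open>Each of the two surface integrals contributes the area S, each harmonic its
      supremum, and the kernel its uniform error.\<close>
    have bound: "cmod (spectrum M T l l' m m' - kernel_form (?K n) l l' m m') \<le> (B * S * B' * S) * (1 / real (Suc n))" for n
    proof -
      have cC: "continuous_on S2 (\<lambda>y. \<integral>x. of_real (C x y) * cnj (?Y x) \<partial>surface_measure)"
      proof (rule continuous_on_surface_integral)
        have "continuous_on (S2 \<times> S2) (\<lambda>z. complex_of_real (case z of (x, y) \<Rightarrow> C x y) * cnj (?Y (fst z)))"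
          by (intro continuous_intros continuous_on_cov continuous_on_compose2[OF cY]) auto
        then show "continuous_on (S2 \<times> S2) (\<lambda>(x, y). complex_of_real (C x y) * cnj (?Y x))"
          by (simp add: case_prod_unfold)
      qed
      have cK: "continuous_on S2 (\<lambda>y. \<integral>x. complex_of_real (?K n x y) * cnj (?Y x) \<partial>surface_measure)"
        by (subst continuous_on_cong[OF refl inner]) (auto intro!: continuous_intros cY)
      let ?d = "\<lambda>y. (\<integral>x. complex_of_real (C x y) * cnj (?Y x) \<partial>surface_measure) - (\<integral>x. complex_of_real (?K n x y) * cnj (?Y x) \<partial>surface_measure)"
      have d: "cmod (?d y) \<le> 1 / real (Suc n) * B * S" if y: "y \<in> S2" for y
      proof -
        have c1: "continuous_on S2 (\<lambda>x. complex_of_real (C x y) * cnj (?Y x))"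
          by (intro continuous_intros continuous_on_cov_left[OF y] cY)
        have c2: "continuous_on S2 (\<lambda>x. complex_of_real (?K n x y) * cnj (?Y x))"
          by (intro continuous_intros cY)
        have eq: "?d y = (\<integral>x. complex_of_real (C x y - ?K n x y) * cnj (?Y x) \<partial>surface_measure)"
          unfolding of_real_diff left_diff_distrib
          by (rule Bochner_Integration.integral_diff[OF integrable_surface[OF c1] integrable_surface[OF c2], symmetric])
        show ?thesis unfolding eq S_def
        proof (rule surface_integral_bound)
          show "continuous_on S2 (\<lambda>x. complex_of_real (C x y - ?K n x y) * cnj (?Y x))"
            by (intro continuous_intros continuous_on_cov_left[OF y] cY)
          fix x :: "real ^ 3" assume x: "x \<in> S2"
          have "\<bar>C x y - ?K n x y\<bar> \<le> 1 / real (Suc n)"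
            unfolding G(2)[OF x y] by (rule less_imp_le[OF p[OF inner_S2_bound[OF x y]]])
          moreover have "cmod (?Y x) \<le> B" using B x by blast
          ultimately show "cmod (complex_of_real (C x y - ?K n x y) * cnj (?Y x)) \<le> 1 / real (Suc n) * B"
            unfolding norm_mult norm_of_real complex_mod_cnj by (intro mult_mono) auto
        qed
      qed
      have eq: "spectrum M T l l' m m' - kernel_form (?K n) l l' m m' = (\<integral>y. ?d y * ?Y' y \<partial>surface_measure)"
        unfolding spectrum_eq_integral[OF m m'] kernel_form_def left_diff_distrib
        by (rule Bochner_Integration.integral_diff[symmetric])
          (intro integrable_surface continuous_on_mult cC cK cY')+
      have "cmod (spectrum M T l l' m m' - kernel_form (?K n) l l' m m') \<le> (1 / real (Suc n) * B * S * B') * S"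
        unfolding eq S_def
      proof (rule surface_integral_bound)
        show "continuous_on S2 (\<lambda>y. ?d y * ?Y' y)"
          by (intro continuous_on_mult continuous_on_diff cC cK cY')
        fix y :: "real ^ 3" assume y: "y \<in> S2"
        then have "cmod (?Y' y) \<le> B'" using B' by blast
        then show "cmod (?d y * ?Y' y) \<le> 1 / real (Suc n) * B * measure surface_measure S2 * B'"
          unfolding norm_mult using d[OF y] \<open>B \<ge> 0\<close> by (intro mult_mono) (auto simp: S_def)
      qed
      then show ?thesis by (simp only: mult_ac)
    qed
    have "(\<lambda>n. (B * S * B' * S) * (1 / real (Suc n))) \<longlonglongrightarrow> (B * S * B' * S) * 0"
      by (rule tendsto_mult[OF tendsto_const LIMSEQ_Suc[OF lim_1_over_n]])
    then have g: "(\<lambda>n. (B * S * B' * S) * (1 / real (Suc n))) \<longlonglongrightarrow> 0" by (simp only: mult_zero_right)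
    have "(\<lambda>n. spectrum M T l l' m m' - kernel_form (?K n) l l' m m') \<longlonglongrightarrow> 0"
      by (rule Lim_null_comparison[OF always_eventually[OF allI[OF bound]] g])
    from tendsto_diff[OF tendsto_const[of "spectrum M T l l' m m'"] this]
    have "(\<lambda>n. kernel_form (?K n) l l' m m') \<longlonglongrightarrow> spectrum M T l l' m m'"
      by (simp only: diff_diff_eq2 add_diff_cancel_left' diff_zero)
    then show ?thesis by (simp only: form)
  qed
  \<comment> \<open>All orders of a degree are limits of the same sequence; order 0 is present in
    every degree and serves to name that limit.\<close>
  have "spectrum M T l l' m m' = (if l = l' \<and> m = m' then spectrum M T l l 0 0 else 0)"
    if m: "m \<in> {- int l..int l}" and m': "m' \<in> {- int l'..int l'}" for l l' m m'
  proof (cases "l = l' \<and> m = m'")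
    case True
    have "(\<lambda>n. complex_of_real (\<kappa> n l * harm_sq_norm l)) \<longlonglongrightarrow> spectrum M T l l m m"
      using lim[OF m m] by simp
    moreover have "(\<lambda>n. complex_of_real (\<kappa> n l * harm_sq_norm l)) \<longlonglongrightarrow> spectrum M T l l 0 0"
      using lim[of 0 l 0 l] by simp
    ultimately have "spectrum M T l l m m = spectrum M T l l 0 0" by (rule LIMSEQ_unique)
    then show ?thesis using True by simp
  next
    case False
    then have "(\<lambda>n. 0) \<longlonglongrightarrow> spectrum M T l l' m m'" using lim[OF m m'] by (simp only: if_False)
    then have "spectrum M T l l' m m' = 0" by (simp add: LIMSEQ_const_iff)
    then show ?thesis by (simp only: False if_False)
  qed
  then show ?thesis by (intro exI[of _ "\<lambda>l. spectrum M T l l 0 0"] allI ballI)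
qed

text \<open>With equal coefficients in a degree the sum over orders is the reproducing kernel, which
  the addition theorem turns into a function of x . y. The real part in \<open>g\<close> only gives
  it the required type: the series sums to the real number C x y.\<close>

lemma scalar_spectrum_isotropic:
  assumes "expanded_field M T"
    and c: "\<And>l l' m m'. m \<in> {- int l..int l} \<Longrightarrow> m' \<in> {- int l'..int l'} \<Longrightarrow>
      spectrum M T l l' m m' = (if l = l' \<and> m = m' then c l else 0)"
  shows "isotropic M T"
proof -
  interpret expanded_field M T by fact
  have D: "degree_diagonal_spectrum M T (\<lambda>l m m'. if m = m' then c l else 0)"
    using c by (auto simp: degree_diagonal_spectrum_def)
  define g where "g d = Re (\<Sum>l. c l * of_real (zonal_coeff l * poly (legendre_poly l) (cos d)))" for d
  have "C x y = g (arccos (x \<bullet> y))" if x: "x \<in> S2" and y: "y \<in> S2" for x y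
  proof -
    have "(\<Sum>m=- int l..int l. \<Sum>m'=- int l..int l. (if m = m' then c l else 0) * (sph_harm_at l m x * cnj (sph_harm_at l m' y)))
       = c l * of_real (zonal_coeff l * poly (legendre_poly l) (x \<bullet> y))" for l
    proof -
      have "(\<Sum>m'=- int l..int l. (if m = m' then c l else 0) * (sph_harm_at l m x * cnj (sph_harm_at l m' y)))
        = c l * (sph_harm_at l m x * cnj (sph_harm_at l m y))" if "m \<in> {- int l..int l}" for m
      proof -
        have "(\<Sum>m'=- int l..int l. (if m = m' then c l else 0) * (sph_harm_at l m x * cnj (sph_harm_at l m' y)))
          = (\<Sum>m'=- int l..int l. if m' = m then c l * (sph_harm_at l m x * cnj (sph_harm_at l m y)) else 0)"
          by (intro sum.cong) auto
        then show ?thesis using that by simp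
      qed
      then show ?thesis unfolding addition_theorem[OF x y, symmetric] by (simp add: sum_distrib_left)
    qed
    with cov_sums[OF D x y] have "(\<lambda>l. c l * of_real (zonal_coeff l * poly (legendre_poly l) (x \<bullet> y))) sums of_real (C x y)"
      by simp
    moreover have "cos (arccos (x \<bullet> y)) = x \<bullet> y" using inner_S2_bound[OF x y] by simp
    ultimately show ?thesis by (simp add: g_def sums_unique[symmetric])
  qed
  then show ?thesis unfolding isotropic_def great_circle_dist_def by blast
qed

text \<open>Averaging in either argument multiplies the degree-l part of C by the same \<mu> l. The
  average in the second argument is brought to the form of the first by conjugation: it is real, the
  matrix \<open>Ct l\<close> is Hermitian as a covariance of coefficients, and the sums over m and
  m' may be exchanged.\<close>

lemma zonal_average_commute:
  fixes p :: "real poly"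
  assumes "expanded_field M T" and D: "degree_diagonal_spectrum M T Ct" and x: "x \<in> S2" and y: "y \<in> S2"
  shows "(\<integral>z. poly p (x \<bullet> z) * cov_fun M T z y \<partial>surface_measure) = (\<integral>z. poly p (y \<bullet> z) * cov_fun M T x z \<partial>surface_measure)"
proof -
  interpret expanded_field M T by fact
  obtain \<mu> N where "\<forall>g. continuous_on S2 g \<longrightarrow> (\<forall>x\<in>S2.
       (\<integral>z. complex_of_real (poly p (x \<bullet> z)) * g z \<partial>surface_measure)
       = (\<Sum>l\<le>N. of_real (\<mu> l) * (\<Sum>m=- int l..int l. sph_harm_at l m x *
           (\<integral>z. g z * cnj (sph_harm_at l m z) \<partial>surface_measure))))"
    using zonal_integral[of p] by blast
  note \<mu> = this[rule_format]
  have cross: "(\<integral>z. complex_of_real (C z w) * cnj (sph_harm_at l m z) \<partial>surface_measure) = harm_cross l m w"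
    if "m \<in> {- int l..int l}" "w \<in> S2" for l m w
    using covariance_functional[OF that(2), of "\<lambda>z. cnj (sph_harm_at l m z)"] that
    by (simp add: harm_cross_def harm_coeff_eq mult.commute[of "surface_functional _ _"] cov_commute[of w]
          continuous_on_cnj continuous_on_sph_harm_at)
  have *: "complex_of_real (\<integral>z. poly p (v \<bullet> z) * C z w \<partial>surface_measure) = (\<Sum>l\<le>N. of_real (\<mu> l) *
      (\<Sum>m=- int l..int l. \<Sum>m'=- int l..int l. Ct l m m' * (sph_harm_at l m v * cnj (sph_harm_at l m' w))))"
    if v: "v \<in> S2" and w: "w \<in> S2" for v w
  proof -
    have c: "continuous_on S2 (\<lambda>z. complex_of_real (C z w))"
      by (intro continuous_intros continuous_on_cov_left w)
    have "complex_of_real (\<integral>z. poly p (v \<bullet> z) * C z w \<partial>surface_measure)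
       = (\<integral>z. complex_of_real (poly p (v \<bullet> z)) * of_real (C z w) \<partial>surface_measure)"
      by (simp flip: of_real_mult)
    also have "\<dots> = (\<Sum>l\<le>N. of_real (\<mu> l) * (\<Sum>m=- int l..int l. sph_harm_at l m v * harm_cross l m w))"
      unfolding \<mu>[OF c v] by (intro sum.cong arg_cong2[where f = "(*)"] refl cross w)
    also have "\<dots> = (\<Sum>l\<le>N. of_real (\<mu> l) *
      (\<Sum>m=- int l..int l. \<Sum>m'=- int l..int l. Ct l m m' * (sph_harm_at l m v * cnj (sph_harm_at l m' w))))"
      by (intro sum.cong arg_cong2[where f = "(*)"] refl)
        (simp add: harm_cross_degree_diagonal[OF D _ w] sum_distrib_left mult_ac)
    finally show ?thesis .
  qed
  have herm: "cnj (Ct l m m') = Ct l m' m" if "m \<in> {- int l..int l}" "m' \<in> {- int l..int l}" for l m m'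
    using D that spectrum_cnj[of l l m' m] by (simp add: degree_diagonal_spectrum_def)
  have "complex_of_real (\<integral>z. poly p (y \<bullet> z) * C z x \<partial>surface_measure)
      = cnj (of_real (\<integral>z. poly p (y \<bullet> z) * C z x \<partial>surface_measure))" by simp
  also have "\<dots> = (\<Sum>l\<le>N. of_real (\<mu> l) *
      (\<Sum>m=- int l..int l. \<Sum>m'=- int l..int l. Ct l m' m * (sph_harm_at l m' x * cnj (sph_harm_at l m y))))"
  proof -
    have "(\<Sum>m=- int l..int l. \<Sum>m'=- int l..int l. cnj (Ct l m m') * (cnj (sph_harm_at l m y) * sph_harm_at l m' x))
      = (\<Sum>m=- int l..int l. \<Sum>m'=- int l..int l. Ct l m' m * (sph_harm_at l m' x * cnj (sph_harm_at l m y)))" for l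
      by (intro sum.cong refl) (simp add: herm mult.commute)
    then show ?thesis
      unfolding *[OF y x] cnj_sum complex_cnj_mult complex_cnj_cnj complex_cnj_complex_of_real by (simp only:)
  qed
  also have "\<dots> = complex_of_real (\<integral>z. poly p (x \<bullet> z) * C z y \<partial>surface_measure)"
    unfolding *[OF x y] by (intro sum.cong arg_cong2[where f = "(*)"] refl sum.swap)
  finally show ?thesis by (simp add: cov_commute[of x] of_real_eq_iff)
qed

section \<open>Moments of zonal kernels\<close>

definition zonal_mean :: "real poly \<Rightarrow> real ^ 3 \<Rightarrow> (real ^ 3 \<Rightarrow> real) \<Rightarrow> real" where
  "zonal_mean p v f = (\<integral>x. poly p (v \<bullet> x) * f x \<partial>surface_measure)"

lemma integrable_zonal:
  assumes "continuous_on S2 f"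
  shows "integrable surface_measure (\<lambda>x. poly p (v \<bullet> x) * f x)"
  by (intro integrable_surface continuous_intros assms)

lemma zonal_mean_add:
  "continuous_on S2 f \<Longrightarrow> continuous_on S2 g \<Longrightarrow> zonal_mean p v (\<lambda>x. f x + g x) = zonal_mean p v f + zonal_mean p v g"
  by (simp add: zonal_mean_def distrib_left integrable_zonal)

lemma zonal_mean_diff:
  "continuous_on S2 f \<Longrightarrow> continuous_on S2 g \<Longrightarrow> zonal_mean p v (\<lambda>x. f x - g x) = zonal_mean p v f - zonal_mean p v g"
  by (simp add: zonal_mean_def right_diff_distrib integrable_zonal)

lemma zonal_mean_cmult: "zonal_mean p v (\<lambda>x. c * f x) = c * zonal_mean p v f"
  by (simp add: zonal_mean_def mult.left_commute[of _ c])

lemma zonal_mean_multc: "zonal_mean p v (\<lambda>x. f x * c) = zonal_mean p v f * c"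
  by (simp add: zonal_mean_def mult.assoc[symmetric])

lemma zonal_mean_sum:
  "(\<And>i. i \<in> I \<Longrightarrow> continuous_on S2 (f i)) \<Longrightarrow> zonal_mean p v (\<lambda>x. \<Sum>i\<in>I. f i x) = (\<Sum>i\<in>I. zonal_mean p v (f i))"
  unfolding zonal_mean_def sum_distrib_left
  by (intro Bochner_Integration.integral_sum integrable_zonal)

lemma zonal_mean_cong:
  "(\<And>x. x \<in> S2 \<Longrightarrow> f x = g x) \<Longrightarrow> zonal_mean p v f = zonal_mean p v g"
  unfolding zonal_mean_def by (rule Bochner_Integration.integral_cong) auto

lemma zonal_mean_poly: "zonal_mean p v (\<lambda>x. poly q (v \<bullet> x) * f x) = zonal_mean (p * q) v f"
  by (simp add: zonal_mean_def mult.assoc)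

text \<open>The form in which rotation invariance is used: the zonal mean of a function of x . w
  depends on v and w only through v . w. Linear and quadratic q yield the first and second moments
  below.\<close>

lemma zonal_convolution:
  fixes p q :: "real poly"
  shows "\<exists>h. \<forall>v\<in>S2. \<forall>w\<in>S2. zonal_mean p v (\<lambda>x. poly q (x \<bullet> w)) = h (v \<bullet> w)"
proof -
  obtain \<mu> N where "\<forall>g. continuous_on S2 g \<longrightarrow> (\<forall>x\<in>S2.
       (\<integral>z. complex_of_real (poly p (x \<bullet> z)) * g z \<partial>surface_measure)
       = (\<Sum>l\<le>N. of_real (\<mu> l) * (\<Sum>m=- int l..int l. sph_harm_at l m x *
           (\<integral>z. g z * cnj (sph_harm_at l m z) \<partial>surface_measure))))"
    using zonal_integral[of p] by blast
  note \<mu> = this[rule_format]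
  obtain \<kappa> where "\<forall>l. \<forall>m\<in>{- int l..int l}. \<forall>x\<in>S2.
    (\<integral>z. complex_of_real (poly q (x \<bullet> z)) * sph_harm_at l m z \<partial>surface_measure) = of_real (\<kappa> l) * sph_harm_at l m x"
    using funk_hecke[of q] by blast
  note \<kappa> = this[rule_format]
  define h where "h t = (\<Sum>l\<le>N. \<mu> l * (\<kappa> l * (zonal_coeff l * poly (legendre_poly l) t)))" for t
  have "zonal_mean p v (\<lambda>x. poly q (x \<bullet> w)) = h (v \<bullet> w)" if v: "v \<in> S2" and w: "w \<in> S2" for v w
  proof -
    have inner: "(\<integral>z. complex_of_real (poly q (z \<bullet> w)) * cnj (sph_harm_at l m z) \<partial>surface_measure)
       = of_real (\<kappa> l) * cnj (sph_harm_at l m w)" if m: "m \<in> {- int l..int l}" for l m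
    proof -
      have "(\<integral>z. complex_of_real (poly q (z \<bullet> w)) * cnj (sph_harm_at l m z) \<partial>surface_measure)
        = (\<integral>z. cnj (complex_of_real (poly q (w \<bullet> z)) * sph_harm_at l m z) \<partial>surface_measure)"
        by (simp add: inner_commute)
      also have "\<dots> = cnj (of_real (\<kappa> l) * sph_harm_at l m w)"
        unfolding Bochner_Integration.integral_cnj \<kappa>[OF m w] ..
      finally show ?thesis by simp
    qed
    have "complex_of_real (zonal_mean p v (\<lambda>x. poly q (x \<bullet> w)))
       = (\<integral>z. complex_of_real (poly p (v \<bullet> z)) * complex_of_real (poly q (z \<bullet> w)) \<partial>surface_measure)"
      by (simp add: zonal_mean_def flip: of_real_mult)
    also have "\<dots> = (\<Sum>l\<le>N. of_real (\<mu> l) * (\<Sum>m=- int l..int l. sph_harm_at l m v * (of_real (\<kappa> l) * cnj (sph_harm_at l m w))))"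
      unfolding \<mu>[OF continuous_on_poly_inner(2) v]
      by (intro sum.cong arg_cong2[where f = "(*)"] refl inner)
    also have "\<dots> = (\<Sum>l\<le>N. of_real (\<mu> l) * (of_real (\<kappa> l) * (\<Sum>m=- int l..int l. sph_harm_at l m v * cnj (sph_harm_at l m w))))"
      by (simp add: sum_distrib_left mult_ac)
    also have "\<dots> = complex_of_real (h (v \<bullet> w))"
      unfolding addition_theorem[OF v w] h_def by simp
    finally show ?thesis by (simp only: of_real_eq_iff)
  qed
  then show ?thesis by blast
qed

lemma zonal_mean_const_indep: "v \<in> S2 \<Longrightarrow> w \<in> S2 \<Longrightarrow> zonal_mean p v (\<lambda>x. 1) = zonal_mean p w (\<lambda>x. 1)"
proof -
  assume v: "v \<in> S2" and w: "w \<in> S2"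
  obtain h where h: "\<forall>v\<in>S2. \<forall>w\<in>S2. zonal_mean p v (\<lambda>x. poly 1 (x \<bullet> w)) = h (v \<bullet> w)"
    using zonal_convolution[of p 1] by blast
  have "v \<bullet> v = 1" "w \<bullet> w = 1" using v w by (simp_all add: dot_square_norm)
  then show ?thesis using bspec[OF bspec[OF h v] v] bspec[OF bspec[OF h w] w] by simp
qed

text \<open>Both w and -w have inner product 0 with v, so the convolution takes the same value at
  them, while the mean is odd in w.\<close>

lemma zonal_first_moment_unit:
  assumes v: "v \<in> S2" and w: "w \<in> S2" "v \<bullet> w = 0"
  shows "zonal_mean p v (\<lambda>x. x \<bullet> w) = 0"
proof -
  obtain h where h: "\<forall>v\<in>S2. \<forall>w\<in>S2. zonal_mean p v (\<lambda>x. poly [:0, 1:] (x \<bullet> w)) = h (v \<bullet> w)"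
    using zonal_convolution[of p "[:0, 1:]"] by blast
  have "- w \<in> S2" using w by simp
  from bspec[OF bspec[OF h v] this] bspec[OF bspec[OF h v] w(1)] w(2)
  have "zonal_mean p v (\<lambda>x. x \<bullet> w) = zonal_mean p v (\<lambda>x. - 1 * (x \<bullet> w))" by simp
  then show ?thesis unfolding zonal_mean_cmult by simp
qed

lemma zonal_first_moment_orth:
  assumes v: "v \<in> S2" and w: "v \<bullet> w = 0"
  shows "zonal_mean p v (\<lambda>x. x \<bullet> w) = 0"
proof (cases "w = 0")
  case True
  then show ?thesis by (simp add: zonal_mean_def)
next
  case False
  have "x \<bullet> w = norm w * (x \<bullet> sgn w)" for x
    using False by (simp add: sgn_div_norm)
  then have "zonal_mean p v (\<lambda>x. x \<bullet> w) = zonal_mean p v (\<lambda>x. norm w * (x \<bullet> sgn w))"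
    by (simp only:)
  also have "\<dots> = 0"
    unfolding zonal_mean_cmult using False w
    by (subst zonal_first_moment_unit[OF v]) (auto simp: norm_sgn sgn_div_norm)
  finally show ?thesis .
qed

text \<open>The squared length of the part of x orthogonal to v is 1 - (v . x)^2, shared equally by
  the two directions of the tangent plane; hence the division by 2.\<close>

definition zonal_second :: "real poly \<Rightarrow> real ^ 3 \<Rightarrow> real" where
  "zonal_second p v = zonal_mean p v (\<lambda>x. 1 - (v \<bullet> x)\<^sup>2) / 2"

lemma zonal_second_moment_orth:
  assumes v: "v \<in> S2"
  obtains B where "\<And>w. v \<bullet> w = 0 \<Longrightarrow> zonal_mean p v (\<lambda>x. (x \<bullet> w)\<^sup>2) = B * (norm w)\<^sup>2"
proof -
  obtain h where h: "\<forall>v\<in>S2. \<forall>w\<in>S2. zonal_mean p v (\<lambda>x. poly [:0, 0, 1:] (x \<bullet> w)) = h (v \<bullet> w)"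
    using zonal_convolution[of p "[:0, 0, 1:]"] by blast
  have "zonal_mean p v (\<lambda>x. (x \<bullet> w)\<^sup>2) = h 0 * (norm w)\<^sup>2" if w: "v \<bullet> w = 0" for w
  proof (cases "w = 0")
    case True
    then show ?thesis by (simp add: zonal_mean_def)
  next
    case False
    then have s: "sgn w \<in> S2" "v \<bullet> sgn w = 0" using w by (simp_all add: norm_sgn sgn_div_norm)
    have "x \<bullet> w = norm w * (x \<bullet> sgn w)" for x
      using False by (simp add: sgn_div_norm)
    then have "(x \<bullet> w)\<^sup>2 = (norm w)\<^sup>2 * (x \<bullet> sgn w)\<^sup>2" for x
      by (metis power_mult_distrib)
    then have "zonal_mean p v (\<lambda>x. (x \<bullet> w)\<^sup>2) = zonal_mean p v (\<lambda>x. (norm w)\<^sup>2 * (x \<bullet> sgn w)\<^sup>2)"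
      by (simp only:)
    also have "\<dots> = (norm w)\<^sup>2 * h 0"
      unfolding zonal_mean_cmult using bspec[OF bspec[OF h v] s(1)] s(2) by (simp add: power2_eq_square)
    finally show ?thesis by (simp add: mult.commute)
  qed
  then show ?thesis by (rule that)
qed

lemma zonal_second_moment_polar:
  assumes v: "v \<in> S2"
  obtains B where "\<And>u w. v \<bullet> u = 0 \<Longrightarrow> v \<bullet> w = 0 \<Longrightarrow> zonal_mean p v (\<lambda>x. (x \<bullet> u) * (x \<bullet> w)) = B * (u \<bullet> w)"
proof -
  obtain B where B: "\<And>w. v \<bullet> w = 0 \<Longrightarrow> zonal_mean p v (\<lambda>x. (x \<bullet> w)\<^sup>2) = B * (norm w)\<^sup>2"
    using zonal_second_moment_orth[OF v, of p] by blast
  have "zonal_mean p v (\<lambda>x. (x \<bullet> u) * (x \<bullet> w)) = B * (u \<bullet> w)" if u: "v \<bullet> u = 0" and w: "v \<bullet> w = 0" for u w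
  proof -
    have "(x \<bullet> u) * (x \<bullet> w) = (1/4) * ((x \<bullet> (u + w))\<^sup>2 - (x \<bullet> (u - w))\<^sup>2)" for x
      by (simp add: inner_simps power2_eq_square algebra_simps)
    then have "zonal_mean p v (\<lambda>x. (x \<bullet> u) * (x \<bullet> w))
       = (1/4) * (zonal_mean p v (\<lambda>x. (x \<bullet> (u + w))\<^sup>2) - zonal_mean p v (\<lambda>x. (x \<bullet> (u - w))\<^sup>2))"
      by (simp only: zonal_mean_cmult) (subst zonal_mean_diff, auto intro!: continuous_intros)
    also have "\<dots> = (1/4) * (B * (norm (u + w))\<^sup>2 - B * (norm (u - w))\<^sup>2)"
    proof -
      have "v \<bullet> (u + w) = 0" "v \<bullet> (u - w) = 0" using u w by (simp_all add: inner_simps)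
      then show ?thesis by (simp only: B)
    qed
    also have "\<dots> = B * (u \<bullet> w)"
      by (simp add: power2_norm_eq_inner inner_simps inner_commute[of w u] algebra_simps)
    finally show ?thesis .
  qed
  then show ?thesis by (rule that)
qed

text \<open>Both vectors are split along v and across it. The cross terms are first moments for the
  kernel p times 1 - t, still a polynomial kernel, and so vanish; the tangential part is isotropic
  by \<open>zonal_second_moment_polar\<close>.\<close>

lemma zonal_second_moment:
  assumes v: "v \<in> S2"
  obtains B where "\<And>u w. zonal_mean p v (\<lambda>x. ((x - v) \<bullet> u) * ((x - v) \<bullet> w))
      = B * (u \<bullet> w - (v \<bullet> u) * (v \<bullet> w)) + (v \<bullet> u) * (v \<bullet> w) * zonal_mean p v (\<lambda>x. (1 - v \<bullet> x)\<^sup>2)"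
proof -
  obtain B where B: "\<And>u w. v \<bullet> u = 0 \<Longrightarrow> v \<bullet> w = 0 \<Longrightarrow> zonal_mean p v (\<lambda>x. (x \<bullet> u) * (x \<bullet> w)) = B * (u \<bullet> w)"
    using zonal_second_moment_polar[OF v, of p] by blast
  have vv: "v \<bullet> v = 1" using v by (simp add: dot_square_norm)
  have "zonal_mean p v (\<lambda>x. ((x - v) \<bullet> u) * ((x - v) \<bullet> w))
      = B * (u \<bullet> w - (v \<bullet> u) * (v \<bullet> w)) + (v \<bullet> u) * (v \<bullet> w) * zonal_mean p v (\<lambda>x. (1 - v \<bullet> x)\<^sup>2)" for u w
  proof -
    define u' where "u' = u - (v \<bullet> u) *\<^sub>R v"
    define w' where "w' = w - (v \<bullet> w) *\<^sub>R v"
    have o: "v \<bullet> u' = 0" "v \<bullet> w' = 0" by (simp_all add: u'_def w'_def inner_simps vv)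
    have uw: "u = u' + (v \<bullet> u) *\<^sub>R v" "w = w' + (v \<bullet> w) *\<^sub>R v" by (simp_all add: u'_def w'_def)
    define a where "a = v \<bullet> u"
    define b where "b = v \<bullet> w"
    have e: "(x - v) \<bullet> u = x \<bullet> u' - a * (1 - v \<bullet> x)" "(x - v) \<bullet> w = x \<bullet> w' - b * (1 - v \<bullet> x)" for x
      by (simp_all add: u'_def w'_def a_def b_def inner_simps inner_commute[of x v] algebra_simps)
    have "((x - v) \<bullet> u) * ((x - v) \<bullet> w) = (x \<bullet> u') * (x \<bullet> w')
        - (a * (poly [:1, -1:] (v \<bullet> x) * (x \<bullet> w')) + b * (poly [:1, -1:] (v \<bullet> x) * (x \<bullet> u'))) + (a * b) * (1 - v \<bullet> x)\<^sup>2" for x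
      unfolding e by (simp add: algebra_simps power2_eq_square)
    then have "zonal_mean p v (\<lambda>x. ((x - v) \<bullet> u) * ((x - v) \<bullet> w))
      = zonal_mean p v (\<lambda>x. (x \<bullet> u') * (x \<bullet> w')
        - (a * (poly [:1, -1:] (v \<bullet> x) * (x \<bullet> w')) + b * (poly [:1, -1:] (v \<bullet> x) * (x \<bullet> u'))) + (a * b) * (1 - v \<bullet> x)\<^sup>2)"
      by (simp only:)
    also have "\<dots> = zonal_mean p v (\<lambda>x. (x \<bullet> u') * (x \<bullet> w'))
        - (zonal_mean p v (\<lambda>x. a * (poly [:1, -1:] (v \<bullet> x) * (x \<bullet> w'))) + zonal_mean p v (\<lambda>x. b * (poly [:1, -1:] (v \<bullet> x) * (x \<bullet> u'))))
        + zonal_mean p v (\<lambda>x. (a * b) * (1 - v \<bullet> x)\<^sup>2)"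
    proof -
      have c: "continuous_on S2 (\<lambda>x. (x \<bullet> u') * (x \<bullet> w'))"
        "continuous_on S2 (\<lambda>x. a * (poly [:1, -1:] (v \<bullet> x) * (x \<bullet> w')))"
        "continuous_on S2 (\<lambda>x. b * (poly [:1, -1:] (v \<bullet> x) * (x \<bullet> u')))"
        "continuous_on S2 (\<lambda>x. (a * b) * (1 - v \<bullet> x)\<^sup>2)"
        by (intro continuous_intros)+
      show ?thesis
        by (simp only: zonal_mean_add[OF continuous_on_diff[OF c(1) continuous_on_add[OF c(2,3)]] c(4)]
            zonal_mean_diff[OF c(1) continuous_on_add[OF c(2,3)]] zonal_mean_add[OF c(2,3)])
    qed
    also have "\<dots> = B * (u' \<bullet> w') + (a * b) * zonal_mean p v (\<lambda>x. (1 - v \<bullet> x)\<^sup>2)"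
      unfolding zonal_mean_cmult zonal_mean_poly B[OF o] zonal_first_moment_orth[OF v o(1)] zonal_first_moment_orth[OF v o(2)]
      by simp
    also have "u' \<bullet> w' = u \<bullet> w - a * b"
      by (simp add: u'_def w'_def a_def b_def inner_simps vv inner_commute[of u v] inner_commute[of w v])
    finally show ?thesis by (simp add: a_def b_def)
  qed
  then show ?thesis by (rule that)
qed

lemma sum_inner_Basis_mult: "(\<Sum>i\<in>Basis. (x \<bullet> i) * (y \<bullet> i)) = x \<bullet> (y :: 'a::euclidean_space)"
  by (rule euclidean_inner[symmetric])

text \<open>The constant B is found by taking the trace over an orthonormal basis: the projection
  onto the tangent plane has trace 2, and |x - v|^2 splits into 1 - (v . x)^2 and (1 - v .
  x)^2.\<close>

lemma zonal_second_moment_eq: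
  assumes v: "v \<in> S2"
  shows "zonal_mean p v (\<lambda>x. ((x - v) \<bullet> u) * ((x - v) \<bullet> w))
      = zonal_second p v * (u \<bullet> w - (v \<bullet> u) * (v \<bullet> w)) + (v \<bullet> u) * (v \<bullet> w) * zonal_mean p v (\<lambda>x. (1 - v \<bullet> x)\<^sup>2)"
proof -
  have vv: "v \<bullet> v = 1" using v by (simp add: dot_square_norm)
  let ?D = "zonal_mean p v (\<lambda>x. (1 - v \<bullet> x)\<^sup>2)"
  obtain B where B: "\<And>u w. zonal_mean p v (\<lambda>x. ((x - v) \<bullet> u) * ((x - v) \<bullet> w))
      = B * (u \<bullet> w - (v \<bullet> u) * (v \<bullet> w)) + (v \<bullet> u) * (v \<bullet> w) * ?D"
    using zonal_second_moment[OF v, of p] by blast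
  have "(\<Sum>i\<in>Basis. zonal_mean p v (\<lambda>x. ((x - v) \<bullet> i) * ((x - v) \<bullet> i))) = zonal_mean p v (\<lambda>x. \<Sum>i\<in>Basis. ((x - v) \<bullet> i) * ((x - v) \<bullet> i))"
    by (rule zonal_mean_sum[symmetric]) (intro continuous_intros)
  also have "\<dots> = zonal_mean p v (\<lambda>x. (1 - (v \<bullet> x)\<^sup>2) + (1 - v \<bullet> x)\<^sup>2)"
  proof (rule zonal_mean_cong)
    fix x :: "real ^ 3" assume "x \<in> S2"
    then have "x \<bullet> x = 1" by (simp add: dot_square_norm)
    then show "(\<Sum>i\<in>Basis. ((x - v) \<bullet> i) * ((x - v) \<bullet> i)) = (1 - (v \<bullet> x)\<^sup>2) + (1 - v \<bullet> x)\<^sup>2"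
      unfolding sum_inner_Basis_mult
      by (simp add: inner_simps vv inner_commute[of x v] power2_eq_square algebra_simps)
  qed
  also have "\<dots> = 2 * zonal_second p v + ?D"
    unfolding zonal_second_def by (subst zonal_mean_add) (auto intro!: continuous_intros)
  finally have "(\<Sum>i\<in>Basis. B * (1 - (v \<bullet> i) * (v \<bullet> i)) + (v \<bullet> i) * (v \<bullet> i) * ?D) = 2 * zonal_second p v + ?D"
    unfolding B by simp
  moreover have "(\<Sum>i\<in>Basis. B * (1 - (v \<bullet> i) * (v \<bullet> i)) + (v \<bullet> i) * (v \<bullet> i) * ?D)
     = B * (real DIM(real ^ 3) - 1) + ?D"
  proof -
    have "(\<Sum>i\<in>Basis. B * (1 - (v \<bullet> i) * (v \<bullet> i)) + (v \<bullet> i) * (v \<bullet> i) * ?D)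
       = B * (\<Sum>i\<in>(Basis::(real^3) set). 1) - B * (\<Sum>i\<in>Basis. (v \<bullet> i) * (v \<bullet> i)) + (\<Sum>i\<in>Basis. (v \<bullet> i) * (v \<bullet> i)) * ?D"
      by (simp only: sum.distrib sum_distrib_left sum_distrib_right right_diff_distrib sum_subtractf)
    then show ?thesis unfolding sum_inner_Basis_mult vv by (simp add: algebra_simps)
  qed
  ultimately have "B = zonal_second p v" by simp
  then show ?thesis using B by simp
qed

section \<open>Peaked kernels, their moments and the Laplacian\<close>

definition peak_poly :: "nat \<Rightarrow> real poly" where
  "peak_poly n = [:1/2, 1/2:] ^ n"

lemma poly_peak: "poly (peak_poly n) t = ((1 + t) / 2) ^ n"
  by (simp add: peak_poly_def field_simps)

lemma zonal_mean_1:
  assumes v: "v \<in> S2"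
  shows "zonal_mean p v (\<lambda>x. 1) = 2 * pi * integral {-1..1} (poly p)"
proof -
  let ?N = "sph_point 0 0"
  have dot: "?N \<bullet> sph_point \<theta> \<phi> = cos \<theta>" for \<theta> \<phi> by (simp add: inner_vec_def sum_3)
  have c: "continuous_on S2 (\<lambda>x. poly p (?N \<bullet> x))" by (intro continuous_intros)
  \<comment> \<open>With the axis moved to the north pole, the inner product with it is the cosine
    of the colatitude.\<close>
  have "zonal_mean p v (\<lambda>x. 1) = zonal_mean p ?N (\<lambda>x. 1)"
    by (rule zonal_mean_const_indep[OF v sph_point_in_S2])
  also have "\<dots> = integral (cbox (0, 0) (pi, 2*pi)) (\<lambda>(\<theta>, \<phi>). sin \<theta> * poly p (cos \<theta>))"
    using integral_surface[OF c] by (simp add: zonal_mean_def dot)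
  also have "\<dots> = integral {0..pi} (\<lambda>\<theta>. integral {0..2*pi} (\<lambda>\<phi>. sin \<theta> * poly p (cos \<theta>)))"
    by (subst integral_prod_continuous) (auto intro!: continuous_intros simp: case_prod_unfold)
  also have "\<dots> = integral {0..pi} (\<lambda>\<theta>. (2 * pi) * (sin \<theta> * poly p (cos \<theta>)))"
    by (intro Henstock_Kurzweil_Integration.integral_cong) simp
  also have "\<dots> = 2 * pi * integral {0..pi} (\<lambda>\<theta>. sin \<theta> * poly p (cos \<theta>))"
    by (rule Henstock_Kurzweil_Integration.integral_mult_right)
  also have "integral {0..pi} (\<lambda>\<theta>. sin \<theta> * poly p (cos \<theta>)) = integral {-1..1} (poly p)"
    by (rule integral_sin_cos) (intro continuous_intros)
  finally show ?thesis .
qed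

lemma integral_peak: "integral {-1..1} (poly (peak_poly n)) = 2 / (real n + 1)"
proof -
  have "((\<lambda>t. 2 / (real n + 1) * ((1 + t) / 2) ^ Suc n) has_real_derivative poly (peak_poly n) t) (at t within {-1..1})" for t
  proof -
    have d: "((\<lambda>t. (1 + t) / 2) has_real_derivative 1 / 2) (at t within {-1..1})"
      by (auto intro!: derivative_eq_intros)
    have "2 / (real n + 1) * ((1 + of_nat n) * (1 / 2 * q)) = q" for q :: real
      by (simp add: field_simps)
    then show ?thesis
      using DERIV_cmult[OF DERIV_power_Suc[OF d, of n], of "2 / (real n + 1)"]
      by (simp only: poly_peak)
  qed
  then have "(poly (peak_poly n) has_integral 2 / (real n + 1) * ((1 + 1) / 2) ^ Suc n - 2 / (real n + 1) * ((1 + - 1) / 2) ^ Suc n) {-1..1}"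
    by (intro fundamental_theorem_of_calculus)
      (auto simp flip: has_real_derivative_iff_has_vector_derivative)
  then show ?thesis by (simp add: integral_unique)
qed

lemma zonal_mean_peak: "v \<in> S2 \<Longrightarrow> zonal_mean (peak_poly n) v (\<lambda>x. 1) = 4 * pi / (real n + 1)"
  by (simp add: zonal_mean_1 integral_peak)

text \<open>Multiplication by a power of (1 + v . x) / 2 only raises the exponent of the kernel, so
  every moment in v . x reduces to a total mass.\<close>

lemma zonal_mean_peak_power:
  assumes v: "v \<in> S2"
  shows "zonal_mean (peak_poly n) v (\<lambda>x. ((1 + v \<bullet> x) / 2) ^ k) = 4 * pi / (real n + real k + 1)"
proof -
  have "zonal_mean (peak_poly n) v (\<lambda>x. ((1 + v \<bullet> x) / 2) ^ k) = zonal_mean (peak_poly (n + k)) v (\<lambda>x. 1)"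
    unfolding zonal_mean_def poly_peak by (simp add: power_add)
  then show ?thesis by (simp add: zonal_mean_peak[OF v])
qed

text \<open>With s = (1 + t) / 2 one has 1 - t = 2 - 2 s, (1 - t)^2 = 4 - 8 s + 4 s^2 and 1 - t^2 =
  4 s - 4 s^2. As |x - v|^2 = 2 (1 - v . x), the second moment in the distance is of order n^-2 and
  the fourth of order n^-3; this gap makes remainders negligible.\<close>

lemma zonal_mean_peak_moments:
  assumes v: "v \<in> S2"
  shows "zonal_mean (peak_poly n) v (\<lambda>x. 1 - v \<bullet> x) = 8 * pi / ((real n + 1) * (real n + 2))"
    and "zonal_mean (peak_poly n) v (\<lambda>x. (1 - v \<bullet> x)\<^sup>2) = 32 * pi / ((real n + 1) * (real n + 2) * (real n + 3))"
    and "zonal_second (peak_poly n) v = 8 * pi / ((real n + 2) * (real n + 3))"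
proof -
  let ?s = "\<lambda>x. (1 + v \<bullet> x) / 2"
  let ?m = "\<lambda>k. zonal_mean (peak_poly n) v (\<lambda>x. ?s x ^ k)"
  have c: "continuous_on S2 (\<lambda>x. a * ?s x ^ k)" for a k by (intro continuous_intros) auto
  have lin: "zonal_mean (peak_poly n) v (\<lambda>x. a * ?s x ^ i + b * ?s x ^ j) = a * ?m i + b * ?m j" for a b i j
    by (subst zonal_mean_add[OF c c]) (simp only: zonal_mean_cmult)
  have lin3: "zonal_mean (peak_poly n) v (\<lambda>x. (a * ?s x ^ i + b * ?s x ^ j) + d * ?s x ^ k) = (a * ?m i + b * ?m j) + d * ?m k" for a b d i j k
    by (subst zonal_mean_add[OF continuous_on_add[OF c c] c]) (simp only: zonal_mean_cmult lin)
  have p: "real n + 1 \<noteq> 0" "real n + 2 \<noteq> 0" "real n + 3 \<noteq> 0" by linarith+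
  have "1 - v \<bullet> x = 2 * ?s x ^ 0 + (- 2) * ?s x ^ 1" for x by (simp add: field_simps)
  then have "zonal_mean (peak_poly n) v (\<lambda>x. 1 - v \<bullet> x) = 2 * ?m 0 + (- 2) * ?m 1"
    by (simp only: lin)
  also have "\<dots> = 8 * pi / ((real n + 1) * (real n + 2))"
    unfolding zonal_mean_peak_power[OF v] using p by (simp add: divide_simps) (simp add: algebra_simps)
  finally show "zonal_mean (peak_poly n) v (\<lambda>x. 1 - v \<bullet> x) = 8 * pi / ((real n + 1) * (real n + 2))" .
  have "(1 - v \<bullet> x)\<^sup>2 = (4 * ?s x ^ 0 + (- 8) * ?s x ^ 1) + 4 * ?s x ^ 2" for x
    by (simp add: power2_eq_square field_simps)
  then have "zonal_mean (peak_poly n) v (\<lambda>x. (1 - v \<bullet> x)\<^sup>2) = (4 * ?m 0 + (- 8) * ?m 1) + 4 * ?m 2"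
    by (simp only: lin3)
  also have "\<dots> = 32 * pi / ((real n + 1) * (real n + 2) * (real n + 3))"
    unfolding zonal_mean_peak_power[OF v] using p by (simp add: divide_simps) (simp add: algebra_simps)
  finally show "zonal_mean (peak_poly n) v (\<lambda>x. (1 - v \<bullet> x)\<^sup>2) = 32 * pi / ((real n + 1) * (real n + 2) * (real n + 3))" .
  have "1 - (v \<bullet> x)\<^sup>2 = 4 * ?s x ^ 1 + (- 4) * ?s x ^ 2" for x
    by (simp add: power2_eq_square field_simps)
  then have "zonal_mean (peak_poly n) v (\<lambda>x. 1 - (v \<bullet> x)\<^sup>2) = 4 * ?m 1 + (- 4) * ?m 2"
    by (simp only: lin)
  also have "\<dots> = 16 * pi / ((real n + 2) * (real n + 3))"
    unfolding zonal_mean_peak_power[OF v] using p by (simp add: divide_simps) (simp add: algebra_simps)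
  finally show "zonal_second (peak_poly n) v = 8 * pi / ((real n + 2) * (real n + 3))"
    by (simp add: zonal_second_def)
qed

text \<open>As \<open>n\<close> grows, averaging against the peaked kernel \<open>((1 + v \<bullet> x)/2)\<^sup>n\<close> computes the
  Laplacian at \<open>v\<close> from a second-order Peano expansion.\<close>

lemma zonal_mean_peak_laplacian:
  fixes f :: "real ^ 3 \<Rightarrow> real" and L :: "real ^ 3 \<Rightarrow> real" and H :: "real ^ 3 \<Rightarrow> real ^ 3 \<Rightarrow> real"
  assumes v: "v \<in> S2" and f: "continuous_on S2 f"
    and L: "linear L" "L v = 0" and H: "\<And>y. linear (H y)" "\<And>y. linear (\<lambda>x. H x y)" "H v v = 0"
    and peano: "\<And>e. 0 < e \<Longrightarrow> \<exists>d>0. \<forall>x\<in>S2. norm (x - v) < d \<longrightarrow>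
       \<bar>f x - f v - L (x - v) - H (x - v) (x - v) / 2\<bar> \<le> e * (norm (x - v))\<^sup>2"
  shows "(\<lambda>n. (zonal_mean (peak_poly n) v f - f v * (4 * pi / (real n + 1)))
      / (8 * pi / ((real n + 2) * (real n + 3)))) \<longlonglongrightarrow> (\<Sum>i\<in>Basis. H i i) / 2"
proof -
  define g where "g = (\<Sum>i\<in>Basis. L i *\<^sub>R i)"
  have Lg: "L x = x \<bullet> g" for x
  proof -
    have "L x = L (\<Sum>i\<in>Basis. (x \<bullet> i) *\<^sub>R i)" by (simp only: euclidean_representation)
    also have "\<dots> = (\<Sum>i\<in>Basis. (x \<bullet> i) * L i)" using L(1) by (simp add: linear_sum linear_scale o_def)
    finally show ?thesis by (simp add: g_def inner_sum_right mult.commute)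
  qed
  have Hb: "H x y = (\<Sum>i\<in>Basis. \<Sum>j\<in>Basis. ((x \<bullet> i) * (y \<bullet> j)) * H i j)" for x y
  proof -
    have "H x y = H (\<Sum>i\<in>Basis. (x \<bullet> i) *\<^sub>R i) y" by (simp only: euclidean_representation)
    also have "\<dots> = (\<Sum>i\<in>Basis. (x \<bullet> i) * H i y)"
      by (simp only: linear_sum[OF H(2)[of y]] linear_scale[OF H(2)[of y]] real_scaleR_def)
    also have "\<dots> = (\<Sum>i\<in>Basis. (x \<bullet> i) * (\<Sum>j\<in>Basis. (y \<bullet> j) * H i j))"
    proof (intro sum.cong refl arg_cong2[where f = "(*)"])
      fix i :: "real ^ 3"
      have "H i y = H i (\<Sum>j\<in>Basis. (y \<bullet> j) *\<^sub>R j)" by (simp only: euclidean_representation)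
      also have "\<dots> = (\<Sum>j\<in>Basis. (y \<bullet> j) * H i j)"
        by (simp only: linear_sum[OF H(1)[of i]] linear_scale[OF H(1)[of i]] real_scaleR_def)
      finally show "H i y = (\<Sum>j\<in>Basis. (y \<bullet> j) * H i j)" .
    qed
    finally show ?thesis by (simp add: sum_distrib_left mult.assoc)
  qed
  define tr where "tr = (\<Sum>i\<in>Basis. H i i)"
  define rem where "rem x = f x - f v - L (x - v) - H (x - v) (x - v) / 2" for x
  define \<beta> where "\<beta> n = 8 * pi / ((real n + 2) * (real n + 3))" for n
  have \<beta>: "0 < \<beta> n" for n by (simp add: \<beta>_def)
  have cL: "continuous_on S2 (\<lambda>x. (x - v) \<bullet> g)" by (intro continuous_intros)
  have Heq: "(\<lambda>x. H (x - v) (x - v)) = (\<lambda>x. \<Sum>i\<in>Basis. \<Sum>j\<in>Basis. (((x - v) \<bullet> i) * ((x - v) \<bullet> j)) * H i j)"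
    by (rule ext) (rule Hb)
  have cH: "continuous_on S2 (\<lambda>x. H (x - v) (x - v))"
    unfolding Heq by (intro continuous_intros)
  have crem: "continuous_on S2 rem"
    unfolding rem_def Lg by (intro continuous_intros f cH) simp
  have mL: "zonal_mean p v (\<lambda>x. (x - v) \<bullet> g) = 0" for p
  proof -
    have "v \<bullet> g = 0" using L(2) Lg by simp
    then show ?thesis using zonal_first_moment_orth[OF v, of g] by (simp add: inner_diff_left)
  qed
  have mH: "zonal_mean p v (\<lambda>x. H (x - v) (x - v)) = zonal_second p v * tr" for p
  proof -
    let ?D = "zonal_mean p v (\<lambda>x. (1 - v \<bullet> x)\<^sup>2)"
    have "zonal_mean p v (\<lambda>x. H (x - v) (x - v))
      = (\<Sum>i\<in>Basis. \<Sum>j\<in>Basis. zonal_mean p v (\<lambda>x. ((x - v) \<bullet> i) * ((x - v) \<bullet> j)) * H i j)"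
    proof -
      have c: "continuous_on S2 (\<lambda>x. (((x - v) \<bullet> i) * ((x - v) \<bullet> j)) * H i j)" for i j
        by (intro continuous_intros)
      show ?thesis
        by (simp only: Heq zonal_mean_sum[OF continuous_on_sum[OF c]] zonal_mean_sum[OF c] zonal_mean_multc)
    qed
    also have "\<dots> = (\<Sum>i\<in>Basis. \<Sum>j\<in>Basis. zonal_second p v * ((i \<bullet> j) * H i j)
        + (?D - zonal_second p v) * (((v \<bullet> i) * (v \<bullet> j)) * H i j))"
      unfolding zonal_second_moment_eq[OF v] by (intro sum.cong refl) (simp add: algebra_simps)
    \<comment> \<open>The deviation from an isotropic second moment is proportional to
      \<open>H v v\<close>, which is 0. So the trace over the whole space appears although only
      tangential directions are averaged.\<close>
    also have "\<dots> = zonal_second p v * (\<Sum>i\<in>Basis. \<Sum>j\<in>Basis. (i \<bullet> j) * H i j)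
        + (?D - zonal_second p v) * H v v"
      unfolding Hb[of v v] by (simp add: sum.distrib sum_distrib_left)
    also have "(\<Sum>i\<in>Basis. \<Sum>j\<in>Basis. (i \<bullet> j) * H i j) = tr"
      unfolding tr_def
    proof (rule sum.cong[OF refl])
      fix i :: "real ^ 3" assume i: "i \<in> Basis"
      have "(\<Sum>j\<in>Basis. (i \<bullet> j) * H i j) = (\<Sum>j\<in>Basis. if j = i then H i i else 0)"
        using i by (intro sum.cong) (auto simp: inner_Basis)
      then show "(\<Sum>j\<in>Basis. (i \<bullet> j) * H i j) = H i i" using i by simp
    qed
    finally show ?thesis using H(3) by simp
  qed
  have expand: "zonal_mean (peak_poly n) v f - f v * (4 * pi / (real n + 1))
      = \<beta> n * (tr / 2) + zonal_mean (peak_poly n) v rem" for n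
  proof -
    have "f x = (f v * 1 + (x - v) \<bullet> g) + ((1/2) * H (x - v) (x - v) + rem x)" for x
      by (simp add: rem_def Lg)
    then have "zonal_mean (peak_poly n) v f
      = zonal_mean (peak_poly n) v (\<lambda>x. (f v * 1 + (x - v) \<bullet> g) + ((1/2) * H (x - v) (x - v) + rem x))"
      by (intro zonal_mean_cong)
    also have "\<dots> = (f v * zonal_mean (peak_poly n) v (\<lambda>x. 1) + zonal_mean (peak_poly n) v (\<lambda>x. (x - v) \<bullet> g))
       + ((1/2) * zonal_mean (peak_poly n) v (\<lambda>x. H (x - v) (x - v)) + zonal_mean (peak_poly n) v rem)"
    proof -
      have c1: "continuous_on S2 (\<lambda>x::real^3. f v * 1)" by (intro continuous_intros)
      have c2: "continuous_on S2 (\<lambda>x. (1/2) * H (x - v) (x - v))" by (intro continuous_intros cH)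
      show ?thesis
        by (simp only: zonal_mean_add[OF continuous_on_add[OF c1 cL] continuous_on_add[OF c2 crem]]
            zonal_mean_add[OF c1 cL] zonal_mean_add[OF c2 crem] zonal_mean_cmult)
    qed
    finally show ?thesis
      unfolding mL mH zonal_mean_peak[OF v] zonal_mean_peak_moments(3)[OF v] \<beta>_def by simp
  qed
  have "(\<lambda>n. zonal_mean (peak_poly n) v rem / \<beta> n) \<longlonglongrightarrow> 0"
  proof (rule LIMSEQ_I)
    fix r :: real assume r: "0 < r"
    \<comment> \<open>Since (n + 3) / (n + 1) is at most 3, the part near v contributes at most 6 e
      = r / 4; the choice of N below keeps the far part under r / 2.\<close>
    define e where "e = r / 24"
    have e: "0 < e" using r by (simp add: e_def)
    obtain d where d: "0 < d" "\<And>x. x \<in> S2 \<Longrightarrow> norm (x - v) < d \<Longrightarrow> \<bar>rem x\<bar> \<le> e * (norm (x - v))\<^sup>2"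
      using peano[OF e] unfolding rem_def by blast
    obtain K where K: "\<forall>x\<in>S2. norm (rem x) \<le> K" using bounded_on_S2[OF crem] .
    then have "0 \<le> K" using v by (meson norm_ge_zero order_trans)
    \<comment> \<open>At distance at least d from v the bound K is at most k |x - v|^4 = 4 k (1 - v
      . x)^2, whose mean is one order smaller than the normalising factor.\<close>
    define k where "k = K / d ^ 4"
    have k: "0 \<le> k" using \<open>0 \<le> K\<close> d(1) by (simp add: k_def)
    have rem_le: "\<bar>rem x\<bar> \<le> (2 * e) * (1 - v \<bullet> x) + (4 * k) * (1 - v \<bullet> x)\<^sup>2" if x: "x \<in> S2" for x
    proof -
      have nx: "(norm (x - v))\<^sup>2 = 2 * (1 - v \<bullet> x)"
      proof -
        have "x \<bullet> x = 1" "v \<bullet> v = 1" using x v by (simp_all add: dot_square_norm)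
        then show ?thesis by (simp add: power2_norm_eq_inner inner_simps inner_commute[of x v])
      qed
      have pos: "0 \<le> (2 * e) * (1 - v \<bullet> x)" using e inner_S2_bound[OF v x] by simp
      show ?thesis
      proof (cases "norm (x - v) < d")
        case True
        have "\<bar>rem x\<bar> \<le> (2 * e) * (1 - v \<bullet> x)"
          using d(2)[OF x True] unfolding nx by (simp only: mult_ac)
        moreover have "0 \<le> (4 * k) * (1 - v \<bullet> x)\<^sup>2" using k by simp
        ultimately show ?thesis by linarith
      next
        case False
        then have "d ^ 4 \<le> norm (x - v) ^ 4" using d(1) by (intro power_mono) auto
        also have "norm (x - v) ^ 4 = ((norm (x - v))\<^sup>2)\<^sup>2"
          by (simp only: power4_eq_xxxx power2_eq_square mult.assoc)
        also have "\<dots> = 4 * (1 - v \<bullet> x)\<^sup>2" unfolding nx by (simp only: power_mult_distrib) simp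
        finally have "k * d ^ 4 \<le> k * (4 * (1 - v \<bullet> x)\<^sup>2)" using k by (rule mult_left_mono)
        moreover have "\<bar>rem x\<bar> \<le> k * d ^ 4" using K x d(1) by (simp add: k_def)
        moreover have "k * (4 * (1 - v \<bullet> x)\<^sup>2) = (4 * k) * (1 - v \<bullet> x)\<^sup>2" by (simp only: mult_ac)
        ultimately show ?thesis using pos by linarith
      qed
    qed
    have bound: "\<bar>zonal_mean (peak_poly n) v rem\<bar> \<le> (2 * e) * (8 * pi / ((real n + 1) * (real n + 2)))
        + (4 * k) * (32 * pi / ((real n + 1) * (real n + 2) * (real n + 3)))" for n
    proof -
      let ?b = "\<lambda>x. (2 * e) * (1 - v \<bullet> x) + (4 * k) * (1 - v \<bullet> x)\<^sup>2"
      have cb: "continuous_on S2 (\<lambda>x. (2 * e) * (1 - v \<bullet> x))" "continuous_on S2 (\<lambda>x. (4 * k) * (1 - v \<bullet> x)\<^sup>2)"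
        by (intro continuous_intros)+
      have "\<bar>zonal_mean (peak_poly n) v rem\<bar> \<le> (\<integral>x. \<bar>poly (peak_poly n) (v \<bullet> x) * rem x\<bar> \<partial>surface_measure)"
        unfolding zonal_mean_def by (rule integral_abs_bound)
      also have "\<dots> \<le> zonal_mean (peak_poly n) v ?b"
        unfolding zonal_mean_def
      proof (rule integral_mono)
        show "integrable surface_measure (\<lambda>x. \<bar>poly (peak_poly n) (v \<bullet> x) * rem x\<bar>)"
          by (intro integrable_abs integrable_zonal crem)
        show "integrable surface_measure (\<lambda>x. poly (peak_poly n) (v \<bullet> x) * ?b x)"
          by (intro integrable_zonal continuous_on_add cb)
        fix x :: "real ^ 3" assume "x \<in> space surface_measure"
        then have x: "x \<in> S2" by simp
        have "0 \<le> poly (peak_poly n) (v \<bullet> x)"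
          unfolding poly_peak using inner_S2_bound[OF v x] by (intro zero_le_power) auto
        then show "\<bar>poly (peak_poly n) (v \<bullet> x) * rem x\<bar> \<le> poly (peak_poly n) (v \<bullet> x) * ?b x"
          unfolding abs_mult using rem_le[OF x] by (simp add: mult_left_mono)
      qed
      also have "\<dots> = (2 * e) * zonal_mean (peak_poly n) v (\<lambda>x. 1 - v \<bullet> x) + (4 * k) * zonal_mean (peak_poly n) v (\<lambda>x. (1 - v \<bullet> x)\<^sup>2)"
        by (simp only: zonal_mean_add[OF cb] zonal_mean_cmult)
      finally show ?thesis unfolding zonal_mean_peak_moments[OF v] .
    qed
    obtain N :: nat where N: "32 * k / r < real N" using reals_Archimedean2 by blast
    have "\<bar>zonal_mean (peak_poly n) v rem / \<beta> n\<bar> < r" if "n \<ge> N" for n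
    proof -
      have "\<bar>zonal_mean (peak_poly n) v rem / \<beta> n\<bar> \<le> ((2 * e) * (8 * pi / ((real n + 1) * (real n + 2)))
        + (4 * k) * (32 * pi / ((real n + 1) * (real n + 2) * (real n + 3)))) / \<beta> n"
        using bound[of n] \<beta>[of n] by (simp add: abs_divide divide_right_mono)
      also have "\<dots> = (2 * e) * ((real n + 3) / (real n + 1)) + 16 * k / (real n + 1)"
      proof -
        define a b c where "a = real n + 1" and "b = real n + 2" and "c = real n + 3"
        have "0 < a" "0 < b" "0 < c" by (simp_all add: a_def b_def c_def)
        then show ?thesis unfolding \<beta>_def a_def[symmetric] b_def[symmetric] c_def[symmetric]
          by (simp add: field_simps)
      qed
      also have "\<dots> \<le> (2 * e) * 3 + 16 * k / (real n + 1)"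
        using e by (intro add_mono mult_left_mono) (auto simp: field_simps)
      also have "\<dots> < r"
      proof -
        have "32 * k / r < real n + 1" using N that by linarith
        then have "16 * k / (real n + 1) < r / 2" using r by (simp add: field_simps)
        then show ?thesis using r unfolding e_def by linarith
      qed
      finally show ?thesis .
    qed
    then show "\<exists>N. \<forall>n\<ge>N. norm (zonal_mean (peak_poly n) v rem / \<beta> n - 0) < r"
      by (intro exI[of _ N]) simp
  qed
  then have "(\<lambda>n. tr / 2 + zonal_mean (peak_poly n) v rem / \<beta> n) \<longlonglongrightarrow> tr / 2 + 0"
    by (intro tendsto_add tendsto_const)
  moreover have "(zonal_mean (peak_poly n) v f - f v * (4 * pi / (real n + 1))) / \<beta> n
     = tr / 2 + zonal_mean (peak_poly n) v rem / \<beta> n" for n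
    unfolding expand using \<beta>[of n] by (simp add: add_divide_distrib)
  ultimately show ?thesis unfolding tr_def \<beta>_def by simp
qed

section \<open>Second derivatives and the Laplace--Beltrami operator\<close>

lemma twice_differentiable_on_affine:
  fixes G :: "'b::real_normed_vector \<Rightarrow> real" and A :: "'a::real_normed_vector \<Rightarrow> 'b"
  assumes G: "twice_differentiable_on G W" and A: "bounded_linear A"
    and sub: "\<And>x. x \<in> U \<Longrightarrow> c + A x \<in> W"
  shows "twice_differentiable_on (\<lambda>x. G (c + A x)) U"
proof -
  obtain G' :: "'b \<Rightarrow> 'b \<Rightarrow>\<^sub>L real" where G': "\<And>z. z \<in> W \<Longrightarrow> (G has_derivative blinfun_apply (G' z)) (at z)"
    "\<And>z. z \<in> W \<Longrightarrow> G' differentiable (at z)"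
    using G unfolding twice_differentiable_on_def by blast
  define B where "B = Blinfun A"
  have B: "blinfun_apply B = A" by (simp add: B_def bounded_linear_Blinfun_apply[OF A])
  have dA: "((\<lambda>x. c + A x) has_derivative A) (at x)" for x
    using has_derivative_add[OF has_derivative_const bounded_linear_imp_has_derivative[OF A]] by simp
  show ?thesis
    unfolding twice_differentiable_on_def
  proof (intro exI[of _ "\<lambda>x. G' (c + A x) o\<^sub>L B"] ballI conjI)
    fix x assume x: "x \<in> U"
    have "(G \<circ> (\<lambda>x. c + A x) has_derivative blinfun_apply (G' (c + A x)) \<circ> A) (at x)"
      by (rule diff_chain_at[OF dA G'(1)[OF sub[OF x]]])
    moreover have "blinfun_apply (G' (c + A x) o\<^sub>L B) = blinfun_apply (G' (c + A x)) \<circ> A"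
      by (auto simp: B)
    ultimately show "((\<lambda>x. G (c + A x)) has_derivative blinfun_apply (G' (c + A x) o\<^sub>L B)) (at x)"
      by (simp add: o_def)
    obtain G'' where "(G' has_derivative G'') (at (c + A x))"
      using G'(2)[OF sub[OF x]] unfolding differentiable_def by blast
    from diff_chain_at[OF dA this] have "((\<lambda>x. G' (c + A x)) has_derivative G'' \<circ> A) (at x)"
      by (simp add: o_def)
    from bounded_linear.has_derivative[OF bounded_bilinear.bounded_linear_left[OF bounded_bilinear_blinfun_compose] this]
    show "(\<lambda>x. G' (c + A x) o\<^sub>L B) differentiable (at x)"
      unfolding differentiable_def by blast
  qed
qed

lemma has_real_derivativeI:
  "(g has_derivative (\<lambda>s. s * c)) (at t) \<Longrightarrow> (g has_real_derivative c) (at t)"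
  by (simp add: has_field_derivative_def mult_commute_abs)

text \<open>The mean value theorem is applied on the segment from v to x to F minus its second-order
  Taylor polynomial. The derivative of this difference is the error of the linear approximation of
  F' at v, evaluated at h, hence at most e |h|^2.\<close>

lemma second_order_peano:
  fixes F :: "'a::real_normed_vector \<Rightarrow> real" and F' :: "'a \<Rightarrow> 'a \<Rightarrow>\<^sub>L real"
  assumes U: "open U" "v \<in> U" and F': "\<And>z. z \<in> U \<Longrightarrow> (F has_derivative blinfun_apply (F' z)) (at z)"
    and F'': "(F' has_derivative F'') (at v)" and e: "0 < e"
  shows "\<exists>d>0. \<forall>x. norm (x - v) < d \<longrightarrow>
    \<bar>F x - F v - F' v (x - v) - F'' (x - v) (x - v) / 2\<bar> \<le> e * (norm (x - v))\<^sup>2"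
proof -
  interpret F'': bounded_linear F'' using F'' by (rule has_derivative_bounded_linear)
  obtain d1 where d1: "0 < d1" "\<And>x. norm (x - v) < d1 \<Longrightarrow> norm (F' x - F' v - F'' (x - v)) \<le> e * norm (x - v)"
    using F'' e unfolding has_derivative_at_alt by blast
  obtain d2 where d2: "0 < d2" "ball v d2 \<subseteq> U" using U open_contains_ball by blast
  have "\<bar>F x - F v - F' v (x - v) - F'' (x - v) (x - v) / 2\<bar> \<le> e * (norm (x - v))\<^sup>2"
    if x: "norm (x - v) < min d1 d2" for x
  proof -
    define h where "h = x - v"
    define \<phi> where "\<phi> t = F (v + t *\<^sub>R h) - t * F' v h - t\<^sup>2 / 2 * F'' h h" for t :: real
    define \<psi> where "\<psi> t = (F' (v + t *\<^sub>R h) - F' v - F'' (t *\<^sub>R h)) h" for t :: real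
    have small: "norm (t *\<^sub>R h) \<le> norm h" if "0 \<le> t" "t \<le> 1" for t
      using that by (simp add: mult_left_le_one_le)
    have "DERIV \<phi> t :> \<psi> t" if t: "0 \<le> t" "t \<le> 1" for t
    proof -
      have "v + t *\<^sub>R h \<in> U"
        using d2(2) small[OF t] x by (auto simp: dist_norm h_def)
      have "((\<lambda>t. v + t *\<^sub>R h) has_derivative (\<lambda>s. s *\<^sub>R h)) (at t)"
        by (auto intro!: derivative_eq_intros)
      from diff_chain_at[OF this F'[OF \<open>v + t *\<^sub>R h \<in> U\<close>]]
      have "((\<lambda>t. F (v + t *\<^sub>R h)) has_derivative (\<lambda>s. s * F' (v + t *\<^sub>R h) h)) (at t)"
        by (simp add: o_def blinfun.scaleR_right)
      then have "DERIV (\<lambda>t. F (v + t *\<^sub>R h)) t :> F' (v + t *\<^sub>R h) h"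
        by (rule has_real_derivativeI)
      then show ?thesis unfolding \<phi>_def \<psi>_def
        by (auto intro!: derivative_eq_intros simp: blinfun.diff_left F''.scaleR blinfun.scaleR_left)
    qed
    then obtain \<xi> where \<xi>: "0 < \<xi>" "\<xi> < 1" "\<phi> 1 - \<phi> 0 = (1 - 0) * \<psi> \<xi>"
      using MVT2[of 0 1 \<phi> \<psi>] by auto
    have "\<bar>\<psi> \<xi>\<bar> \<le> norm (F' (v + \<xi> *\<^sub>R h) - F' v - F'' (\<xi> *\<^sub>R h)) * norm h"
      unfolding \<psi>_def using norm_blinfun by (metis real_norm_def)
    also have "\<dots> \<le> (e * norm (\<xi> *\<^sub>R h)) * norm h"
      using d1(2)[of "v + \<xi> *\<^sub>R h"] small[of \<xi>] \<xi>(1,2) x by (intro mult_right_mono) (auto simp: h_def)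
    also have "\<dots> \<le> (e * norm h) * norm h"
      using small[of \<xi>] \<xi>(1,2) e by (intro mult_right_mono mult_left_mono) auto
    finally have "\<bar>\<phi> 1 - \<phi> 0\<bar> \<le> e * (norm h)\<^sup>2" unfolding \<xi>(3) by (simp add: power2_eq_square)
    moreover have "\<phi> 1 - \<phi> 0 = F x - F v - F' v (x - v) - F'' (x - v) (x - v) / 2"
      by (simp add: \<phi>_def h_def)
    ultimately show ?thesis by (simp add: h_def)
  qed
  then show ?thesis using d1(1) d2(1) by (intro exI[of _ "min d1 d2"]) auto
qed

text \<open>Here \<open>F\<close> is \<open>f \<circ> sgn\<close>, whose radial derivative vanishes.\<close>

locale ray_extension =
  fixes f F :: "real ^ 3 \<Rightarrow> real" and F' :: "real ^ 3 \<Rightarrow> (real ^ 3) \<Rightarrow>\<^sub>L real"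
    and F'' :: "real ^ 3 \<Rightarrow> real ^ 3 \<Rightarrow> (real ^ 3) \<Rightarrow>\<^sub>L real"
  assumes F: "\<And>x. F x = f (sgn x)"
    and F': "\<And>z. z \<noteq> 0 \<Longrightarrow> (F has_derivative blinfun_apply (F' z)) (at z)"
    and F'': "\<And>z. z \<noteq> 0 \<Longrightarrow> (F' has_derivative F'' z) (at z)"
begin

lemma radial_derivative:
  assumes z: "z \<noteq> 0"
  shows "F' z z = 0"
proof -
  have "((\<lambda>t. (1 + t) *\<^sub>R z) has_derivative (\<lambda>t. t *\<^sub>R z)) (at (0::real))"
    by (auto intro!: derivative_eq_intros)
  moreover have "(F has_derivative blinfun_apply (F' z)) (at ((1 + 0) *\<^sub>R z))" using F'[OF z] by simp
  ultimately have "(F \<circ> (\<lambda>t. (1 + t) *\<^sub>R z) has_derivative blinfun_apply (F' z) \<circ> (\<lambda>t. t *\<^sub>R z)) (at 0)"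
    by (rule diff_chain_at)
  moreover have "(F \<circ> (\<lambda>t. (1 + t) *\<^sub>R z) has_derivative (\<lambda>t. 0)) (at 0)"
  proof (rule has_derivative_transform_within_open[OF has_derivative_const[of "F z"]])
    show "open {- 1<..<(1::real)}" by simp
    fix t :: real assume "t \<in> {- 1<..<1}"
    then have "sgn ((1 + t) *\<^sub>R z) = sgn z" by (simp add: sgn_scaleR)
    then show "F z = (F \<circ> (\<lambda>t. (1 + t) *\<^sub>R z)) t" by (simp add: F)
  qed simp
  ultimately have "blinfun_apply (F' z) \<circ> (\<lambda>t. t *\<^sub>R z) = (\<lambda>t. 0)" by (rule has_derivative_unique)
  from fun_cong[OF this, of 1] show ?thesis by simp
qed

text \<open>Differentiating the identity F' z z = 0 in the direction h gives F' z h + F'' z h z = 0,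
  and the first term vanishes at h = z.\<close>

lemma radial_second_derivative:
  assumes z: "z \<noteq> 0"
  shows "F'' z z z = 0"
proof -
  have "((\<lambda>z. blinfun_apply (F' z) z) has_derivative (\<lambda>h. F' z h + F'' z h z)) (at z)"
    by (rule bounded_bilinear.FDERIV[OF bounded_bilinear_blinfun_apply F''[OF z] has_derivative_ident])
  moreover have "((\<lambda>z. blinfun_apply (F' z) z) has_derivative (\<lambda>h. 0)) (at z)"
  proof (rule has_derivative_transform_within_open[OF has_derivative_const[of 0]])
    show "open (- {0 :: real ^ 3})" by auto
  qed (use z radial_derivative in auto)
  ultimately have "(\<lambda>h. F' z h + F'' z h z) = (\<lambda>h. 0)" by (rule has_derivative_unique)
  from fun_cong[OF this, of z] show ?thesis using radial_derivative[OF z] by simp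
qed

lemma linear_second: "z \<noteq> 0 \<Longrightarrow> linear (\<lambda>x. F'' z x y)" "linear (\<lambda>x. F'' z y x)"
proof -
  show "linear (\<lambda>x. F'' z y x)"
    by (rule bounded_linear.linear) (rule blinfun.bounded_linear_right)
  assume "z \<noteq> 0"
  then interpret bounded_linear "F'' z" using F'' has_derivative_bounded_linear by blast
  show "linear (\<lambda>x. F'' z x y)"
    by (rule linearI) (simp_all add: add scaleR blinfun.add_left blinfun.scaleR_left)
qed

lemma second_axis:
  assumes z: "z \<noteq> 0"
  shows "F'' z x y = (\<Sum>i\<in>UNIV. \<Sum>j\<in>UNIV. x $ i * y $ j * F'' z (axis i 1) (axis j 1))"
proof -
  have e: "x = (\<Sum>i\<in>UNIV. (x $ i) *\<^sub>R axis i 1)" for x :: "real ^ 3"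
    by (simp add: vec_eq_iff axis_def sum_3 forall_3)
  have "F'' z x y = F'' z (\<Sum>i\<in>UNIV. (x $ i) *\<^sub>R axis i 1) y" by (simp only: e[symmetric])
  also have "\<dots> = (\<Sum>i\<in>UNIV. x $ i * F'' z (axis i 1) y)"
    by (simp only: linear_sum[OF linear_second(1)[OF z, of y]] linear_scale[OF linear_second(1)[OF z, of y]] real_scaleR_def)
  also have "\<dots> = (\<Sum>i\<in>UNIV. x $ i * (\<Sum>j\<in>UNIV. y $ j * F'' z (axis i 1) (axis j 1)))"
  proof (intro sum.cong refl arg_cong2[where f = "(*)"])
    fix i :: 3
    have "F'' z (axis i 1) y = F'' z (axis i 1) (\<Sum>i\<in>UNIV. (y $ i) *\<^sub>R axis i 1)" by (simp only: e[symmetric])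
    also have "\<dots> = (\<Sum>j\<in>UNIV. y $ j * F'' z (axis i 1) (axis j 1))"
      by (simp only: linear_sum[OF linear_second(2)] linear_scale[OF linear_second(2)] real_scaleR_def)
    finally show "F'' z (axis i 1) y = (\<Sum>j\<in>UNIV. y $ j * F'' z (axis i 1) (axis j 1))" .
  qed
  finally show ?thesis by (simp only: sum_distrib_left mult.assoc)
qed

text \<open>The vectors q, r and p are the unit vectors along colatitude, longitude and radius. The
  term with cot \<theta> in the coordinate Laplacian cancels against the component along q of the
  acceleration of the parallel circle, which leaves F'' on q and on r. The radial entry F'' p p p is
  0 and completes the trace.\<close>

lemma laplace_coords_eq_trace:
  fixes \<theta> \<phi> :: real
  assumes s: "sin \<theta> \<noteq> 0"
  defines "p \<equiv> sph_point \<theta> \<phi>"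
  shows "laplace_coords (\<lambda>\<theta> \<phi>. f (sph_point \<theta> \<phi>)) \<theta> \<phi> = (\<Sum>i\<in>UNIV. F'' p (axis i 1) (axis i 1))"
proof -
  define q where "q t u = (cos t * cos u) *\<^sub>R axis 1 1 + (cos t * sin u) *\<^sub>R axis 2 1 - sin t *\<^sub>R (axis 3 1 :: real ^ 3)"
    for t u :: real
  define r where "r u = (- sin u) *\<^sub>R axis 1 1 + cos u *\<^sub>R (axis 2 1 :: real ^ 3)" for u :: real
  have p0: "sph_point t u \<noteq> 0" for t u using norm_sph_point[of t u] by (metis norm_zero zero_neq_one)
  have fF: "f (sph_point t u) = F (sph_point t u)" for t u
    by (simp add: F sgn_div_norm)
  have dt: "((\<lambda>t. sph_point t u) has_vector_derivative q t u) (at t)" for t u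
    unfolding sph_point_eq_axis q_def has_vector_derivative_def
    by (auto intro!: derivative_eq_intros simp: algebra_simps)
  have du: "((\<lambda>u. sph_point t u) has_vector_derivative sin t *\<^sub>R r u) (at u)" for t u
    unfolding sph_point_eq_axis r_def has_vector_derivative_def
    by (auto intro!: derivative_eq_intros simp: algebra_simps)
  have dq: "((\<lambda>t. q t u) has_vector_derivative - sph_point t u) (at t)" for t u
    unfolding sph_point_eq_axis q_def has_vector_derivative_def
    by (auto intro!: derivative_eq_intros simp: algebra_simps)
  have dr: "((\<lambda>u. sin t *\<^sub>R r u) has_vector_derivative - (sin t * sin t) *\<^sub>R sph_point t u - (sin t * cos t) *\<^sub>R q t u) (at u)" for t u
  proof -
    have "((\<lambda>u. sin t *\<^sub>R r u) has_vector_derivative sin t *\<^sub>R ((- cos u) *\<^sub>R axis 1 1 + (- sin u) *\<^sub>R axis 2 1)) (at u)"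
      unfolding r_def has_vector_derivative_def
      by (auto intro!: derivative_eq_intros simp: algebra_simps)
    moreover have "sin t *\<^sub>R ((- cos u) *\<^sub>R axis 1 1 + (- sin u) *\<^sub>R axis 2 1 :: real ^ 3)
       = - (sin t * sin t) *\<^sub>R sph_point t u - (sin t * cos t) *\<^sub>R q t u"
    proof -
      have i: "sin t * (sin t * (sin t * a)) + sin t * (cos t * (cos t * a)) = sin t * a" for a
      proof -
        have "sin t * (sin t * (sin t * a)) + sin t * (cos t * (cos t * a)) = (sin t * a) * ((sin t)\<^sup>2 + (cos t)\<^sup>2)"
          by (simp only: power2_eq_square algebra_simps)
        then show ?thesis by simp
      qed
      show ?thesis
        unfolding q_def sph_point_eq_axis vec_eq_iff forall_3 axis_def
        using i[of "cos u"] i[of "sin u"] by (simp add: algebra_simps)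
    qed
    ultimately show ?thesis by simp
  qed
  have d1: "((\<lambda>t. F (sph_point t u)) has_real_derivative F' (sph_point t u) (q t u)) (at t)" for t u
    using diff_chain_at[OF dt[unfolded has_vector_derivative_def] F'[OF p0]]
    by (intro has_real_derivativeI) (simp add: o_def blinfun.scaleR_right)
  have d2: "((\<lambda>u. F (sph_point t u)) has_real_derivative F' (sph_point t u) (sin t *\<^sub>R r u)) (at u)" for t u
    using diff_chain_at[OF du[unfolded has_vector_derivative_def] F'[OF p0]]
    by (intro has_real_derivativeI) (simp add: o_def blinfun.scaleR_right mult.assoc)
  have chain: "((\<lambda>t. F' (c t) (b t)) has_real_derivative F'' (c t) c' (b t) + F' (c t) b') (at t)"
    if c: "(c has_vector_derivative c') (at t)" "c t \<noteq> 0" and b: "(b has_vector_derivative b') (at t)" for c b c' b' t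
  proof -
    interpret L: bounded_linear "F'' (c t)" using F''[OF c(2)] by (rule has_derivative_bounded_linear)
    from diff_chain_at[OF c(1)[unfolded has_vector_derivative_def] F''[OF c(2)]]
    have "((\<lambda>t. F' (c t)) has_derivative (\<lambda>s. s *\<^sub>R F'' (c t) c')) (at t)" by (simp add: o_def L.scaleR)
    from bounded_bilinear.FDERIV[OF bounded_bilinear_blinfun_apply this b[unfolded has_vector_derivative_def]]
    moreover have "(\<lambda>h. blinfun_apply (F' (c t)) (h *\<^sub>R b') + blinfun_apply (h *\<^sub>R F'' (c t) c') (b t))
       = (\<lambda>h. h * (F'' (c t) c' (b t) + F' (c t) b'))"
      by (simp add: fun_eq_iff blinfun.scaleR_left blinfun.scaleR_right algebra_simps)
    ultimately show ?thesis by (intro has_real_derivativeI) (simp only:)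
  qed
  have i1: "deriv (\<lambda>s. f (sph_point s \<phi>)) t = F' (sph_point t \<phi>) (q t \<phi>)" for t
    unfolding fF by (rule DERIV_imp_deriv[OF d1])
  have i2: "deriv (\<lambda>u. f (sph_point \<theta> u)) = (\<lambda>u. F' (sph_point \<theta> u) (sin \<theta> *\<^sub>R r u))"
    unfolding fF by (rule ext) (rule DERIV_imp_deriv[OF d2])
  have q0: "F' p p = 0" by (rule radial_derivative) (simp add: p_def p0)
  have "((\<lambda>t. sin t * F' (sph_point t \<phi>) (q t \<phi>)) has_real_derivative
      cos \<theta> * F' p (q \<theta> \<phi>) + (F'' p (q \<theta> \<phi>) (q \<theta> \<phi>) + F' p (- p)) * sin \<theta>) (at \<theta>)"
    unfolding p_def by (rule DERIV_mult[OF DERIV_sin chain[OF dt p0 dq]])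
  then have D1: "deriv (\<lambda>t. sin t * deriv (\<lambda>s. f (sph_point s \<phi>)) t) \<theta>
     = cos \<theta> * F' p (q \<theta> \<phi>) + F'' p (q \<theta> \<phi>) (q \<theta> \<phi>) * sin \<theta>"
    unfolding i1 using DERIV_imp_deriv q0 by (simp add: blinfun.minus_right)
  have D2: "deriv (deriv (\<lambda>u. f (sph_point \<theta> u))) \<phi>
     = (sin \<theta>)\<^sup>2 * F'' p (r \<phi>) (r \<phi>) - (sin \<theta> * cos \<theta>) * F' p (q \<theta> \<phi>)"
  proof -
    have "((\<lambda>u. F' (sph_point \<theta> u) (sin \<theta> *\<^sub>R r u)) has_real_derivative F'' p (sin \<theta> *\<^sub>R r \<phi>) (sin \<theta> *\<^sub>R r \<phi>)
      + F' p (- (sin \<theta> * sin \<theta>) *\<^sub>R p - (sin \<theta> * cos \<theta>) *\<^sub>R q \<theta> \<phi>)) (at \<phi>)"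
      unfolding p_def by (rule chain[OF du p0 dr])
    moreover have "F'' p (sin \<theta> *\<^sub>R r \<phi>) (sin \<theta> *\<^sub>R r \<phi>) = (sin \<theta>)\<^sup>2 * F'' p (r \<phi>) (r \<phi>)"
      using linear_scale[OF linear_second(1)[of p]] linear_scale[OF linear_second(2)] p0
      by (simp add: p_def power2_eq_square)
    moreover have "F' p (- (sin \<theta> * sin \<theta>) *\<^sub>R p - (sin \<theta> * cos \<theta>) *\<^sub>R q \<theta> \<phi>) = - (sin \<theta> * cos \<theta>) * F' p (q \<theta> \<phi>)"
      by (simp add: blinfun.diff_right blinfun.minus_right blinfun.scaleR_right q0)
    ultimately show ?thesis unfolding i2 using DERIV_imp_deriv by force
  qed
  have "laplace_coords (\<lambda>\<theta> \<phi>. f (sph_point \<theta> \<phi>)) \<theta> \<phi> = F'' p (q \<theta> \<phi>) (q \<theta> \<phi>) + F'' p (r \<phi>) (r \<phi>)"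
    unfolding laplace_coords_def D1 D2 using s by (simp add: field_simps power2_eq_square)
  also have "\<dots> = F'' p (q \<theta> \<phi>) (q \<theta> \<phi>) + F'' p (r \<phi>) (r \<phi>) + F'' p p p"
    using radial_second_derivative[of p] p0 by (simp add: p_def)
  also have "\<dots> = (\<Sum>i\<in>UNIV. \<Sum>j\<in>UNIV. (q \<theta> \<phi> $ i * q \<theta> \<phi> $ j + r \<phi> $ i * r \<phi> $ j + p $ i * p $ j) * F'' p (axis i 1) (axis j 1))"
  proof -
    have "p \<noteq> 0" using p0 by (simp add: p_def)
    note sa = second_axis[OF this]
    show ?thesis
      by (simp only: sa[of "q \<theta> \<phi>"] sa[of "r \<phi>"] sa[of p p] sum.distrib distrib_right)
  qed
  also have "\<dots> = (\<Sum>i\<in>UNIV. \<Sum>j\<in>UNIV. (if j = i then 1 else 0) * F'' p (axis i 1) (axis j 1))"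
  proof (intro sum.cong refl arg_cong2[where f = "(*)"])
    fix i j :: 3
    have c: "(sin \<theta>)\<^sup>2 + (cos \<theta>)\<^sup>2 = 1" "(sin \<phi>)\<^sup>2 + (cos \<phi>)\<^sup>2 = 1" by simp_all
    have comp: "q \<theta> \<phi> $ 1 = cos \<theta> * cos \<phi>" "q \<theta> \<phi> $ 2 = cos \<theta> * sin \<phi>" "q \<theta> \<phi> $ 3 = - sin \<theta>"
      "r \<phi> $ 1 = - sin \<phi>" "r \<phi> $ 2 = cos \<phi>" "r \<phi> $ 3 = 0"
      "p $ 1 = sin \<theta> * cos \<phi>" "p $ 2 = sin \<theta> * sin \<phi>" "p $ 3 = cos \<theta>"
      by (simp_all add: q_def r_def p_def axis_def)
    \<comment> \<open>These identities say that the frame q, r, p is complete: its outer products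
      sum to the identity matrix, so the trace may be taken in the standard basis.\<close>
    have "cos \<theta> * cos \<phi> * (cos \<theta> * cos \<phi>) + - sin \<phi> * - sin \<phi> + sin \<theta> * cos \<phi> * (sin \<theta> * cos \<phi>) = 1"
      "cos \<theta> * sin \<phi> * (cos \<theta> * sin \<phi>) + cos \<phi> * cos \<phi> + sin \<theta> * sin \<phi> * (sin \<theta> * sin \<phi>) = 1"
      "- sin \<theta> * - sin \<theta> + 0 * 0 + cos \<theta> * cos \<theta> = 1"
      "cos \<theta> * cos \<phi> * (cos \<theta> * sin \<phi>) + - sin \<phi> * cos \<phi> + sin \<theta> * cos \<phi> * (sin \<theta> * sin \<phi>) = 0"
      "cos \<theta> * cos \<phi> * - sin \<theta> + - sin \<phi> * 0 + sin \<theta> * cos \<phi> * cos \<theta> = 0"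
      "cos \<theta> * sin \<phi> * - sin \<theta> + cos \<phi> * 0 + sin \<theta> * sin \<phi> * cos \<theta> = 0"
      using c by algebra+
    then have "\<forall>i j. q \<theta> \<phi> $ i * q \<theta> \<phi> $ j + r \<phi> $ i * r \<phi> $ j + p $ i * p $ j = (if j = i then 1 else 0)"
      unfolding forall_3 comp by (simp add: mult_ac)
    then show "q \<theta> \<phi> $ i * q \<theta> \<phi> $ j + r \<phi> $ i * r \<phi> $ j + p $ i * p $ j = (if j = i then 1 else 0)" by blast
  qed
  also have "\<dots> = (\<Sum>i\<in>UNIV. F'' p (axis i 1) (axis i 1))"
  proof (rule sum.cong[OF refl])
    fix i :: 3
    have "(\<Sum>j\<in>UNIV. (if j = i then 1 else 0) * F'' p (axis i 1) (axis j 1))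
      = (\<Sum>j\<in>UNIV. if j = i then F'' p (axis i 1) (axis i 1) else 0)"
      by (intro sum.cong) auto
    then show "(\<Sum>j\<in>UNIV. (if j = i then 1 else 0) * F'' p (axis i 1) (axis j 1)) = F'' p (axis i 1) (axis i 1)" by simp
  qed
  finally show ?thesis .
qed

end

section \<open>The Laplace-Beltrami operator at the poles\<close>

lemma rotate_axes_axis: "rotate_axes (axis 1 1) = axis 2 1" "rotate_axes (axis 2 1) = axis 3 1" "rotate_axes (axis 3 1) = axis 1 1"
  by (simp_all add: rotate_axes_def vec_eq_iff forall_3 axis_def)

lemma bounded_linear_rotate_axes: "bounded_linear rotate_axes"
  by (rule linear_conv_bounded_linear[THEN iffD1], rule linearI)
    (simp_all add: rotate_axes_def vec_eq_iff forall_3)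

lemma norm_rotate_axes: "norm (rotate_axes x) = norm x"
  by (simp add: norm_eq_sqrt_inner inner_vec_def sum_3 rotate_axes_def add_ac)

lemma sgn_rotate_axes: "sgn (rotate_axes x) = rotate_axes (sgn x)"
  using linear_scale[OF bounded_linear.linear[OF bounded_linear_rotate_axes]]
  by (simp add: sgn_div_norm norm_rotate_axes)

text \<open>At the poles the operator is evaluated in permuted axes. The permutation is a linear
  isometry and commutes with \<open>sgn\<close>, so the composite is again extended constantly along
  rays.\<close>

lemma (in ray_extension) ray_extension_rotate:
  "ray_extension (\<lambda>x. f (rotate_axes x)) (\<lambda>x. F (rotate_axes x))
    (\<lambda>z. F' (rotate_axes z) o\<^sub>L Blinfun rotate_axes)
    (\<lambda>z h. F'' (rotate_axes z) (rotate_axes h) o\<^sub>L Blinfun rotate_axes)"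
proof
  note A = bounded_linear_rotate_axes
  have dA: "(rotate_axes has_derivative rotate_axes) (at x)" for x
    by (rule bounded_linear_imp_has_derivative[OF A])
  show "F (rotate_axes x) = f (rotate_axes (sgn x))" for x by (simp add: F sgn_rotate_axes)
  fix z :: "real ^ 3" assume "z \<noteq> 0"
  then have z: "rotate_axes z \<noteq> 0" using norm_rotate_axes[of z] by force
  from diff_chain_at[OF dA F'[OF z]]
  show "((\<lambda>x. F (rotate_axes x)) has_derivative blinfun_apply (F' (rotate_axes z) o\<^sub>L Blinfun rotate_axes)) (at z)"
    by (simp add: o_def bounded_linear_Blinfun_apply[OF A] blinfun_compose.rep_eq)
  from diff_chain_at[OF dA F''[OF z]]
  have "((\<lambda>x. F' (rotate_axes x)) has_derivative (\<lambda>h. F'' (rotate_axes z) (rotate_axes h))) (at z)"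
    by (simp add: o_def)
  from bounded_linear.has_derivative[OF bounded_bilinear.bounded_linear_left[OF bounded_bilinear_blinfun_compose] this]
  show "((\<lambda>z. F' (rotate_axes z) o\<^sub>L Blinfun rotate_axes) has_derivative
     (\<lambda>h. F'' (rotate_axes z) (rotate_axes h) o\<^sub>L Blinfun rotate_axes)) (at z)" .
qed

text \<open>Away from the poles this is the coordinate computation. At a pole the same computation
  is made in the rotated chart, and the cyclic permutation of the axes only permutes the diagonal
  entries of the trace.\<close>

lemma (in ray_extension) laplace_beltrami_eq_trace:
  assumes x: "x \<in> S2"
  shows "laplace_beltrami f x = (\<Sum>i\<in>UNIV. F'' x (axis i 1) (axis i 1))"
proof (cases "x $ 1 = 0 \<and> x $ 2 = 0")
  case True
  let ?y = "sph_point (pi / 2) (x $ 3 * pi / 2)"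
  have y: "rotate_axes ?y = x" using True x by (intro rotate_axes_pole) auto
  interpret R: ray_extension "\<lambda>x. f (rotate_axes x)" "\<lambda>x. F (rotate_axes x)"
    "\<lambda>z. F' (rotate_axes z) o\<^sub>L Blinfun rotate_axes"
    "\<lambda>z h. F'' (rotate_axes z) (rotate_axes h) o\<^sub>L Blinfun rotate_axes"
    by (rule ray_extension_rotate)
  have "laplace_beltrami f x = laplace_coords (\<lambda>\<theta> \<phi>. f (rotate_axes (sph_point \<theta> \<phi>))) (pi / 2) (x $ 3 * pi / 2)"
    using True by (simp add: laplace_beltrami_def)
  also have "\<dots> = (\<Sum>i\<in>UNIV. (F'' x (rotate_axes (axis i 1)) o\<^sub>L Blinfun rotate_axes) (axis i 1))"
    using R.laplace_coords_eq_trace[of "pi / 2" "x $ 3 * pi / 2"] by (simp add: y)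
  also have "\<dots> = (\<Sum>i\<in>UNIV. F'' x (axis i 1) (axis i 1))"
    by (simp add: sum_3 rotate_axes_axis bounded_linear_Blinfun_apply[OF bounded_linear_rotate_axes])
  finally show ?thesis .
next
  case False
  have sp: "sph_point (colat x) (longi x) = x" by (rule sph_point_colat_longi[OF x])
  have "sin (colat x) \<noteq> 0"
  proof
    assume "sin (colat x) = 0"
    then have "x $ 1 = 0" "x $ 2 = 0"
      using sph_point_nth(1,2)[of "colat x" "longi x"] unfolding sp by simp_all
    then show False using False by blast
  qed
  from laplace_coords_eq_trace[OF this, of "longi x"] show ?thesis
    unfolding sp using False by (auto simp: laplace_beltrami_def)
qed

lemma ray_extension_exists:
  assumes "twice_differentiable_on (\<lambda>x. f (sgn x)) (- {0})"
  obtains F' F'' where "ray_extension f (\<lambda>x. f (sgn x)) F' F''"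
proof -
  obtain F' :: "real ^ 3 \<Rightarrow> (real ^ 3) \<Rightarrow>\<^sub>L real" where F': "\<And>z. z \<noteq> 0 \<Longrightarrow> ((\<lambda>x. f (sgn x)) has_derivative blinfun_apply (F' z)) (at z)"
    "\<And>z. z \<noteq> 0 \<Longrightarrow> F' differentiable (at z)"
    using assms unfolding twice_differentiable_on_def by blast
  have "\<And>z. z \<noteq> 0 \<Longrightarrow> (F' has_derivative frechet_derivative F' (at z)) (at z)"
    using F'(2) by (simp add: frechet_derivative_works)
  with F'(1) have "ray_extension f (\<lambda>x. f (sgn x)) F' (\<lambda>z. frechet_derivative F' (at z))"
    by unfold_locales auto
  then show ?thesis by (rule that)
qed

lemma twice_differentiable_slice:
  assumes "twice_differentiable_sphere C" "y \<in> S2"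
  shows "twice_differentiable_on (\<lambda>x. C (sgn x) y) (- {0})" "twice_differentiable_on (\<lambda>x. C y (sgn x)) (- {0})"
proof -
  have y: "y \<noteq> 0" "sgn y = y" using assms(2) by (auto simp: sgn_div_norm)
  have G: "twice_differentiable_on (\<lambda>(x, y). C (sgn x) (sgn y)) ((- {0}) \<times> (- {0}))"
    using assms(1) by (simp add: twice_differentiable_sphere_def)
  have A1: "bounded_linear (\<lambda>x::real^3. (x, 0::real^3))" and A2: "bounded_linear (\<lambda>x::real^3. (0::real^3, x))"
    by (intro bounded_linear_Pair bounded_linear_ident bounded_linear_zero)+
  show "twice_differentiable_on (\<lambda>x. C (sgn x) y) (- {0})"
    using twice_differentiable_on_affine[OF G A1, of "- {0}" "(0, y)"] y by simp
  show "twice_differentiable_on (\<lambda>x. C y (sgn x)) (- {0})"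
    using twice_differentiable_on_affine[OF G A2, of "- {0}" "(y, 0)"] y by simp
qed

text \<open>The derivatives of the ray extension provide L and H; both vanish in the radial
  direction, as \<open>zonal_mean_peak_laplacian\<close> demands, and the trace of H is the operator
  at v, also when v is a pole.\<close>

lemma zonal_mean_peak_laplace_beltrami:
  assumes f: "continuous_on S2 f" "twice_differentiable_on (\<lambda>x. f (sgn x)) (- {0})" and v: "v \<in> S2"
  shows "(\<lambda>n. (zonal_mean (peak_poly n) v f - f v * (4 * pi / (real n + 1)))
      / (8 * pi / ((real n + 2) * (real n + 3)))) \<longlonglongrightarrow> laplace_beltrami f v / 2"
proof -
  obtain F' F'' where "ray_extension f (\<lambda>x. f (sgn x)) F' F''"
    using ray_extension_exists[OF f(2)] by blast
  then interpret ray_extension f "\<lambda>x. f (sgn x)" F' F'' .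
  have v0: "v \<noteq> 0" using v by auto
  have sg: "sgn x = x" if "x \<in> S2" for x :: "real ^ 3" using that by (simp add: sgn_div_norm)
  have "(\<lambda>n. (zonal_mean (peak_poly n) v f - f v * (4 * pi / (real n + 1)))
      / (8 * pi / ((real n + 2) * (real n + 3)))) \<longlonglongrightarrow> (\<Sum>i\<in>Basis. F'' v i i) / 2"
  proof (rule zonal_mean_peak_laplacian[OF v f(1), where L = "\<lambda>x. F' v x" and H = "\<lambda>x y. F'' v x y"])
    show "linear (F' v)" by (rule bounded_linear.linear[OF blinfun.bounded_linear_right])
    show "F' v v = 0" "F'' v v v = 0" by (rule radial_derivative[OF v0] radial_second_derivative[OF v0])+
    show "linear (\<lambda>x. F'' v x y)" "linear (F'' v y)" for y
      by (rule linear_second(1)[OF v0] linear_second(2))+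
    fix e :: real assume e: "0 < e"
    have "\<exists>d>0. \<forall>x. norm (x - v) < d \<longrightarrow>
       \<bar>f (sgn x) - f (sgn v) - F' v (x - v) - F'' v (x - v) (x - v) / 2\<bar> \<le> e * (norm (x - v))\<^sup>2"
      by (rule second_order_peano[of "- {0}"]) (use v0 e F' F'' in auto)
    then obtain d where d: "0 < d" "\<And>x. norm (x - v) < d \<Longrightarrow>
       \<bar>f (sgn x) - f (sgn v) - F' v (x - v) - F'' v (x - v) (x - v) / 2\<bar> \<le> e * (norm (x - v))\<^sup>2"
      by blast
    have "\<bar>f x - f v - F' v (x - v) - F'' v (x - v) (x - v) / 2\<bar> \<le> e * (norm (x - v))\<^sup>2"
      if "x \<in> S2" "norm (x - v) < d" for x
      using d(2)[OF that(2)] unfolding sg[OF that(1)] sg[OF v] .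
    with d(1) show "\<exists>d>0. \<forall>x\<in>S2. norm (x - v) < d \<longrightarrow>
       \<bar>f x - f v - F' v (x - v) - F'' v (x - v) (x - v) / 2\<bar> \<le> e * (norm (x - v))\<^sup>2"
      by (intro exI[of _ d] conjI ballI impI)
  qed
  also have "(\<Sum>i\<in>Basis. F'' v i i) = (\<Sum>i\<in>UNIV. F'' v (axis i 1) (axis i 1))"
  proof -
    have "(Basis :: (real ^ 3) set) = (\<lambda>i. axis i 1) ` UNIV" by (auto simp: Basis_vec_def)
    then have "(\<Sum>i\<in>Basis. F'' v i i) = (\<Sum>i\<in>range (\<lambda>i::3. axis i 1). F'' v i i)" by (simp only:)
    also have "\<dots> = (\<Sum>i\<in>UNIV. F'' v (axis i 1) (axis i 1))"
      by (subst sum.reindex) (auto simp: inj_on_def axis_eq_axis)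
    finally show ?thesis .
  qed
  also have "\<dots> = laplace_beltrami f v" by (rule laplace_beltrami_eq_trace[OF v, symmetric])
  finally show ?thesis .
qed

text \<open>For every n the averages in the two arguments agree by
  \<open>zonal_average_commute\<close>, and the subtracted multiple of C x y is the same for both,
  so the limits agree.\<close>

lemma degree_diagonal_laplace_beltrami:
  assumes "expanded_field M T" and D: "degree_diagonal_spectrum M T Ct"
    and td: "twice_differentiable_sphere (cov_fun M T)" and x: "x \<in> S2" and y: "y \<in> S2"
  shows "laplace_beltrami (\<lambda>z. cov_fun M T z y) x = laplace_beltrami (\<lambda>z. cov_fun M T x z) y"
proof -
  interpret expanded_field M T by fact
  have a: "(\<lambda>n. (zonal_mean (peak_poly n) x (\<lambda>z. C z y) - C x y * (4 * pi / (real n + 1)))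
      / (8 * pi / ((real n + 2) * (real n + 3)))) \<longlonglongrightarrow> laplace_beltrami (\<lambda>z. C z y) x / 2"
    by (rule zonal_mean_peak_laplace_beltrami[OF continuous_on_cov_left[OF y] twice_differentiable_slice(1)[OF td y] x])
  have b: "(\<lambda>n. (zonal_mean (peak_poly n) y (\<lambda>z. C x z) - C x y * (4 * pi / (real n + 1)))
      / (8 * pi / ((real n + 2) * (real n + 3)))) \<longlonglongrightarrow> laplace_beltrami (\<lambda>z. C x z) y / 2"
    by (rule zonal_mean_peak_laplace_beltrami[OF continuous_on_cov_right[OF x] twice_differentiable_slice(2)[OF td x] y])
  have c: "zonal_mean (peak_poly n) x (\<lambda>z. C z y) = zonal_mean (peak_poly n) y (\<lambda>z. C x z)" for n
    unfolding zonal_mean_def by (rule zonal_average_commute[OF \<open>expanded_field M T\<close> D x y])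
  have "laplace_beltrami (\<lambda>z. C z y) x / 2 = laplace_beltrami (\<lambda>z. C x z) y / 2"
    by (rule LIMSEQ_unique[OF a[unfolded c] b])
  then show ?thesis by simp
qed

section \<open>The weak form of the Laplace--Beltrami condition\<close>

text \<open>At order 0 the truncated exponent is harmless, since its term carries the factor
  0.\<close>

definition harm_amp_deriv :: "nat \<Rightarrow> int \<Rightarrow> real \<Rightarrow> real" where
  "harm_amp_deriv l m \<theta> = (if m < 0 then 1 else (-1) ^ nat \<bar>m\<bar>) * harm_norm l (nat \<bar>m\<bar>)
     * (real (nat \<bar>m\<bar>) * (cos \<theta> * sin \<theta> ^ (nat \<bar>m\<bar> - 1)) * poly (legendre_deriv l (nat \<bar>m\<bar>)) (cos \<theta>)
        - sin \<theta> ^ Suc (nat \<bar>m\<bar>) * poly (legendre_deriv l (Suc (nat \<bar>m\<bar>))) (cos \<theta>))"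

lemma DERIV_legendre_cos:
  "((\<lambda>t. poly (legendre_deriv l k) (cos t)) has_real_derivative
     poly (legendre_deriv l (Suc k)) (cos t) * - sin t) (at t)"
  by (rule DERIV_chain2[OF DERIV_legendre_deriv DERIV_cos])

lemma DERIV_sin_power: "((\<lambda>t. sin t ^ k) has_real_derivative real k * (cos t * sin t ^ (k - 1))) (at t)"
  by (rule DERIV_cong[OF DERIV_power[OF DERIV_sin]]) simp

lemma DERIV_harm_amp: "(harm_amp l m has_real_derivative harm_amp_deriv l m t) (at t)"
proof -
  define k where "k = nat \<bar>m\<bar>"
  have "((\<lambda>t. sin t ^ k * poly (legendre_deriv l k) (cos t)) has_real_derivative
     real k * (cos t * sin t ^ (k - 1)) * poly (legendre_deriv l k) (cos t)
     + poly (legendre_deriv l (Suc k)) (cos t) * - sin t * sin t ^ k) (at t)"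
    by (rule DERIV_mult[OF DERIV_sin_power DERIV_legendre_cos])
  from DERIV_cmult[OF this, of "(if m < 0 then 1 else (-1) ^ k) * harm_norm l k"]
  show ?thesis unfolding harm_amp_def[abs_def] harm_amp_deriv_def k_def[symmetric]
    by (rule DERIV_cong) (simp add: mult_ac)
qed

text \<open>The colatitude part of the eigenvalue equation in Sturm-Liouville form, as Lagrange's
  identity needs it.\<close>

lemma DERIV_sin_harm_amp_deriv:
  assumes s: "sin t \<noteq> 0"
  shows "((\<lambda>t. sin t * harm_amp_deriv l m t) has_real_derivative
     ((real_of_int m)\<^sup>2 / sin t - real l * (real l + 1) * sin t) * harm_amp l m t) (at t)"
proof -
  define k where "k = nat \<bar>m\<bar>"
  define c where "c = (if m < 0 then 1 else (-1) ^ k) * harm_norm l k"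
  define Q where "Q j t = poly (legendre_deriv l j) (cos t)" for j t
  have dQ: "(Q j has_real_derivative Q (Suc j) t * - sin t) (at t)" for j
    unfolding Q_def by (rule DERIV_legendre_cos)
  have ks: "sin t * (real k * (cos t * sin t ^ (k - 1))) = real k * (cos t * sin t ^ k)" for t
    by (cases k) simp_all
  have eq: "sin t * harm_amp_deriv l m t = c * (real k * (cos t * sin t ^ k) * Q k t - sin t ^ (k + 2) * Q (Suc k) t)" for t
  proof -
    have "sin t * harm_amp_deriv l m t = c * ((sin t * (real k * (cos t * sin t ^ (k - 1)))) * Q k t - (sin t * sin t ^ Suc k) * Q (Suc k) t)"
      unfolding harm_amp_deriv_def k_def[symmetric] c_def[symmetric] Q_def by (simp only: algebra_simps)
    then show ?thesis unfolding ks by simp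
  qed
  have amp: "harm_amp l m t = c * (sin t ^ k * Q k t)"
    by (simp add: harm_amp_def k_def c_def Q_def)
  have m2: "(real_of_int m)\<^sup>2 = (real k)\<^sup>2" by (simp add: k_def)
  let ?d = "c * ((real k * (- sin t * sin t ^ k + real k * (cos t * sin t ^ (k - 1)) * cos t)) * Q k t
       + Q (Suc k) t * - sin t * (real k * (cos t * sin t ^ k))
       - (real (k + 2) * (cos t * sin t ^ (k + 2 - 1)) * Q (Suc k) t + Q (Suc (Suc k)) t * - sin t * sin t ^ (k + 2)))"
  have D: "((\<lambda>t. c * (real k * (cos t * sin t ^ k) * Q k t - sin t ^ (k + 2) * Q (Suc k) t)) has_real_derivative ?d) (at t)"
    by (intro DERIV_cmult DERIV_diff DERIV_mult DERIV_sin_power dQ DERIV_cos)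
  define S C R where "S = sin t" and "C = cos t" and "R = sin t ^ k"
  have SC: "C * C = 1 - S * S" by (simp add: C_def S_def flip: power2_eq_square cos_squared_eq)
  have ode: "S * S * Q (Suc (Suc k)) t = 2 * (real k + 1) * C * Q (Suc k) t - (real l - real k) * (real l + real k + 1) * Q k t"
  proof -
    have "1 - (cos t)\<^sup>2 = sin t * sin t" using sin_squared_eq[of t] by (simp add: power2_eq_square)
    then show ?thesis using legendre_deriv_ode[of "cos t" l k] unfolding Q_def S_def C_def by simp
  qed
  \<comment> \<open>Multiplication by sin t clears the exponent k - 1 and produces the factor sin^2
    that the Legendre equation has in front of its second derivative.\<close>
  have "S * ?d = c * R * (real k * real k * (C * C) * Q k t - real k * (S * S) * Q k t
       - (2 * real k + 2) * (S * S) * C * Q (Suc k) t + (S * S) * (S * S * Q (Suc (Suc k)) t))"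
  proof -
    have "S * ?d = c * (real k * (- S * S * R + (sin t * (real k * (cos t * sin t ^ (k - 1)))) * C) * Q k t
       - S * S * Q (Suc k) t * (real k * (C * R))
       - (real (k + 2) * (C * (S * S * R)) * Q (Suc k) t - S * S * S * S * R * Q (Suc (Suc k)) t))"
      by (simp add: S_def C_def R_def algebra_simps)
    then show ?thesis unfolding ks by (simp add: S_def C_def R_def algebra_simps)
  qed
  also have "\<dots> = S * ((((real k)\<^sup>2 / S - real l * (real l + 1) * S) * (c * (R * Q k t))))"
    unfolding SC ode using s by (simp add: S_def[symmetric] power2_eq_square field_simps)
  finally have "?d = ((real k)\<^sup>2 / S - real l * (real l + 1) * S) * (c * (R * Q k t))"
    using s by (simp only: mult_cancel_left S_def[symmetric]) simp
  then show ?thesis unfolding eq amp m2 using DERIV_cong[OF D] by (simp only: S_def R_def)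
qed

text \<open>Lagrange's identity: in the derivative of w a' b - a w b' the two products of first
  derivatives cancel. It is Green's identity in one coordinate, used with weight sin for the
  colatitude and weight 1 for the longitude.\<close>

lemma wronskian_derivative:
  fixes b b1 :: "real \<Rightarrow> complex"
  assumes a: "(a has_real_derivative a1 t) (at t)"
    and wa: "((\<lambda>s. w s * a1 s) has_real_derivative X) (at t)"
    and b: "(b has_vector_derivative b1 t) (at t)"
    and wb: "((\<lambda>s. of_real (w s) * b1 s) has_vector_derivative Y) (at t)"
  shows "((\<lambda>s. of_real (w s * a1 s) * b s - of_real (a s) * (of_real (w s) * b1 s)) has_vector_derivative
     of_real X * b t - of_real (a t) * Y) (at t)"
proof -
  have "((\<lambda>s. complex_of_real (w s * a1 s)) has_vector_derivative of_real X) (at t)"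
    "((\<lambda>s. complex_of_real (a s)) has_vector_derivative of_real (a1 t)) (at t)"
    by (rule has_vector_derivative_of_real[OF wa] has_vector_derivative_of_real[OF a])+
  from has_vector_derivative_diff[OF has_vector_derivative_mult[OF this(1) b] has_vector_derivative_mult[OF this(2) wb]]
  show ?thesis by (rule back_subst) (simp add: mult_ac)
qed

lemma (in ray_extension) laplace_coords_eq_beltrami:
  "sin \<theta> \<noteq> 0 \<Longrightarrow> laplace_coords (\<lambda>\<theta> \<phi>. f (sph_point \<theta> \<phi>)) \<theta> \<phi> = laplace_beltrami f (sph_point \<theta> \<phi>)"
  by (simp add: laplace_coords_eq_trace laplace_beltrami_eq_trace)

text \<open>Joint differentiability enters only as a property, while the divergence is computed by
  one-variable calculus: the Frechet derivative of component i applied to i is the derivative along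
  the line in that direction.\<close>

lemma flux_defect_eq_0_partial:
  fixes V :: "'a::euclidean_space \<Rightarrow> 'a \<Rightarrow> 'b::euclidean_space"
  assumes ab: "\<And>i. i \<in> Basis \<Longrightarrow> a \<bullet> i < b \<bullet> i"
    and h: "continuous_on (cbox a b) h"
    and V: "\<And>i z. i \<in> Basis \<Longrightarrow> z \<in> cbox a b \<Longrightarrow> V i differentiable (at z)"
    and d: "\<And>i z. i \<in> Basis \<Longrightarrow> z \<in> cbox a b \<Longrightarrow> ((\<lambda>s. V i (z + s *\<^sub>R i)) has_vector_derivative d i z) (at 0)"
    and div: "\<And>z. z \<in> cbox a b \<Longrightarrow> (\<Sum>i\<in>Basis. d i z) = h z"
  shows "flux_defect V h a b = 0"
proof (rule flux_defect_eq_0[OF ab h, where V' = "\<lambda>z i. frechet_derivative (V i) (at z)"])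
  have D: "(V i has_derivative frechet_derivative (V i) (at z)) (at z)" if "i \<in> Basis" "z \<in> cbox a b" for i z
    using V[OF that] by (simp add: frechet_derivative_works)
  then show "(V i has_derivative frechet_derivative (V i) (at z)) (at z within cbox a b)"
    if "i \<in> Basis" "z \<in> cbox a b" for i z
    using that by (blast intro: has_derivative_at_withinI)
  fix z assume z: "z \<in> cbox a b"
  have "frechet_derivative (V i) (at z) i = d i z" if i: "i \<in> Basis" for i
  proof -
    have line: "((\<lambda>s. z + s *\<^sub>R i) has_derivative (\<lambda>s. s *\<^sub>R i)) (at (0::real))"
      by (auto intro!: derivative_eq_intros)
    have "(V i has_derivative frechet_derivative (V i) (at z)) (at (z + 0 *\<^sub>R i))" using D[OF i z] by simp
    from diff_chain_at[OF line this]
    have "((\<lambda>s. V i (z + s *\<^sub>R i)) has_derivative (\<lambda>s. frechet_derivative (V i) (at z) (s *\<^sub>R i))) (at 0)"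
      by (simp add: o_def)
    from has_derivative_unique[OF this d[OF i z, unfolded has_vector_derivative_def]]
    have "(\<lambda>s. frechet_derivative (V i) (at z) (s *\<^sub>R i)) = (\<lambda>s. s *\<^sub>R d i z)" .
    from fun_cong[OF this, of 1] show ?thesis by simp
  qed
  then show "(\<Sum>i\<in>Basis. frechet_derivative (V i) (at z) i) = h z"
    using div[OF z] by simp
qed

section \<open>Charts, tangent vectors and differentiability in the coordinates\<close>

definition tangent_colat :: "real \<times> real \<Rightarrow> real ^ 3" where
  "tangent_colat s = (cos (fst s) * cos (snd s)) *\<^sub>R axis 1 1 + (cos (fst s) * sin (snd s)) *\<^sub>R axis 2 1
     - sin (fst s) *\<^sub>R axis 3 1"

definition tangent_longi :: "real \<times> real \<Rightarrow> real ^ 3" where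
  "tangent_longi s = (- (sin (fst s) * sin (snd s))) *\<^sub>R axis 1 1 + (sin (fst s) * cos (snd s)) *\<^sub>R axis 2 1"

abbreviation chart :: "real \<times> real \<Rightarrow> real ^ 3" where
  "chart s \<equiv> sph_point (fst s) (snd s)"

lemma chart_derivatives:
  "((\<lambda>t. sph_point t u) has_vector_derivative tangent_colat (t, u)) (at t)"
  "((\<lambda>u. sph_point t u) has_vector_derivative tangent_longi (t, u)) (at u)"
  unfolding sph_point_eq_axis tangent_colat_def tangent_longi_def has_vector_derivative_def
  by (auto intro!: derivative_eq_intros simp: algebra_simps)

lemma differentiable_chart:
  "chart differentiable (at s)" "tangent_colat differentiable (at s)" "tangent_longi differentiable (at s)"
  unfolding sph_point_eq_axis tangent_colat_def[abs_def] tangent_longi_def[abs_def] differentiable_def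
  by (rule exI, (rule derivative_intros)+)+

lemma differentiable_fst_snd:
  assumes "f differentiable (at (fst t))" shows "(\<lambda>t. f (fst t)) differentiable (at t)"
proof -
  obtain D where "(f has_derivative D) (at (fst t))" using assms unfolding differentiable_def by blast
  from diff_chain_at[OF has_derivative_fst[OF has_derivative_ident] this] show ?thesis
    unfolding differentiable_def o_def by blast
qed

lemma differentiable_snd:
  assumes "f differentiable (at (snd t))" shows "(\<lambda>t. f (snd t)) differentiable (at t)"
proof -
  obtain D where "(f has_derivative D) (at (snd t))" using assms unfolding differentiable_def by blast
  from diff_chain_at[OF has_derivative_snd[OF has_derivative_ident] this] show ?thesis
    unfolding differentiable_def o_def by blast
qed

lemma differentiable_Pair:
  assumes "f differentiable (at t)" "g differentiable (at t)"
  shows "(\<lambda>t. (f t, g t)) differentiable (at t)"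
  using assms has_derivative_Pair unfolding differentiable_def by blast

lemma differentiable_blinfun_apply:
  assumes "A differentiable (at t)" "w differentiable (at t)"
  shows "(\<lambda>t. blinfun_apply (A t) (w t)) differentiable (at t)"
  using assms bounded_bilinear.FDERIV[OF bounded_bilinear_blinfun_apply] unfolding differentiable_def by blast

lemma differentiable_compose_at:
  assumes "f differentiable (at t)" "g differentiable (at (f t))"
  shows "(\<lambda>t. g (f t)) differentiable (at t)"
  using differentiable_chain_at[OF assms] by (simp add: o_def)

lemma differentiable_of_real:
  "f differentiable (at t) \<Longrightarrow> (\<lambda>t. complex_of_real (f t)) differentiable (at t)"
  using has_derivative_of_real unfolding differentiable_def by blast

lemma DERIV_differentiable: "(f has_real_derivative D) (at x) \<Longrightarrow> f differentiable (at x)"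
  unfolding differentiable_def has_field_derivative_def by blast

lemma differentiable_fst_fst: "(\<lambda>t. fst (fst t)) differentiable (at (t :: (real \<times> real) \<times> (real \<times> real)))"
  and differentiable_fst_snd': "(\<lambda>t. fst (snd t)) differentiable (at (t :: (real \<times> real) \<times> (real \<times> real)))"
  unfolding differentiable_def by (rule exI, (rule derivative_intros)+)+

text \<open>The exponent \<sigma> is i m for a harmonic and -i m for its conjugate, so one
  computation covers both factors of the spectral integral.\<close>

definition harm_block :: "nat \<Rightarrow> int \<Rightarrow> complex \<Rightarrow> real \<times> real \<Rightarrow> complex" where
  "harm_block l m \<sigma> s = of_real (harm_amp l m (fst s)) * exp (\<sigma> * of_real (snd s))"

definition harm_block_colat :: "nat \<Rightarrow> int \<Rightarrow> complex \<Rightarrow> real \<times> real \<Rightarrow> complex" where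
  "harm_block_colat l m \<sigma> s = of_real (harm_amp_deriv l m (fst s)) * exp (\<sigma> * of_real (snd s))"

lemma exp_longi_derivative:
  fixes \<sigma> :: complex
  shows
  "((\<lambda>u. exp (\<sigma> * of_real u)) has_vector_derivative \<sigma> * exp (\<sigma> * of_real u)) (at u)"
proof -
  have "((\<lambda>z. exp (\<sigma> * z)) has_field_derivative \<sigma> * exp (\<sigma> * of_real u)) (at (of_real u))"
    by (auto intro!: derivative_eq_intros)
  then show ?thesis by (rule has_vector_derivative_real_field)
qed

lemma differentiable_harm_amp_deriv: "harm_amp_deriv l m differentiable (at t)"
  unfolding harm_amp_deriv_def[abs_def] differentiable_def
  by (rule exI, (rule derivative_intros has_derivative_sin has_derivative_cos
      DERIV_legendre_cos[THEN has_field_derivative_imp_has_derivative])+)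

lemma differentiable_harm_block:
  "harm_block l m \<sigma> differentiable (at s)" "harm_block_colat l m \<sigma> differentiable (at s)"
proof -
  have e: "(\<lambda>s::real \<times> real. exp (\<sigma> * of_real (snd s))) differentiable (at s)"
    using exp_longi_derivative[of \<sigma> "snd s"]
    by (intro differentiable_snd) (auto simp: differentiable_def has_vector_derivative_def)
  have a: "(\<lambda>s::real \<times> real. complex_of_real (harm_amp l m (fst s))) differentiable (at s)"
    "(\<lambda>s::real \<times> real. complex_of_real (harm_amp_deriv l m (fst s))) differentiable (at s)"
    by (intro differentiable_of_real differentiable_fst_snd DERIV_differentiable[OF DERIV_harm_amp]
        differentiable_harm_amp_deriv)+
  show "harm_block l m \<sigma> differentiable (at s)" "harm_block_colat l m \<sigma> differentiable (at s)"
    unfolding harm_block_def[abs_def] harm_block_colat_def[abs_def]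
    by (intro differentiable_mult a e)+
qed

text \<open>Green's identity in one point of the sphere, the other being frozen and its harmonic
  absorbed in K. The two terms with m^2, from the colatitude equation and from \<sigma> * \<sigma>,
  cancel and leave the eigenvalue l (l + 1). The factor (sin \<theta>)^2 clears the denominators of
  the coordinate Laplacian.\<close>

lemma block_divergence:
  fixes g A1 A2 :: "real \<times> real \<Rightarrow> real" and K :: complex
  assumes s: "sin \<theta> \<noteq> 0" and \<sigma>: "\<sigma> * \<sigma> = - of_real ((real_of_int m)\<^sup>2)"
    and g1: "\<And>t. ((\<lambda>t. g (t, \<phi>)) has_real_derivative A1 (t, \<phi>)) (at t)"
    and g2: "\<And>u. ((\<lambda>u. g (\<theta>, u)) has_real_derivative A2 (\<theta>, u)) (at u)"
    and A1: "(\<lambda>t. A1 (t, \<phi>)) differentiable (at \<theta>)" and A2: "(\<lambda>u. A2 (\<theta>, u)) differentiable (at \<phi>)"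
  obtains d1 d2 where
    "((\<lambda>t. of_real (sin t * A1 (t, \<phi>)) * (harm_block l m \<sigma> (t, \<phi>) * K)
        - of_real (g (t, \<phi>)) * (of_real (sin t) * (harm_block_colat l m \<sigma> (t, \<phi>) * K))) has_vector_derivative d1) (at \<theta>)"
    "((\<lambda>u. of_real (A2 (\<theta>, u)) * (harm_block l m \<sigma> (\<theta>, u) * K)
        - of_real (g (\<theta>, u)) * (\<sigma> * harm_block l m \<sigma> (\<theta>, u) * K)) has_vector_derivative d2) (at \<phi>)"
    "of_real (sin \<theta>) * d1 + d2 = of_real ((sin \<theta>)\<^sup>2 * (laplace_coords (\<lambda>\<theta> \<phi>. g (\<theta>, \<phi>)) \<theta> \<phi>
        + real l * (real l + 1) * g (\<theta>, \<phi>))) * (harm_block l m \<sigma> (\<theta>, \<phi>) * K)"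
proof -
  let ?Y = "harm_block l m \<sigma>"
  define X1 where "X1 = deriv (\<lambda>t. sin t * deriv (\<lambda>s. g (s, \<phi>)) t) \<theta>"
  define X2 where "X2 = deriv (deriv (\<lambda>u. g (\<theta>, u))) \<phi>"
  have i1: "deriv (\<lambda>s. g (s, \<phi>)) t = A1 (t, \<phi>)" for t by (rule DERIV_imp_deriv[OF g1])
  have i2: "deriv (\<lambda>u. g (\<theta>, u)) = (\<lambda>u. A2 (\<theta>, u))" by (rule ext) (rule DERIV_imp_deriv[OF g2])
  have "(\<lambda>t. sin t * A1 (t, \<phi>)) differentiable (at \<theta>)"
    by (intro differentiable_mult A1 DERIV_differentiable[OF DERIV_sin])
  then have X1: "((\<lambda>t. sin t * A1 (t, \<phi>)) has_real_derivative X1) (at \<theta>)"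
    unfolding X1_def i1 by (simp add: DERIV_deriv_iff_real_differentiable)
  have X2: "((\<lambda>u. 1 * A2 (\<theta>, u)) has_real_derivative X2) (at \<phi>)"
    unfolding X2_def i2 using A2 by (simp add: DERIV_deriv_iff_real_differentiable)
  define E where "E = exp (\<sigma> * of_real \<phi>)"
  have b1: "((\<lambda>t. ?Y (t, \<phi>) * K) has_vector_derivative harm_block_colat l m \<sigma> (t, \<phi>) * K) (at t)" for t
    unfolding harm_block_def harm_block_colat_def fst_conv snd_conv
    by (intro has_vector_derivative_mult_left has_vector_derivative_of_real DERIV_harm_amp)
  have wb1: "((\<lambda>t. of_real (sin t) * (harm_block_colat l m \<sigma> (t, \<phi>) * K)) has_vector_derivative
      of_real (((real_of_int m)\<^sup>2 / sin \<theta> - real l * (real l + 1) * sin \<theta>) * harm_amp l m \<theta>) * (E * K)) (at \<theta>)"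
  proof -
    have "(\<lambda>t. of_real (sin t) * (harm_block_colat l m \<sigma> (t, \<phi>) * K))
      = (\<lambda>t. complex_of_real (sin t * harm_amp_deriv l m t) * (E * K))"
      by (simp add: fun_eq_iff harm_block_colat_def E_def mult_ac)
    then show ?thesis
      using has_vector_derivative_mult_left[OF has_vector_derivative_of_real[OF DERIV_sin_harm_amp_deriv[OF s, of l m]], of "E * K"]
      by (simp only:)
  qed
  have b2: "((\<lambda>u. ?Y (\<theta>, u) * K) has_vector_derivative \<sigma> * ?Y (\<theta>, u) * K) (at u)" for u
  proof -
    have "((\<lambda>u. of_real (harm_amp l m \<theta>) * exp (\<sigma> * of_real u) * K) has_vector_derivative
       of_real (harm_amp l m \<theta>) * (\<sigma> * exp (\<sigma> * of_real u)) * K) (at u)"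
      by (intro has_vector_derivative_mult_left has_vector_derivative_mult_right exp_longi_derivative)
    then show ?thesis by (simp add: harm_block_def mult_ac)
  qed
  have wb2: "((\<lambda>u. of_real 1 * (\<sigma> * ?Y (\<theta>, u) * K)) has_vector_derivative \<sigma> * (\<sigma> * ?Y (\<theta>, \<phi>) * K)) (at \<phi>)"
    using has_vector_derivative_mult_right[OF b2, of \<sigma>] by (simp add: mult_ac)
  note W1 = wronskian_derivative[OF g1 X1 b1 wb1]
  have W2: "((\<lambda>u. of_real (A2 (\<theta>, u)) * (?Y (\<theta>, u) * K)
        - of_real (g (\<theta>, u)) * (\<sigma> * ?Y (\<theta>, u) * K)) has_vector_derivative
        of_real X2 * (?Y (\<theta>, \<phi>) * K) - of_real (g (\<theta>, \<phi>)) * (\<sigma> * (\<sigma> * ?Y (\<theta>, \<phi>) * K))) (at \<phi>)"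
    using wronskian_derivative[OF g2 X2 b2 wb2] by simp
  define S where "S = sin \<theta>"
  define \<Lambda> where "\<Lambda> = real l * (real l + 1)"
  define Z where "Z = ?Y (\<theta>, \<phi>) * K"
  define gg where "gg = g (\<theta>, \<phi>)"
  define M2 where "M2 = (real_of_int m)\<^sup>2"
  have S: "S \<noteq> 0" using s by (simp add: S_def)
  have sq: "\<sigma> * (\<sigma> * ?Y (\<theta>, \<phi>) * K) = - of_real M2 * Z"
    using \<sigma> by (simp add: Z_def M2_def mult.assoc[symmetric])
  have amp: "of_real ((M2 / S - \<Lambda> * S) * harm_amp l m \<theta>) * (E * K) = of_real (M2 / S - \<Lambda> * S) * Z"
    by (simp add: Z_def harm_block_def E_def mult_ac)
  have L: "S\<^sup>2 * laplace_coords (\<lambda>\<theta> \<phi>. g (\<theta>, \<phi>)) \<theta> \<phi> = S * X1 + X2"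
    unfolding laplace_coords_def X1_def[symmetric] X2_def[symmetric] S_def[symmetric]
    using S by (simp add: field_simps power2_eq_square)
  have "of_real S * (of_real X1 * Z - of_real gg * (of_real (M2 / S - \<Lambda> * S) * Z))
      + (of_real X2 * Z - of_real gg * (- of_real M2 * Z))
    = of_real ((S * X1 + X2) - gg * (S * (M2 / S - \<Lambda> * S)) + gg * M2) * Z"
    by (simp add: algebra_simps)
  also have "(S * X1 + X2) - gg * (S * (M2 / S - \<Lambda> * S)) + gg * M2 = S\<^sup>2 * (laplace_coords (\<lambda>\<theta> \<phi>. g (\<theta>, \<phi>)) \<theta> \<phi> + \<Lambda> * gg)"
    unfolding distrib_left L using S by (simp add: field_simps power2_eq_square)
  finally show ?thesis
    using W1 W2 unfolding sq M2_def[symmetric] S_def[symmetric] \<Lambda>_def[symmetric] amp Z_def[symmetric] gg_def[symmetric]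
    by (intro that) (simp_all only: S_def Z_def gg_def \<Lambda>_def)
qed

lemma has_vector_derivative_shift_0:
  assumes "(W has_vector_derivative d) (at a)"
  shows "((\<lambda>s. W (a + s)) has_vector_derivative d) (at 0)"
proof -
  have "((\<lambda>s. a + s) has_derivative (\<lambda>s. s)) (at (0::real))" by (auto intro!: derivative_eq_intros)
  from diff_chain_at[OF this, of W "\<lambda>s. s *\<^sub>R d"] assms show ?thesis
    by (simp add: has_vector_derivative_def o_def)
qed

section \<open>Divergence argument in the four coordinates of a pair of points\<close>

abbreviation (input) "ef1 \<equiv> (((1, 0), 0) :: (real \<times> real) \<times> (real \<times> real))"
abbreviation (input) "ef2 \<equiv> (((0, 1), 0) :: (real \<times> real) \<times> (real \<times> real))"
abbreviation (input) "es1 \<equiv> ((0, (1, 0)) :: (real \<times> real) \<times> (real \<times> real))"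
abbreviation (input) "es2 \<equiv> ((0, (0, 1)) :: (real \<times> real) \<times> (real \<times> real))"

lemma Basis_chart_pairs: "(Basis :: ((real \<times> real) \<times> (real \<times> real)) set) = {ef1, ef2, es1, es2}"
  by (auto simp: Basis_prod_def zero_prod_def)

lemma sum_Basis_chart_pairs: "(\<Sum>i\<in>Basis. g i) = (g ef1 + g ef2) + (g es1 + g es2)"
  unfolding Basis_chart_pairs by (simp add: zero_prod_def add.assoc)

lemma face_difference_chart_pairs:
  "face_difference ((a1, b1), (a2, b2)) ((c1, d1), (c2, d2)) ef1 g ((x, y), s) = g ((c1, y), s) - g ((a1, y), s)"
  "face_difference ((a1, b1), (a2, b2)) ((c1, d1), (c2, d2)) ef2 g ((x, y), s) = g ((x, d1), s) - g ((x, b1), s)"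
  "face_difference ((a1, b1), (a2, b2)) ((c1, d1), (c2, d2)) es1 g (s, (x, y)) = g (s, (c2, y)) - g (s, (a2, y))"
  "face_difference ((a1, b1), (a2, b2)) ((c1, d1), (c2, d2)) es2 g (s, (x, y)) = g (s, (x, d2)) - g (s, (x, b2))"
  by (cases s; simp add: face_difference_def zero_prod_def)+

lemma exp_int_periodic: "exp (\<i> * of_int m * of_real (2 * pi)) = 1" "exp (- (\<i> * of_int m) * of_real (2 * pi)) = 1"
  using exp_integer_2pi[of "of_int m"] exp_integer_2pi[of "of_int (- m)"] by (simp_all add: mult_ac)

lemma chart_periodic:
  "chart (\<theta>, 2 * pi) = chart (\<theta>, 0)" "tangent_longi (\<theta>, 2 * pi) = tangent_longi (\<theta>, 0)"
  by (simp_all add: sph_point_eq_axis tangent_longi_def)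

text \<open>The field V is sin \<theta>2 times the Green field of the first point minus sin
  \<theta>1 times that of the second. Its divergence is sin \<theta>1 sin \<theta>2 Y Z times the
  difference of the two Laplacians plus \<Lambda> C; the difference is 0, which leaves the
  continuous function \<open>h\<close>. With the sines as area elements, the integral of
  \<open>h\<close> is \<Lambda> times a spectral coefficient.\<close>

lemma laplace_beltrami_degree_diagonal:
  assumes ef: "expanded_field M T" and td: "twice_differentiable_sphere (cov_fun M T)"
    and LB: "\<And>x y. x \<in> S2 \<Longrightarrow> y \<in> S2 \<Longrightarrow>
      laplace_beltrami (\<lambda>z. cov_fun M T z y) x = laplace_beltrami (\<lambda>z. cov_fun M T x z) y"
    and m: "m \<in> {- int l..int l}" and n: "n \<in> {- int k..int k}" and lk: "l \<noteq> k"
  shows "spectrum M T k l n m = 0"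
proof -
  interpret expanded_field M T by fact
  \<comment> \<open>Opposite signs, because Z is the conjugate of a harmonic while Y is not.\<close>
  define \<sigma> where "\<sigma> = \<i> * complex_of_int m"
  define \<tau> where "\<tau> = - (\<i> * complex_of_int n)"
  have \<sigma>\<tau>: "\<sigma> * \<sigma> = - of_real ((real_of_int m)\<^sup>2)" "\<tau> * \<tau> = - of_real ((real_of_int n)\<^sup>2)"
    by (simp_all add: \<sigma>_def \<tau>_def power2_eq_square algebra_simps)
  define \<Lambda> where "\<Lambda> = real l * (real l + 1) - real k * (real k + 1)"
  have \<Lambda>: "\<Lambda> \<noteq> 0"
  proof -
    have "\<Lambda> = (real l - real k) * (real l + real k + 1)" by (simp add: \<Lambda>_def algebra_simps)
    moreover have "real l + real k + 1 \<noteq> 0" by linarith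
    ultimately show ?thesis using lk by simp
  qed
  define Y where "Y = harm_block l m \<sigma>"
  define Z where "Z = harm_block k n \<tau>"
  define Yc where "Yc = harm_block_colat l m \<sigma>"
  define Zc where "Zc = harm_block_colat k n \<tau>"
  define f where "f t = C (chart (fst t)) (chart (snd t))" for t :: "(real \<times> real) \<times> (real \<times> real)"
  let ?W = "(- {0 :: real ^ 3}) \<times> (- {0 :: real ^ 3})"
  let ?G = "\<lambda>z. C (sgn (fst z)) (sgn (snd z))"
  obtain G' :: "(real ^ 3) \<times> (real ^ 3) \<Rightarrow> ((real ^ 3) \<times> (real ^ 3)) \<Rightarrow>\<^sub>L real" where
    G': "\<And>z. z \<in> ?W \<Longrightarrow> (?G has_derivative blinfun_apply (G' z)) (at z)" "\<And>z. z \<in> ?W \<Longrightarrow> G' differentiable (at z)"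
    using td unfolding twice_differentiable_sphere_def twice_differentiable_on_def case_prod_unfold by blast
  define P where "P t = (chart (fst t), chart (snd t))" for t :: "(real \<times> real) \<times> (real \<times> real)"
  have chart0: "chart s \<noteq> 0" for s using norm_sph_point[of "fst s" "snd s"] by (metis norm_zero zero_neq_one)
  have PW: "P t \<in> ?W" for t using chart0 by (simp add: P_def)
  have fG: "f t = ?G (P t)" for t by (simp add: f_def P_def sgn_div_norm)
  have dP: "P differentiable (at t)" for t
    unfolding P_def[abs_def] by (intro differentiable_Pair differentiable_fst_snd differentiable_snd differentiable_chart)
  have dGP: "(\<lambda>t. G' (P t)) differentiable (at t)" for t
    by (rule differentiable_compose_at[OF dP G'(2)[OF PW]])
  have df: "f differentiable (at t)" for t
  proof -
    have "?G differentiable (at (P t))" using G'(1)[OF PW] unfolding differentiable_def by blast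
    from differentiable_compose_at[OF dP this] show ?thesis unfolding fG[abs_def] .
  qed
  define D1 where "D1 t = G' (P t) (tangent_colat (fst t), 0)" for t
  define D2 where "D2 t = G' (P t) (tangent_longi (fst t), 0)" for t
  define D3 where "D3 t = G' (P t) (0, tangent_colat (snd t))" for t
  define D4 where "D4 t = G' (P t) (0, tangent_longi (snd t))" for t
  have dD: "D1 differentiable (at t)" "D2 differentiable (at t)" "D3 differentiable (at t)" "D4 differentiable (at t)" for t
    unfolding D1_def[abs_def] D2_def[abs_def] D3_def[abs_def] D4_def[abs_def]
    by (intro differentiable_blinfun_apply dGP differentiable_Pair differentiable_fst_snd differentiable_snd
        differentiable_chart differentiable_const)+
  have chain: "((\<lambda>u. f (c u)) has_real_derivative G' (P (c u)) p') (at u)"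
    if "((\<lambda>u. P (c u)) has_vector_derivative p') (at u)" for c p' u
    using diff_chain_at[OF that[unfolded has_vector_derivative_def] G'(1)[OF PW]]
    by (intro has_real_derivativeI) (simp add: o_def fG blinfun.scaleR_right)
  have pd: "((\<lambda>u. f ((u, \<phi>), s)) has_real_derivative D1 ((u, \<phi>), s)) (at u)"
    "((\<lambda>u. f ((\<phi>, u), s)) has_real_derivative D2 ((\<phi>, u), s)) (at u)"
    "((\<lambda>u. f (s, (u, \<phi>))) has_real_derivative D3 (s, (u, \<phi>))) (at u)"
    "((\<lambda>u. f (s, (\<phi>, u))) has_real_derivative D4 (s, (\<phi>, u))) (at u)" for u \<phi> s
    unfolding D1_def D2_def D3_def D4_def
    by (rule chain, (unfold P_def fst_conv snd_conv)[1],
        (rule has_vector_derivative_Pair chart_derivatives has_vector_derivative_const)+)+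
  have line: "(\<lambda>u. F ((u, \<phi>), s)) differentiable (at u)" "(\<lambda>u. F ((\<phi>, u), s)) differentiable (at u)"
    "(\<lambda>u. F (s, (u, \<phi>))) differentiable (at u)" "(\<lambda>u. F (s, (\<phi>, u))) differentiable (at u)"
    if "\<And>t. F differentiable (at t)" for F :: "(real \<times> real) \<times> (real \<times> real) \<Rightarrow> real" and u \<phi> s
    by (rule differentiable_compose_at[OF _ that], intro differentiable_Pair differentiable_const differentiable_ident)+
  define U1 where "U1 t = of_real (D1 t) * (Y (fst t) * Z (snd t)) - of_real (f t) * (Yc (fst t) * Z (snd t))" for t
  define U2 where "U2 t = of_real (D2 t) * (Y (fst t) * Z (snd t)) - of_real (f t) * (\<sigma> * Y (fst t) * Z (snd t))" for t
  define U3 where "U3 t = of_real (D3 t) * (Z (snd t) * Y (fst t)) - of_real (f t) * (Zc (snd t) * Y (fst t))" for t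
  define U4 where "U4 t = of_real (D4 t) * (Z (snd t) * Y (fst t)) - of_real (f t) * (\<tau> * Z (snd t) * Y (fst t))" for t
  have dYZ: "(\<lambda>t. Y (fst t)) differentiable (at t)" "(\<lambda>t. Z (snd t)) differentiable (at t)"
    "(\<lambda>t. Yc (fst t)) differentiable (at t)" "(\<lambda>t. Zc (snd t)) differentiable (at t)" for t
    unfolding Y_def Z_def Yc_def Zc_def
    by (intro differentiable_fst_snd differentiable_snd differentiable_harm_block)+
  have dU: "U1 differentiable (at t)" "U2 differentiable (at t)" "U3 differentiable (at t)" "U4 differentiable (at t)" for t
    unfolding U1_def[abs_def] U2_def[abs_def] U3_def[abs_def] U4_def[abs_def]
    by (intro differentiable_diff differentiable_mult differentiable_of_real df dD dYZ differentiable_const)+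
  define s1 where "s1 t = sin (fst (fst t))" for t :: "(real \<times> real) \<times> (real \<times> real)"
  define s2 where "s2 t = sin (fst (snd t))" for t :: "(real \<times> real) \<times> (real \<times> real)"
  have ds: "s1 differentiable (at t)" "s2 differentiable (at t)" for t
    unfolding s1_def[abs_def] s2_def[abs_def]
    by (intro differentiable_compose_at[OF differentiable_fst_fst DERIV_differentiable[OF DERIV_sin]]
        differentiable_compose_at[OF differentiable_fst_snd' DERIV_differentiable[OF DERIV_sin]])+
  define V where "V i t = (if i = ef1 then of_real (s2 t) * (of_real (s1 t) * U1 t)
      else if i = ef2 then of_real (s2 t / s1 t) * U2 t
      else if i = es1 then - (of_real (s1 t) * (of_real (s2 t) * U3 t))
      else - (of_real (s1 t / s2 t) * U4 t))" for i t
  have ne: "ef2 \<noteq> ef1" "es1 \<noteq> ef1" "es2 \<noteq> ef1" "es1 \<noteq> ef2" "es2 \<noteq> ef2" "es2 \<noteq> es1" by (simp_all add: zero_prod_def)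
  have V_eq: "V ef1 = (\<lambda>t. of_real (s2 t) * (of_real (s1 t) * U1 t))"
    "V ef2 = (\<lambda>t. of_real (s2 t / s1 t) * U2 t)"
    "V es1 = (\<lambda>t. - (of_real (s1 t) * (of_real (s2 t) * U3 t)))"
    "V es2 = (\<lambda>t. - (of_real (s1 t / s2 t) * U4 t))"
    unfolding V_def by (simp_all only: ne if_True if_False simp_thms)
  define h where "h t = of_real (s1 t * s2 t * (\<Lambda> * f t)) * (Y (fst t) * Z (snd t))" for t
  have dh: "h differentiable (at t)" for t
    unfolding h_def[abs_def]
    by (intro differentiable_mult differentiable_of_real ds df dYZ differentiable_const)
  have cont: "continuous_on A F" if "\<And>t. F differentiable (at t)"
    for A and F :: "(real \<times> real) \<times> (real \<times> real) \<Rightarrow> complex"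
    using that by (intro continuous_at_imp_continuous_on ballI differentiable_imp_continuous_within)
  let ?B = "cbox ((0, 0), (0, 0)) ((pi, 2 * pi), (pi, 2 * pi)) :: ((real \<times> real) \<times> (real \<times> real)) set"
  have bdd: "\<exists>K. \<forall>t\<in>?B. norm (F t) \<le> K" if "\<And>t. F differentiable (at t)"
    for F :: "(real \<times> real) \<times> (real \<times> real) \<Rightarrow> complex"
    using compact_imp_bounded[OF compact_continuous_image[OF cont[OF that] compact_cbox[of "((0, 0), (0, 0))" "((pi, 2 * pi), (pi, 2 * pi))"]]]
    unfolding bounded_iff by auto
  \<comment> \<open>The sine of the component's own colatitude is left out of the bounded factor: on
    the faces near the poles it is at most \<epsilon> and supplies the decay.\<close>
  have "(\<lambda>t. of_real (s2 t) * U1 t) differentiable (at t)" "(\<lambda>t. of_real (s1 t) * U3 t) differentiable (at t)" for t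
    by (intro differentiable_mult differentiable_of_real ds dU)+
  then obtain K1 K3 where K: "\<forall>t\<in>?B. norm (of_real (s2 t) * U1 t) \<le> K1" "\<forall>t\<in>?B. norm (of_real (s1 t) * U3 t) \<le> K3"
    using bdd[of "\<lambda>t. of_real (s2 t) * U1 t"] bdd[of "\<lambda>t. of_real (s1 t) * U3 t"] by blast
  obtain Kh where Kh: "\<forall>t\<in>?B. norm (h t) \<le> Kh" using bdd[OF dh] by blast
  let ?a = "\<lambda>\<epsilon>. ((\<epsilon>, 0), (\<epsilon>, 0)) :: (real \<times> real) \<times> (real \<times> real)"
  let ?b = "\<lambda>\<epsilon>. ((pi - \<epsilon>, 2 * pi), (pi - \<epsilon>, 2 * pi)) :: (real \<times> real) \<times> (real \<times> real)"
  \<comment> \<open>The longitude components contain the quotients of the two sines, so the box has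
    to stay away from the poles in both points.\<close>
  have defect: "flux_defect V h (?a \<epsilon>) (?b \<epsilon>) = 0" if \<epsilon>: "0 < \<epsilon>" "\<epsilon> < 1" for \<epsilon>
  proof -
    let ?Q = "cbox (?a \<epsilon>) (?b \<epsilon>)"
    have pi1: "\<epsilon> < pi - \<epsilon>" using \<epsilon> pi_gt3 by linarith
    have sn: "s1 t \<noteq> 0" "s2 t \<noteq> 0" if "t \<in> ?Q" for t
    proof -
      have "\<epsilon> \<le> fst (fst t)" "fst (fst t) \<le> pi - \<epsilon>" "\<epsilon> \<le> fst (snd t)" "fst (snd t) \<le> pi - \<epsilon>"
        using that by (auto simp: cbox_Pair_eq)
      then have "0 < sin (fst (fst t))" "0 < sin (fst (snd t))" using \<epsilon> by (auto intro!: sin_gt_zero)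
      then show "s1 t \<noteq> 0" "s2 t \<noteq> 0" by (simp_all add: s1_def s2_def)
    qed
    have "\<exists>D. (\<forall>i\<in>Basis. ((\<lambda>s. V i (t + s *\<^sub>R i)) has_vector_derivative D i) (at 0)) \<and> (\<Sum>i\<in>Basis. D i) = h t"
      if t: "t \<in> ?Q" for t
    proof -
      obtain \<theta>1 \<phi>1 \<theta>2 \<phi>2 where tt: "t = ((\<theta>1, \<phi>1), (\<theta>2, \<phi>2))" by (metis surj_pair)
      have S: "sin \<theta>1 \<noteq> 0" "sin \<theta>2 \<noteq> 0" using sn[OF t] by (simp_all add: tt s1_def s2_def)
      obtain d1 d2 where d12:
        "((\<lambda>u. of_real (sin u * D1 ((u, \<phi>1), (\<theta>2, \<phi>2))) * (Y (u, \<phi>1) * Z (\<theta>2, \<phi>2))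
            - of_real (f ((u, \<phi>1), (\<theta>2, \<phi>2))) * (of_real (sin u) * (Yc (u, \<phi>1) * Z (\<theta>2, \<phi>2)))) has_vector_derivative d1) (at \<theta>1)"
        "((\<lambda>u. of_real (D2 ((\<theta>1, u), (\<theta>2, \<phi>2))) * (Y (\<theta>1, u) * Z (\<theta>2, \<phi>2))
            - of_real (f ((\<theta>1, u), (\<theta>2, \<phi>2))) * (\<sigma> * Y (\<theta>1, u) * Z (\<theta>2, \<phi>2))) has_vector_derivative d2) (at \<phi>1)"
        "of_real (sin \<theta>1) * d1 + d2 = of_real ((sin \<theta>1)\<^sup>2 * (laplace_coords (\<lambda>\<theta> \<phi>. f ((\<theta>, \<phi>), (\<theta>2, \<phi>2))) \<theta>1 \<phi>1
            + real l * (real l + 1) * f ((\<theta>1, \<phi>1), (\<theta>2, \<phi>2)))) * (Y (\<theta>1, \<phi>1) * Z (\<theta>2, \<phi>2))"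
        using block_divergence[of \<theta>1 \<sigma> m "\<lambda>s. f (s, (\<theta>2, \<phi>2))" \<phi>1 "\<lambda>s. D1 (s, (\<theta>2, \<phi>2))" "\<lambda>s. D2 (s, (\<theta>2, \<phi>2))" l "Z (\<theta>2, \<phi>2)",
            OF S(1) \<sigma>\<tau>(1) pd(1) pd(2) line(1)[OF dD(1)] line(2)[OF dD(2)], folded Y_def Yc_def] .
      obtain d3 d4 where d34:
        "((\<lambda>u. of_real (sin u * D3 ((\<theta>1, \<phi>1), (u, \<phi>2))) * (Z (u, \<phi>2) * Y (\<theta>1, \<phi>1))
            - of_real (f ((\<theta>1, \<phi>1), (u, \<phi>2))) * (of_real (sin u) * (Zc (u, \<phi>2) * Y (\<theta>1, \<phi>1)))) has_vector_derivative d3) (at \<theta>2)"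
        "((\<lambda>u. of_real (D4 ((\<theta>1, \<phi>1), (\<theta>2, u))) * (Z (\<theta>2, u) * Y (\<theta>1, \<phi>1))
            - of_real (f ((\<theta>1, \<phi>1), (\<theta>2, u))) * (\<tau> * Z (\<theta>2, u) * Y (\<theta>1, \<phi>1))) has_vector_derivative d4) (at \<phi>2)"
        "of_real (sin \<theta>2) * d3 + d4 = of_real ((sin \<theta>2)\<^sup>2 * (laplace_coords (\<lambda>\<theta> \<phi>. f ((\<theta>1, \<phi>1), (\<theta>, \<phi>))) \<theta>2 \<phi>2
            + real k * (real k + 1) * f ((\<theta>1, \<phi>1), (\<theta>2, \<phi>2)))) * (Z (\<theta>2, \<phi>2) * Y (\<theta>1, \<phi>1))"
        using block_divergence[of \<theta>2 \<tau> n "\<lambda>s. f ((\<theta>1, \<phi>1), s)" \<phi>2 "\<lambda>s. D3 ((\<theta>1, \<phi>1), s)" "\<lambda>s. D4 ((\<theta>1, \<phi>1), s)" k "Y (\<theta>1, \<phi>1)",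
            OF S(2) \<sigma>\<tau>(2) pd(3) pd(4) line(3)[OF dD(3)] line(4)[OF dD(4)], folded Z_def Zc_def] .
      define S1 S2 x where "S1 = sin \<theta>1" and "S2 = sin \<theta>2" and "x = Y (\<theta>1, \<phi>1) * Z (\<theta>2, \<phi>2)"
      have e1: "((\<lambda>s. V ef1 (t + s *\<^sub>R ef1)) has_vector_derivative of_real S2 * d1) (at 0)"
        using has_vector_derivative_shift_0[OF has_vector_derivative_mult_right[OF d12(1), of "of_real S2"]]
        unfolding V_eq tt by (simp add: s1_def s2_def S2_def U1_def zero_prod_def algebra_simps)
      have e2: "((\<lambda>s. V ef2 (t + s *\<^sub>R ef2)) has_vector_derivative of_real (S2 / S1) * d2) (at 0)"
        using has_vector_derivative_shift_0[OF has_vector_derivative_mult_right[OF d12(2), of "of_real (S2 / S1)"]]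
        unfolding V_eq tt by (simp add: s1_def s2_def S1_def S2_def U2_def zero_prod_def)
      have e3: "((\<lambda>s. V es1 (t + s *\<^sub>R es1)) has_vector_derivative - (of_real S1 * d3)) (at 0)"
        using has_vector_derivative_minus[OF has_vector_derivative_shift_0[OF has_vector_derivative_mult_right[OF d34(1), of "of_real S1"]]]
        unfolding V_eq tt by (simp add: s1_def s2_def S1_def U3_def zero_prod_def algebra_simps)
      have e4: "((\<lambda>s. V es2 (t + s *\<^sub>R es2)) has_vector_derivative - (of_real (S1 / S2) * d4)) (at 0)"
        using has_vector_derivative_minus[OF has_vector_derivative_shift_0[OF has_vector_derivative_mult_right[OF d34(2), of "of_real (S1 / S2)"]]]
        unfolding V_eq tt by (simp add: s1_def s2_def S1_def S2_def U4_def zero_prod_def)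
      define lap where "lap = laplace_beltrami (\<lambda>z. C z (sph_point \<theta>2 \<phi>2)) (sph_point \<theta>1 \<phi>1)"
      have lap1: "laplace_coords (\<lambda>\<theta> \<phi>. f ((\<theta>, \<phi>), (\<theta>2, \<phi>2))) \<theta>1 \<phi>1 = lap"
      proof -
        obtain F' F'' where "ray_extension (\<lambda>z. C z (sph_point \<theta>2 \<phi>2)) (\<lambda>z. C (sgn z) (sph_point \<theta>2 \<phi>2)) F' F''"
          using ray_extension_exists[OF twice_differentiable_slice(1)[OF td sph_point_in_S2]] by blast
        from ray_extension.laplace_coords_eq_beltrami[OF this S(1)] show ?thesis by (simp add: lap_def f_def)
      qed
      \<comment> \<open>Here the hypothesis on the two operators enters: both coordinate Laplacians
        have the value \<open>lap\<close>.\<close>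
      have lap2: "laplace_coords (\<lambda>\<theta> \<phi>. f ((\<theta>1, \<phi>1), (\<theta>, \<phi>))) \<theta>2 \<phi>2 = lap"
      proof -
        obtain F' F'' where "ray_extension (\<lambda>z. C (sph_point \<theta>1 \<phi>1) z) (\<lambda>z. C (sph_point \<theta>1 \<phi>1) (sgn z)) F' F''"
          using ray_extension_exists[OF twice_differentiable_slice(2)[OF td sph_point_in_S2]] by blast
        from ray_extension.laplace_coords_eq_beltrami[OF this S(2)] show ?thesis
          using LB[OF sph_point_in_S2[of \<theta>1 \<phi>1] sph_point_in_S2[of \<theta>2 \<phi>2]] by (simp add: lap_def f_def)
      qed
      have sum: "(of_real S2 * d1 + of_real (S2 / S1) * d2) + (- (of_real S1 * d3) + - (of_real (S1 / S2) * d4)) = h t"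
      proof -
        have "of_real S2 * d1 + of_real (S2 / S1) * d2 = of_real (S2 / S1) * (of_real S1 * d1 + d2)"
          using S by (simp add: S1_def[symmetric] S2_def[symmetric] field_simps)
        also have "\<dots> = of_real (S2 / S1 * (S1\<^sup>2 * (lap + real l * (real l + 1) * f t))) * x"
          using d12(3) unfolding lap1 by (simp add: S1_def S2_def x_def tt)
        also have "S2 / S1 * (S1\<^sup>2 * (lap + real l * (real l + 1) * f t)) = S1 * S2 * (lap + real l * (real l + 1) * f t)"
          using S by (simp add: S1_def[symmetric] S2_def[symmetric] field_simps power2_eq_square)
        finally have a: "of_real S2 * d1 + of_real (S2 / S1) * d2 = of_real (S1 * S2 * (lap + real l * (real l + 1) * f t)) * x" .
        have "of_real S1 * d3 + of_real (S1 / S2) * d4 = of_real (S1 / S2) * (of_real S2 * d3 + d4)"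
          using S by (simp add: S1_def[symmetric] S2_def[symmetric] field_simps)
        also have "\<dots> = of_real (S1 / S2 * (S2\<^sup>2 * (lap + real k * (real k + 1) * f t))) * x"
          using d34(3) unfolding lap2 by (simp add: S1_def S2_def x_def tt mult.commute[of "Z _"])
        also have "S1 / S2 * (S2\<^sup>2 * (lap + real k * (real k + 1) * f t)) = S1 * S2 * (lap + real k * (real k + 1) * f t)"
          using S by (simp add: S1_def[symmetric] S2_def[symmetric] field_simps power2_eq_square)
        finally have b: "of_real S1 * d3 + of_real (S1 / S2) * d4 = of_real (S1 * S2 * (lap + real k * (real k + 1) * f t)) * x" .
        have "h t = of_real (S1 * S2 * (lap + real l * (real l + 1) * f t)) * x - of_real (S1 * S2 * (lap + real k * (real k + 1) * f t)) * x"
          by (simp add: h_def tt s1_def s2_def S1_def S2_def x_def \<Lambda>_def algebra_simps)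
        then show ?thesis unfolding a[symmetric] b[symmetric] by simp
      qed
      define D where "D i = (if i = ef1 then of_real S2 * d1 else if i = ef2 then of_real (S2 / S1) * d2
          else if i = es1 then - (of_real S1 * d3) else - (of_real (S1 / S2) * d4))" for i
      have D_eq: "D ef1 = of_real S2 * d1" "D ef2 = of_real (S2 / S1) * d2"
        "D es1 = - (of_real S1 * d3)" "D es2 = - (of_real (S1 / S2) * d4)"
        unfolding D_def by (simp_all only: ne if_True if_False simp_thms)
      have "(\<Sum>i\<in>Basis. D i) = h t" unfolding sum_Basis_chart_pairs D_eq by (rule sum)
      moreover have "((\<lambda>s. V i (t + s *\<^sub>R i)) has_vector_derivative D i) (at 0)" if "i \<in> Basis" for i
        using that unfolding Basis_chart_pairs by (elim insertE emptyE; simp only: D_eq e1 e2 e3 e4)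
      ultimately show ?thesis by blast
    qed
    then have "\<forall>t\<in>?Q. \<exists>D. (\<forall>i\<in>Basis. ((\<lambda>s. V i (t + s *\<^sub>R i)) has_vector_derivative D i) (at 0)) \<and> (\<Sum>i\<in>Basis. D i) = h t"
      by blast
    from bchoice[OF this] obtain D where
      D: "\<forall>t\<in>?Q. (\<forall>i\<in>Basis. ((\<lambda>s. V i (t + s *\<^sub>R i)) has_vector_derivative D t i) (at 0)) \<and> (\<Sum>i\<in>Basis. D t i) = h t" ..
    show ?thesis
    proof (rule flux_defect_eq_0_partial[where d = "\<lambda>i t. D t i"])
      show "?a \<epsilon> \<bullet> i < ?b \<epsilon> \<bullet> i" if "i \<in> Basis" for i
        using that pi1 unfolding Basis_chart_pairs by (auto simp: zero_prod_def)
      show "continuous_on ?Q h" by (rule cont[OF dh])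
      fix i z :: "(real \<times> real) \<times> (real \<times> real)" assume iz: "i \<in> Basis" "z \<in> ?Q"
      note sn' = sn[OF iz(2)]
      have dq: "(\<lambda>t. s2 t / s1 t) differentiable (at z)" "(\<lambda>t. s1 t / s2 t) differentiable (at z)"
        by (intro differentiable_divide ds sn')+
      show "V i differentiable (at z)"
        using iz(1) unfolding Basis_chart_pairs
        by (elim insertE emptyE; simp only: V_eq)
          (intro differentiable_mult differentiable_minus differentiable_of_real ds dU dq)+
      show "((\<lambda>s. V i (z + s *\<^sub>R i)) has_vector_derivative D z i) (at 0)"
        using bspec[OF D iz(2)] iz(1) by blast
    next
      fix z assume "z \<in> ?Q"
      then show "(\<Sum>i\<in>Basis. D z i) = h z" using D by blast
    qed
  qed
  define vol where "vol = measure lborel ?B"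
  have small: "norm (integral (cbox (?a \<epsilon>) (?b \<epsilon>)) h) \<le> (2 * (K1 + K3) * vol) * \<epsilon>" if \<epsilon>: "0 < \<epsilon>" "\<epsilon> < 1" for \<epsilon>
  proof -
    let ?Q = "cbox (?a \<epsilon>) (?b \<epsilon>)"
    \<comment> \<open>With \<epsilon> below 1 and pi above 3 the colatitude edges have length at
      least 1, so their reciprocal, the weight \<open>w\<close>, is at most 1.\<close>
    have pi1: "1 \<le> pi - \<epsilon> - \<epsilon>" using \<epsilon> pi_gt3 by linarith
    have QB: "?Q \<subseteq> ?B" using \<epsilon> by (auto simp: cbox_Pair_eq)
    have vol: "measure lborel ?Q \<le> vol" unfolding vol_def
      by (rule content_subset[OF QB])
    have sin_eps: "\<bar>sin \<epsilon>\<bar> \<le> \<epsilon>" "\<bar>sin (pi - \<epsilon>)\<bar> \<le> \<epsilon>"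
      using abs_sin_x_le_abs_x[of \<epsilon>] \<epsilon> by (simp_all add: sin_diff)
    have K0: "0 \<le> K1" "0 \<le> K3"
    proof -
      have "((0, 0), (0, 0)) \<in> ?B" by (auto simp: cbox_Pair_eq)
      then show "0 \<le> K1" "0 \<le> K3" using K norm_ge_zero order_trans by blast+
    qed
    have face: "norm (integral ?Q g) \<le> (2 * \<epsilon> * L) * vol" if g: "\<And>t. t \<in> ?Q \<Longrightarrow> norm (g t) \<le> 2 * \<epsilon> * L" and L: "0 \<le> L"
      for g :: "(real \<times> real) \<times> (real \<times> real) \<Rightarrow> complex" and L
    \<comment> \<open>A function that is not integrable has integral 0 by convention, so the bound
      covers both cases.\<close>
    proof (cases "g integrable_on ?Q")
      case True
      have "0 \<le> 2 * \<epsilon> * L" using \<epsilon> L by simp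
      have "norm (integral ?Q g) \<le> (2 * \<epsilon> * L) * measure lborel ?Q"
        by (rule has_integral_bound[OF \<open>0 \<le> 2 * \<epsilon> * L\<close> integrable_integral[OF True] g])
      also have "\<dots> \<le> (2 * \<epsilon> * L) * vol" using vol \<open>0 \<le> 2 * \<epsilon> * L\<close> by (rule mult_left_mono)
      finally show ?thesis .
    next
      case False
      have "0 \<le> vol" by (simp add: vol_def)
      then show ?thesis using \<epsilon> L by (simp add: not_integrable_integral[OF False])
    qed
    have F1: "norm (face_difference (?a \<epsilon>) (?b \<epsilon>) ef1 (V ef1) t) \<le> 2 * \<epsilon> * K1" if t: "t \<in> ?Q" for t
    proof -
      obtain \<theta>1 \<phi>1 s where tt: "t = ((\<theta>1, \<phi>1), s)" by (metis surj_pair)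
      have b: "norm (V ef1 ((\<theta>, \<phi>1), s)) \<le> \<epsilon> * K1" if "\<theta> = \<epsilon> \<or> \<theta> = pi - \<epsilon>" for \<theta>
      proof -
        have inB: "((\<theta>, \<phi>1), s) \<in> ?B" using that t QB \<epsilon> pi1 by (auto simp: tt cbox_Pair_eq)
        have "V ef1 ((\<theta>, \<phi>1), s) = of_real (sin \<theta>) * (of_real (s2 ((\<theta>, \<phi>1), s)) * U1 ((\<theta>, \<phi>1), s))"
          by (simp add: V_eq s1_def)
        then have "norm (V ef1 ((\<theta>, \<phi>1), s)) = \<bar>sin \<theta>\<bar> * norm (of_real (s2 ((\<theta>, \<phi>1), s)) * U1 ((\<theta>, \<phi>1), s))"
          by (simp only: norm_mult norm_of_real)
        also have "\<dots> \<le> \<epsilon> * K1" using that sin_eps bspec[OF K(1) inB] \<epsilon> by (intro mult_mono) auto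
        finally show ?thesis .
      qed
      have "face_difference (?a \<epsilon>) (?b \<epsilon>) ef1 (V ef1) t = V ef1 ((pi - \<epsilon>, \<phi>1), s) - V ef1 ((\<epsilon>, \<phi>1), s)"
        by (simp only: tt face_difference_chart_pairs)
      then have "norm (face_difference (?a \<epsilon>) (?b \<epsilon>) ef1 (V ef1) t) \<le> norm (V ef1 ((pi - \<epsilon>, \<phi>1), s)) + norm (V ef1 ((\<epsilon>, \<phi>1), s))"
        by (simp only: norm_triangle_ineq4)
      then show ?thesis using b[of \<epsilon>] b[of "pi - \<epsilon>"] by simp
    qed
    have F3: "norm (face_difference (?a \<epsilon>) (?b \<epsilon>) es1 (V es1) t) \<le> 2 * \<epsilon> * K3" if t: "t \<in> ?Q" for t
    proof -
      obtain \<theta>1 \<phi>1 s where tt: "t = (s, (\<theta>1, \<phi>1))" by (metis surj_pair)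
      have b: "norm (V es1 (s, (\<theta>, \<phi>1))) \<le> \<epsilon> * K3" if "\<theta> = \<epsilon> \<or> \<theta> = pi - \<epsilon>" for \<theta>
      proof -
        have inB: "(s, (\<theta>, \<phi>1)) \<in> ?B" using that t QB \<epsilon> pi1 by (auto simp: tt cbox_Pair_eq)
        have "V es1 (s, (\<theta>, \<phi>1)) = - (of_real (sin \<theta>) * (of_real (s1 (s, (\<theta>, \<phi>1))) * U3 (s, (\<theta>, \<phi>1))))"
          by (simp add: V_eq s2_def)
        then have "norm (V es1 (s, (\<theta>, \<phi>1))) = \<bar>sin \<theta>\<bar> * norm (of_real (s1 (s, (\<theta>, \<phi>1))) * U3 (s, (\<theta>, \<phi>1)))"
          by (simp only: norm_minus_cancel norm_mult norm_of_real)
        also have "\<dots> \<le> \<epsilon> * K3" using that sin_eps bspec[OF K(2) inB] \<epsilon> by (intro mult_mono) auto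
        finally show ?thesis .
      qed
      have "face_difference (?a \<epsilon>) (?b \<epsilon>) es1 (V es1) t = V es1 (s, (pi - \<epsilon>, \<phi>1)) - V es1 (s, (\<epsilon>, \<phi>1))"
        by (simp only: tt face_difference_chart_pairs)
      then have "norm (face_difference (?a \<epsilon>) (?b \<epsilon>) es1 (V es1) t) \<le> norm (V es1 (s, (pi - \<epsilon>, \<phi>1))) + norm (V es1 (s, (\<epsilon>, \<phi>1)))"
        by (simp only: norm_triangle_ineq4)
      then show ?thesis using b[of \<epsilon>] b[of "pi - \<epsilon>"] by simp
    qed
    \<comment> \<open>The faces at longitude 0 and 2 pi carry equal values by periodicity of the
      chart, of its tangent vector and of the exponential with integer frequency.\<close>
    have F2: "face_difference (?a \<epsilon>) (?b \<epsilon>) ef2 (V ef2) = (\<lambda>t. 0)"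
    proof
      fix t :: "(real \<times> real) \<times> (real \<times> real)"
      obtain \<theta>1 \<phi>1 s where tt: "t = ((\<theta>1, \<phi>1), s)" by (metis surj_pair)
      have "Y (\<theta>1, 2 * pi) = Y (\<theta>1, 0)"
        using exp_int_periodic(1)[of m] by (simp add: Y_def harm_block_def \<sigma>_def)
      then have "V ef2 ((\<theta>1, 2 * pi), s) = V ef2 ((\<theta>1, 0), s)"
        using chart_periodic[of \<theta>1] by (simp add: V_eq s1_def s2_def U2_def D2_def P_def f_def)
      then show "face_difference (?a \<epsilon>) (?b \<epsilon>) ef2 (V ef2) t = 0"
        by (simp only: tt face_difference_chart_pairs diff_self)
    qed
    have F4: "face_difference (?a \<epsilon>) (?b \<epsilon>) es2 (V es2) = (\<lambda>t. 0)"
    proof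
      fix t :: "(real \<times> real) \<times> (real \<times> real)"
      obtain \<theta>1 \<phi>1 s where tt: "t = (s, (\<theta>1, \<phi>1))" by (metis surj_pair)
      have "Z (\<theta>1, 2 * pi) = Z (\<theta>1, 0)"
        using exp_int_periodic(2)[of n] by (simp add: Z_def harm_block_def \<tau>_def)
      then have "V es2 (s, (\<theta>1, 2 * pi)) = V es2 (s, (\<theta>1, 0))"
        using chart_periodic[of \<theta>1] by (simp add: V_eq s1_def s2_def U4_def D4_def P_def f_def)
      then show "face_difference (?a \<epsilon>) (?b \<epsilon>) es2 (V es2) t = 0"
        by (simp only: tt face_difference_chart_pairs diff_self)
    qed
    define w where "w = 1 / (pi - \<epsilon> - \<epsilon>)"
    have w: "0 \<le> w" "w \<le> 1" using pi1 by (simp_all add: w_def)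
    let ?I1 = "integral ?Q (face_difference (?a \<epsilon>) (?b \<epsilon>) ef1 (V ef1))"
    let ?I3 = "integral ?Q (face_difference (?a \<epsilon>) (?b \<epsilon>) es1 (V es1))"
    have "integral ?Q h = w *\<^sub>R ?I1 + w *\<^sub>R ?I3"
      using defect[OF \<epsilon>] unfolding flux_defect_def sum_Basis_chart_pairs F2 F4
      by (simp add: w_def zero_prod_def)
    then have "norm (integral ?Q h) \<le> w * norm ?I1 + w * norm ?I3"
      using norm_triangle_ineq[of "w *\<^sub>R ?I1" "w *\<^sub>R ?I3"] w by simp
    also have "\<dots> \<le> 1 * ((2 * \<epsilon> * K1) * vol) + 1 * ((2 * \<epsilon> * K3) * vol)"
      using w by (intro add_mono mult_mono face F1 F3 K0) auto
    finally show ?thesis by (simp add: algebra_simps)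
  qed
  have "integral ?B h = 0"
  proof -
    \<comment> \<open>The offset 2 makes e j at most 1/2, so that \<open>small\<close> applies from
      j = 0 on.\<close>
    define e where "e j = 1 / (real j + 2)" for j :: nat
    have e: "0 < e j" "e j < 1" for j by (simp_all add: e_def)
    have e0: "e \<longlonglongrightarrow> 0"
      using LIMSEQ_ignore_initial_segment[OF lim_1_over_n[where ?'a = real], of 2] by (simp add: e_def[abs_def] add.commute)
    let ?Q = "\<lambda>j. cbox (?a (e j)) (?b (e j))"
    let ?h = "\<lambda>j t. if t \<in> ?Q j then h t else 0"
    have QB: "?Q j \<subseteq> ?B" for j using e[of j] by (auto simp: cbox_Pair_eq)
    have hQ: "integral ?B (?h j) = integral (?Q j) h" for j unfolding Henstock_Kurzweil_Integration.integral_restrict_Int Int_absorb2[OF QB] ..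
    have "(\<lambda>j. integral ?B (?h j)) \<longlonglongrightarrow> integral ?B h"
    proof (rule dominated_convergence(2)[where h = "\<lambda>_. Kh"])
      show "?h j integrable_on ?B" for j
        unfolding Henstock_Kurzweil_Integration.integrable_restrict_Int Int_absorb2[OF QB] by (intro integrable_continuous cont dh)
      show "(\<lambda>_. Kh) integrable_on ?B" by (rule Henstock_Kurzweil_Integration.integrable_const)
      fix j t assume t: "t \<in> ?B"
      show "norm (?h j t) \<le> Kh" using bspec[OF Kh t] order_trans[OF norm_ge_zero bspec[OF Kh t]] by simp
    next
      fix t assume t: "t \<in> ?B"
      obtain \<theta>1 \<phi>1 \<theta>2 \<phi>2 where tt: "t = ((\<theta>1, \<phi>1), (\<theta>2, \<phi>2))" by (metis surj_pair)
      have r: "0 \<le> \<theta>1" "\<theta>1 \<le> pi" "0 \<le> \<theta>2" "\<theta>2 \<le> pi" "0 \<le> \<phi>1" "\<phi>1 \<le> 2 * pi" "0 \<le> \<phi>2" "\<phi>2 \<le> 2 * pi"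
        using t by (auto simp: tt cbox_Pair_eq)
      show "(\<lambda>j. ?h j t) \<longlonglongrightarrow> h t"
      proof (cases "0 < \<theta>1 \<and> \<theta>1 < pi \<and> 0 < \<theta>2 \<and> \<theta>2 < pi")
        case True
        define c where "c = min (min \<theta>1 (pi - \<theta>1)) (min \<theta>2 (pi - \<theta>2))"
        have "0 < c" using True by (simp add: c_def)
        then have "eventually (\<lambda>j. e j < c) sequentially" using order_tendstoD(2)[OF e0] by blast
        then have "eventually (\<lambda>j. ?h j t = h t) sequentially"
        proof eventually_elim
          case (elim j)
          then have "t \<in> ?Q j" using r by (auto simp: tt cbox_Pair_eq c_def)
          then show ?case by simp
        qed
        then show ?thesis by (rule tendsto_eventually)
      next
        case False
        \<comment> \<open>On the part of the boundary that no smaller box reaches, h itself is 0, so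
          the truncations converge at every point.\<close>
        then have "\<theta>1 = 0 \<or> \<theta>1 = pi \<or> \<theta>2 = 0 \<or> \<theta>2 = pi" using r by linarith
        then have "h t = 0" by (auto simp: h_def tt s1_def s2_def)
        then have "(\<lambda>j. ?h j t) = (\<lambda>_. h t)" by auto
        then show ?thesis by simp
      qed
    qed
    moreover have "(\<lambda>j. integral ?B (?h j)) \<longlonglongrightarrow> 0"
    proof (rule Lim_null_comparison)
      show "eventually (\<lambda>j. norm (integral ?B (?h j)) \<le> (2 * (K1 + K3) * vol) * e j) sequentially"
        unfolding hQ by (intro always_eventually allI small e)
      show "(\<lambda>j. (2 * (K1 + K3) * vol) * e j) \<longlonglongrightarrow> 0" by (rule tendsto_mult_right_zero[OF e0])
    qed
    ultimately show ?thesis by (rule LIMSEQ_unique)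
  qed
  \<comment> \<open>The spectral integral carries the conjugated harmonic in the first argument of
    C, whereas Z sits at the second point; the symmetry of C matches the two.\<close>
  moreover have "integral ?B h = of_real \<Lambda> * spectrum M T k l n m"
  proof -
    let ?q = "cbox (0, 0) (pi, 2 * pi) :: (real \<times> real) set"
    have YZ: "Y s = sph_harm_at l m (chart s)" "Z s = cnj (sph_harm_at k n (chart s))" if "s \<in> ?q" for s
    proof -
      have "fst s \<in> {0..pi}" using that by (cases s) (auto simp: cbox_Pair_eq)
      then show "Y s = sph_harm_at l m (chart s)" "Z s = cnj (sph_harm_at k n (chart s))"
        by (simp_all only: sph_harm_at_sph_point[OF _ m] sph_harm_at_sph_point[OF _ n] sph_harm_eq_amp[OF _ m] sph_harm_eq_amp[OF _ n])
          (simp_all add: Y_def Z_def harm_block_def \<sigma>_def \<tau>_def exp_cnj mult.commute)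
    qed
    have cx: "continuous_on S2 (\<lambda>x. of_real (C x y) * cnj (sph_harm_at k n x))" if "y \<in> S2" for y
      by (intro continuous_intros continuous_on_cov_left[OF that] continuous_on_sph_harm_at[OF n])
    have cy: "continuous_on S2 (\<lambda>y. (\<integral>x. of_real (C x y) * cnj (sph_harm_at k n x) \<partial>surface_measure) * sph_harm_at l m y)"
    proof (intro continuous_on_mult continuous_on_sph_harm_at[OF m] continuous_on_surface_integral)
      have "continuous_on (S2 \<times> S2) (\<lambda>z. complex_of_real (case z of (x, y) \<Rightarrow> C x y) * cnj (sph_harm_at k n (fst z)))"
        by (intro continuous_intros continuous_on_cov continuous_on_compose2[OF continuous_on_sph_harm_at[OF n]]) auto
      then show "continuous_on (S2 \<times> S2) (\<lambda>(x, y). complex_of_real (C x y) * cnj (sph_harm_at k n x))"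
        by (simp add: case_prod_unfold)
    qed
    have "of_real \<Lambda> * spectrum M T k l n m = of_real \<Lambda> * integral ?q (\<lambda>s. of_real (sin (fst s)) *
        ((integral ?q (\<lambda>r. of_real (sin (fst r)) * (of_real (C (chart r) (chart s)) * cnj (sph_harm_at k n (chart r))))) * sph_harm_at l m (chart s)))"
      unfolding spectrum_eq_integral[OF n m] integral_surface[OF cy] integral_surface[OF cx[OF sph_point_in_S2]]
      by (simp add: case_prod_unfold scaleR_conv_of_real)
    also have "\<dots> = integral ?q (\<lambda>s. integral ?q (\<lambda>r. (of_real (\<Lambda> * sin (fst s)) * sph_harm_at l m (chart s)) *
         (of_real (sin (fst r)) * (of_real (C (chart r) (chart s)) * cnj (sph_harm_at k n (chart r))))))"
      by (simp add: mult_ac flip: Henstock_Kurzweil_Integration.integral_mult_right)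
    also have "\<dots> = integral ?q (\<lambda>s. integral ?q (\<lambda>r. h (s, r)))"
    proof (intro Henstock_Kurzweil_Integration.integral_cong)
      fix s r :: "real \<times> real" assume "s \<in> ?q" "r \<in> ?q"
      then show "(of_real (\<Lambda> * sin (fst s)) * sph_harm_at l m (chart s)) *
         (of_real (sin (fst r)) * (of_real (C (chart r) (chart s)) * cnj (sph_harm_at k n (chart r)))) = h (s, r)"
        by (simp add: h_def s1_def s2_def f_def YZ cov_commute[of "chart r"] mult_ac)
    qed
    also have "\<dots> = integral ?B h" by (rule integral_prod_continuous[symmetric]) (rule cont[OF dh])
    finally show ?thesis ..
  qed
  ultimately show ?thesis using \<Lambda> by simp
qed

section \<open>Disjointness of the classes, their union and the final statement\<close>

lemma sph_harm_product:
  "sph_harm l m \<theta>1 \<phi>1 * cnj (sph_harm l m' \<theta>2 \<phi>2) =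
    of_real ((2 * real l + 1) / (4 * pi)
      * sqrt ((fact (nat (int l - m)) * fact (nat (int l - m'))) / (fact (nat (int l + m)) * fact (nat (int l + m')))))
    * exp (\<i> * of_real (of_int m * \<phi>1 - of_int m' * \<phi>2))
    * of_real (assoc_legendre l m (cos \<theta>1) * assoc_legendre l m' (cos \<theta>2))"
proof -
  have q: "(2 * real l + 1) * a / (4 * pi * b) = (2 * real l + 1) / (4 * pi) * (a / b)" for a b by simp
  have "sqrt ((2 * real l + 1) * a / (4 * pi * b)) * sqrt ((2 * real l + 1) * a' / (4 * pi * b'))
      = (2 * real l + 1) / (4 * pi) * sqrt ((a * a') / (b * b'))" for a a' b b' :: real
    unfolding q real_sqrt_mult real_sqrt_divide
    by (simp add: field_simps)
  then have s: "complex_of_real (sqrt ((2 * real l + 1) * a / (4 * pi * b))) * of_real (sqrt ((2 * real l + 1) * a' / (4 * pi * b')))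
      = of_real ((2 * real l + 1) / (4 * pi) * sqrt ((a * a') / (b * b')))" for a a' b b' :: real
    by (simp only: of_real_mult[symmetric])
  have e: "exp (\<i> * of_int m * of_real \<phi>1) * cnj (exp (\<i> * of_int m' * of_real \<phi>2))
      = exp (\<i> * of_real (of_int m * \<phi>1 - of_int m' * \<phi>2))"
    by (simp add: exp_cnj exp_add[symmetric] algebra_simps)
  have "sph_harm l m \<theta>1 \<phi>1 * cnj (sph_harm l m' \<theta>2 \<phi>2)
     = (of_real (sqrt ((2 * real l + 1) * fact (nat (int l - m)) / (4 * pi * fact (nat (int l + m)))))
       * of_real (sqrt ((2 * real l + 1) * fact (nat (int l - m')) / (4 * pi * fact (nat (int l + m'))))))
       * (exp (\<i> * of_int m * of_real \<phi>1) * cnj (exp (\<i> * of_int m' * of_real \<phi>2)))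
       * of_real (assoc_legendre l m (cos \<theta>1) * assoc_legendre l m' (cos \<theta>2))"
    by (simp only: sph_harm_def complex_cnj_mult complex_cnj_complex_of_real of_real_mult mult_ac)
  then show ?thesis unfolding s e .
qed

lemma isotropic_not_diagonal_anisotropic:
  assumes "expanded_field M T" and iso: "isotropic M T"
  shows "\<not> diagonal_anisotropic M T"
proof
  assume "diagonal_anisotropic M T"
  then obtain d :: "nat \<Rightarrow> int \<Rightarrow> complex" and l m m' where
    d: "\<forall>l l'. \<forall>m\<in>{- int l..int l}. \<forall>m'\<in>{- int l'..int l'}.
          spectrum M T l l' m m' = (if l = l' \<and> m = m' then d l m else 0)"
    and m: "m \<in> {- int l..int l}" "m' \<in> {- int l..int l}" "d l m \<noteq> d l m'"
    unfolding diagonal_anisotropic_def by blast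
  obtain c where c: "\<forall>l l'. \<forall>m\<in>{- int l..int l}. \<forall>m'\<in>{- int l'..int l'}.
     spectrum M T l l' m m' = (if l = l' \<and> m = m' then c l else 0)"
    using isotropic_spectrum[OF assms] by blast
  have "d l n = c l" if "n \<in> {- int l..int l}" for n
    using d[rule_format, OF that that] c[rule_format, OF that that] by simp
  then show False using m by simp
qed

text \<open>On the admissible orders \<open>Ct\<close> is the spectrum itself, so a nonzero
  off-diagonal entry contradicts diagonality. Both isotropic and diagonal anisotropic fields have
  such a diagonal spectrum.\<close>

lemma diagonal_not_harmonic_order_dependent:
  assumes d: "\<And>l l' m m'. m \<in> {- int l..int l} \<Longrightarrow> m' \<in> {- int l'..int l'} \<Longrightarrow>
      spectrum M T l l' m m' = (if l = l' \<and> m = m' then d l m else 0)"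
  shows "\<not> harmonic_order_dependent M T"
proof
  assume "harmonic_order_dependent M T"
  then obtain Ct l m m' where Ct: "degree_diagonal_spectrum M T Ct"
    and m: "m \<in> {- int l..int l}" "m' \<in> {- int l..int l}" "m \<noteq> m'" "Ct l m m' \<noteq> 0"
    unfolding harmonic_order_dependent_def by blast
  have "spectrum M T l l m m' = Ct l m m'"
    using Ct m(1,2) by (simp add: degree_diagonal_spectrum_def)
  then show False using d[OF m(1,2)] m(3,4) by simp
qed

text \<open>For the converse, a nonzero off-diagonal entry gives the harmonic order-dependent class.
  If there is none, unequal diagonal entries within a degree give the diagonal anisotropic class,
  and otherwise the spectrum is scalar on each degree, which means isotropy.\<close>

lemma isotropic_or_anisotropic_iff:
  assumes ef: "expanded_field M T"
  shows "isotropic M T \<or> diagonal_anisotropic M T \<or> harmonic_order_dependent M T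
    \<longleftrightarrow> (\<exists>Ct. degree_diagonal_spectrum M T Ct)" (is "?L \<longleftrightarrow> ?R")
proof
  assume ?L
  then consider (iso) "isotropic M T" | (diag) "diagonal_anisotropic M T" | (hod) "harmonic_order_dependent M T" by blast
  then show ?R
  proof cases
    case iso
    then obtain c where "\<forall>l l'. \<forall>m\<in>{- int l..int l}. \<forall>m'\<in>{- int l'..int l'}.
       spectrum M T l l' m m' = (if l = l' \<and> m = m' then c l else 0)"
      using isotropic_spectrum[OF ef] by blast
    then have "degree_diagonal_spectrum M T (\<lambda>l m m'. if m = m' then c l else 0)"
      by (simp add: degree_diagonal_spectrum_def)
    then show ?thesis by blast
  next
    case diag
    then obtain d :: "nat \<Rightarrow> int \<Rightarrow> complex" where "\<forall>l l'. \<forall>m\<in>{- int l..int l}. \<forall>m'\<in>{- int l'..int l'}.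
        spectrum M T l l' m m' = (if l = l' \<and> m = m' then d l m else 0)"
      unfolding diagonal_anisotropic_def by blast
    then have "degree_diagonal_spectrum M T (\<lambda>l m m'. if m = m' then d l m else 0)"
      by (simp add: degree_diagonal_spectrum_def)
    then show ?thesis by blast
  next
    case hod
    then show ?thesis unfolding harmonic_order_dependent_def by blast
  qed
next
  assume ?R
  then obtain Ct where D: "degree_diagonal_spectrum M T Ct" ..
  then have S: "spectrum M T l l' m m' = (if l = l' then Ct l m m' else 0)"
    if "m \<in> {- int l..int l}" "m' \<in> {- int l'..int l'}" for l l' m m'
    using that by (simp add: degree_diagonal_spectrum_def)
  show ?L
  proof (cases "\<exists>l. \<exists>m\<in>{- int l..int l}. \<exists>m'\<in>{- int l..int l}. m \<noteq> m' \<and> Ct l m m' \<noteq> 0")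
    case True
    then show ?thesis using D unfolding harmonic_order_dependent_def by blast
  next
    case off: False
    have S': "spectrum M T l l' m m' = (if l = l' \<and> m = m' then Ct l m m else 0)"
      if "m \<in> {- int l..int l}" "m' \<in> {- int l'..int l'}" for l l' m m'
    proof -
      have "Ct l m m' = 0" if "l = l'" "m \<noteq> m'" using off \<open>m \<in> _\<close> \<open>m' \<in> _\<close> that by blast
      then show ?thesis using S[OF that] by auto
    qed
    show ?thesis
    proof (cases "\<exists>l. \<exists>m\<in>{- int l..int l}. \<exists>m'\<in>{- int l..int l}. m \<noteq> m' \<and> Ct l m m \<noteq> Ct l m' m'")
      case True
      then have "diagonal_anisotropic M T"
        unfolding diagonal_anisotropic_def using S'
        by (intro exI[of _ "\<lambda>l m. Ct l m m"] conjI allI ballI) simp_all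
      then show ?thesis by blast
    next
      case False
      \<comment> \<open>Every diagonal entry is compared with that of order 0, which occurs in each
        degree.\<close>
      have const: "Ct l m m = Ct l 0 0" if "m \<in> {- int l..int l}" for l m
      proof -
        have "(0 :: int) \<in> {- int l..int l}" by simp
        with False that show ?thesis by metis
      qed
      have "isotropic M T"
      proof (rule scalar_spectrum_isotropic[OF ef, where c = "\<lambda>l. Ct l 0 0"])
        fix l l' :: nat and m m' :: int
        assume m: "m \<in> {- int l..int l}" "m' \<in> {- int l'..int l'}"
        show "spectrum M T l l' m m' = (if l = l' \<and> m = m' then Ct l 0 0 else 0)"
          unfolding S'[OF m] const[OF m(1)] ..
      qed
      then show ?thesis by blast
    qed
  qed
qed

theorem proposition6:
  fixes M :: "'w measure" and T :: "'w \<Rightarrow> real ^ 3 \<Rightarrow> real"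
  assumes "spherical_random_field M T" and "harmonic_expansion M T"
  shows "\<not> (isotropic M T \<and> diagonal_anisotropic M T)
    \<and> \<not> (isotropic M T \<and> harmonic_order_dependent M T)
    \<and> \<not> (diagonal_anisotropic M T \<and> harmonic_order_dependent M T)
    \<and> ((isotropic M T \<or> diagonal_anisotropic M T \<or> harmonic_order_dependent M T)
         \<longleftrightarrow> (\<exists>Ct. degree_diagonal_spectrum M T Ct))
    \<and> (\<forall>Ct. degree_diagonal_spectrum M T Ct \<longrightarrow>
         (\<forall>\<theta>1\<in>{0..pi}. \<forall>\<phi>1\<in>{0..<2*pi}. \<forall>\<theta>2\<in>{0..pi}. \<forall>\<phi>2\<in>{0..<2*pi}.
           (\<lambda>l. \<Sum>m = - int l..int l. \<Sum>m' = - int l..int l.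
              of_real ((2 * real l + 1) / (4 * pi)
                * sqrt ((fact (nat (int l - m)) * fact (nat (int l - m')))
                        / (fact (nat (int l + m)) * fact (nat (int l + m')))))
              * Ct l m m'
              * exp (\<i> * of_real (of_int m * \<phi>1 - of_int m' * \<phi>2))
              * of_real (assoc_legendre l m (cos \<theta>1) * assoc_legendre l m' (cos \<theta>2)))
           sums complex_of_real (cov_fun M T (sph_point \<theta>1 \<phi>1) (sph_point \<theta>2 \<phi>2))))
    \<and> (twice_differentiable_sphere (cov_fun M T) \<longrightarrow>
         ((isotropic M T \<or> diagonal_anisotropic M T \<or> harmonic_order_dependent M T)
           \<longleftrightarrow> (\<forall>x1\<in>S2. \<forall>x2\<in>S2.
                 laplace_beltrami (\<lambda>x. cov_fun M T x x2) x1
               = laplace_beltrami (\<lambda>x. cov_fun M T x1 x) x2)))"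
proof -
  have "prob_space M" using assms(1) by (simp add: spherical_random_field_def)
  then have ef: "expanded_field M T"
    using assms by (intro expanded_field.intro expanded_field_axioms.intro)
  note classes = isotropic_or_anisotropic_iff[OF ef]
  have iso_hod: "\<not> (isotropic M T \<and> harmonic_order_dependent M T)"
  proof
    assume *: "isotropic M T \<and> harmonic_order_dependent M T"
    then obtain c where "\<forall>l l'. \<forall>m\<in>{- int l..int l}. \<forall>m'\<in>{- int l'..int l'}.
       spectrum M T l l' m m' = (if l = l' \<and> m = m' then c l else 0)"
      using isotropic_spectrum[OF ef] by blast
    then show False using diagonal_not_harmonic_order_dependent[of M T "\<lambda>l m. c l"] * by simp
  qed
  have diag_hod: "\<not> (diagonal_anisotropic M T \<and> harmonic_order_dependent M T)"
  proof
    assume *: "diagonal_anisotropic M T \<and> harmonic_order_dependent M T"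
    then obtain d :: "nat \<Rightarrow> int \<Rightarrow> complex" where "\<forall>l l'. \<forall>m\<in>{- int l..int l}. \<forall>m'\<in>{- int l'..int l'}.
        spectrum M T l l' m m' = (if l = l' \<and> m = m' then d l m else 0)"
      unfolding diagonal_anisotropic_def by blast
    then show False using diagonal_not_harmonic_order_dependent[of M T d] * by simp
  qed
  have rep: "(\<lambda>l. \<Sum>m = - int l..int l. \<Sum>m' = - int l..int l.
              of_real ((2 * real l + 1) / (4 * pi)
                * sqrt ((fact (nat (int l - m)) * fact (nat (int l - m')))
                        / (fact (nat (int l + m)) * fact (nat (int l + m')))))
              * Ct l m m'
              * exp (\<i> * of_real (of_int m * \<phi>1 - of_int m' * \<phi>2))
              * of_real (assoc_legendre l m (cos \<theta>1) * assoc_legendre l m' (cos \<theta>2)))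
           sums complex_of_real (cov_fun M T (sph_point \<theta>1 \<phi>1) (sph_point \<theta>2 \<phi>2))"
    (is "?F sums _")
    if D: "degree_diagonal_spectrum M T Ct" and \<theta>: "\<theta>1 \<in> {0..pi}" "\<theta>2 \<in> {0..pi}" for Ct \<theta>1 \<phi>1 \<theta>2 \<phi>2
  proof -
    have "?F = (\<lambda>l. \<Sum>m=- int l..int l. \<Sum>m'=- int l..int l.
        Ct l m m' * (sph_harm_at l m (sph_point \<theta>1 \<phi>1) * cnj (sph_harm_at l m' (sph_point \<theta>2 \<phi>2))))"
      by (intro ext sum.cong refl)
        (simp only: sph_harm_at_sph_point[OF \<theta>(1)] sph_harm_at_sph_point[OF \<theta>(2)] sph_harm_product mult_ac)
    then show ?thesis
      using expanded_field.cov_sums[OF ef D sph_point_in_S2 sph_point_in_S2, of \<theta>1 \<phi>1 \<theta>2 \<phi>2] by simp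
  qed
  have lap: "(\<exists>Ct. degree_diagonal_spectrum M T Ct) \<longleftrightarrow> (\<forall>x1\<in>S2. \<forall>x2\<in>S2.
      laplace_beltrami (\<lambda>x. cov_fun M T x x2) x1 = laplace_beltrami (\<lambda>x. cov_fun M T x1 x) x2)"
    (is "?D \<longleftrightarrow> ?L") if td: "twice_differentiable_sphere (cov_fun M T)"
  proof
    assume ?D
    then obtain Ct where "degree_diagonal_spectrum M T Ct" ..
    from degree_diagonal_laplace_beltrami[OF ef this td] show ?L by blast
  next
    assume L: ?L
    \<comment> \<open>The diagonal blocks of the spectrum are the only possible witness on the
      admissible orders, so only the vanishing between different degrees remains.\<close>
    have "degree_diagonal_spectrum M T (\<lambda>l m m'. spectrum M T l l m m')"
      unfolding degree_diagonal_spectrum_def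
    proof (intro allI ballI)
      fix l l' :: nat and m m' :: int
      assume m: "m \<in> {- int l..int l}" "m' \<in> {- int l'..int l'}"
      have "spectrum M T l l' m m' = 0" if "l \<noteq> l'"
        using laplace_beltrami_degree_diagonal[OF ef td L[rule_format] m(2) m(1)] that by blast
      then show "spectrum M T l l' m m' = (if l = l' then spectrum M T l l m m' else 0)" by auto
    qed
    then show ?D by blast
  qed
  show ?thesis
    using isotropic_not_diagonal_anisotropic[OF ef] iso_hod diag_hod classes rep lap by blast
qed

end
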